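(* Let $A$ be a non-zero sum Heffter array $\mathrm{NH}(m,n;h,k)$ that is simple with respect to the compatible orderings $\omega_r$ (of the rows) and $\omega_c$ (of the columns). Then there exists a cellular biembedding of the circuit decompositions $\mathcal{C}(\mathcal{D}_{\omega_r^{-1}})$ and $\mathcal{C}(\mathcal{D}_{\omega_c})$ of $K_{2nk+1}$ into an orientable surface.
   Context: A partially filled (p.f.) array is a matrix in which some cells may be empty. Let $m\ge k\ge1$, $n\ge h\ge1$ with $mh=nk$, and put $v=2nk+1$. An $\mathrm{NH}(m,n;h,k)$ is an $m\times n$ p.f. array $A$ with entries in $\mathbb{Z}_{v}$ such that: (a) each row contains exactly $h$ filled cells and each column exactly $k$ filled cells; (b) the multiset $\{\pm x\mid x\in A\}$ contains each element of $\mathbb{Z}_v\setminus\{0\}$ exactly once; (c) the sum of the elements in every row and in every column is different from $0$ in $\mathbb{Z}_v$. Let $\mathcal{E}(A)$ be the set of entries of $A$. For a finite subset $T$ of an abelian group, an ordering $(t_1,\dots,t_\ell)$ of the elements of $T$ is simple if no proper nonempty subsequence of consecutive terms sums to $0$. When the total sum is non-zero, this is equivalent to $0,s_1,\dots,s_\ell$ being pairwise distinct, where $s_i=\sum_{j=1}^i t_j$. That $A$ is simple with respect to $\omega_r$ and $\omega_c$ means that simple orderings $\omega_{R_1},\dots,\omega_{R_m}$ of the entries of the rows and simple orderings $\omega_{C_1},\dots,\omega_{C_n}$ of the entries of the columns are given, with $\omega_r=\omega_{R_1}\circ\cdots\circ\omega_{R_m}$ and $\omega_c=\omega_{C_1}\circ\cdots\circ\omega_{C_n}$.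 Each ordering $(t_1,\dots,t_\ell)$ is also regarded as the cyclic permutation $t_1\mapsto t_2\mapsto\cdots\mapsto t_\ell\mapsto t_1$, so that $\omega_r,\omega_c$ are permutations of $\mathcal{E}(A)$. They are compatible if $\omega_c\circ\omega_r$ is a cycle of length $|\mathcal{E}(A)|$. The ordering $\omega_r^{-1}$ is obtained by reversing each row ordering, i.e. replacing $(t_1,\dots,t_h)$ by $(t_h,\dots,t_1)$. Identify $V(K_v)$ with $\mathbb{Z}_v$. Given simple orderings $\omega$ of all the rows (or of all the columns), $\mathcal{D}_\omega$ is the decomposition of $K_v$ into paths consisting of all translates by elements of $\mathbb{Z}_v$ of the paths $[0,s_1,s_2,\dots,s_\ell]$, one for each row (resp. column), where $s_1,\dots,s_\ell$ are the partial sums of the chosen ordering of that row (resp. column). Given a cyclic path decomposition $\mathcal{D}$ of $K_v$ (a decomposition into paths invariant under translation by $\mathbb{Z}_v$) and $P=(x_0,x_1,\dots,x_\ell)\in\mathcal{D}$, let $\lambda_P$ be the minimum positive integer with $\lambda_P(x_\ell-x_0)=0$ in $\mathbb{Z}_v$, and let $C_P=\bigcup_{i=0}^{\lambda_P-1}\bigl(P+i(x_\ell-x_0)\bigr)$, which is a circuit (closed trail: no repeated edge, vertices may repeat). Then $\mathcal{C}(\mathcal{D})=\{C_P : P\in\mathcal{D}\}$ (as a set, without repetition), which is a decomposition of $K_v$ into circuits. An embedding of a graph $\Gamma$ in a surface $\Sigma$ is a continuous injective map $\psi:\Gamma\to\Sigma$ ($\Gamma$ viewed as a 1-dimensional simplicial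 complex). Its faces are the connected components of $\Sigma\setminus\psi(\Gamma)$, and it is cellular if each face is homeomorphic to an open disc. A biembedding of two circuit decompositions $\mathcal{D}$ and $\mathcal{D}'$ of $\Gamma$ is a face 2-colorable embedding of $\Gamma$ (faces colored with two colors so that each edge lies on the boundary of one face of each color) such that the boundaries of the faces in one color class are the circuits of $\mathcal{D}$ and those in the other color class are the circuits of $\mathcal{D}'$. *)

theory Defs
  imports
    "HOL-Complex_Analysis.Complex_Analysis"
    "HOL-Combinatorics.Combinatorics"
    "HOL-Library.Multiset"
    "HOL-Library.Sublist"
begin

section \<open>Non-zero sum Heffter arrays\<close>

text \<open>
  Throughout, the group of integers modulo \<open>v\<close> is represented by the residues
  \<open>{0..<v}\<close> of type \<^typ>\<open>int\<close>, with addition followed by reduction mod \<open>v\<close>.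
  A partially filled array is a function \<open>A\<close> with \<open>A i j = None\<close> for an empty cell;
  only the cells with \<open>i < m\<close> and \<open>j < n\<close> matter.
\<close>

type_synonym pf_array = "nat \<Rightarrow> nat \<Rightarrow> int option"

definition filled_cells :: "nat \<Rightarrow> nat \<Rightarrow> pf_array \<Rightarrow> (nat \<times> nat) set" where
  "filled_cells m n A = {(i, j). i < m \<and> j < n \<and> A i j \<noteq> None}"

definition entry :: "pf_array \<Rightarrow> nat \<times> nat \<Rightarrow> int" where
  "entry A c = the (A (fst c) (snd c))"

definition row_cells :: "nat \<Rightarrow> nat \<Rightarrow> pf_array \<Rightarrow> nat \<Rightarrow> (nat \<times> nat) set" where
  "row_cells m n A i = {c \<in> filled_cells m n A. fst c = i}"

definition col_cells :: "nat \<Rightarrow> nat \<Rightarrow> pf_array \<Rightarrow> nat \<Rightarrow> (nat \<times> nat) set" where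
  "col_cells m n A j = {c \<in> filled_cells m n A. snd c = j}"

definition entries :: "nat \<Rightarrow> nat \<Rightarrow> pf_array \<Rightarrow> int set" where
  "entries m n A = entry A ` filled_cells m n A"

definition NH :: "nat \<Rightarrow> nat \<Rightarrow> nat \<Rightarrow> nat \<Rightarrow> pf_array \<Rightarrow> bool" where
  "NH m n h k A \<longleftrightarrow>
     (let v = 2 * int n * int k + 1 in
       entries m n A \<subseteq> {0..<v} \<and>
       (\<forall>i<m. card (row_cells m n A i) = h) \<and>
       (\<forall>j<n. card (col_cells m n A j) = k) \<and>
       (\<forall>z\<in>{0..<v} - {0}.
          count (\<Sum>c\<in>filled_cells m n A. {# entry A c, (- entry A c) mod v #}) z = 1) \<and>
       (\<forall>i<m. (\<Sum>c\<in>row_cells m n A i. entry A c) mod v \<noteq> 0) \<and>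
       (\<forall>j<n. (\<Sum>c\<in>col_cells m n A j. entry A c) mod v \<noteq> 0))"

section \<open>Simple and compatible orderings\<close>

definition simple_ordering :: "int \<Rightarrow> int set \<Rightarrow> int list \<Rightarrow> bool" where
  "simple_ordering v T ts \<longleftrightarrow>
     distinct ts \<and> set ts = T \<and>
     (\<forall>us. sublist us ts \<and> us \<noteq> [] \<and> us \<noteq> ts \<longrightarrow> sum_list us mod v \<noteq> 0)"

text \<open>
  The orderings of all rows (columns) are given by a function \<open>\<omega>\<close>
  assigning a list to each row (column) index.
\<close>

definition simple_row_orderings ::
    "int \<Rightarrow> nat \<Rightarrow> nat \<Rightarrow> pf_array \<Rightarrow> (nat \<Rightarrow> int list) \<Rightarrow> bool" where
  "simple_row_orderings v m n A \<omega> \<longleftrightarrow>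
     (\<forall>i<m. simple_ordering v (entry A ` row_cells m n A i) (\<omega> i))"

definition simple_col_orderings ::
    "int \<Rightarrow> nat \<Rightarrow> nat \<Rightarrow> pf_array \<Rightarrow> (nat \<Rightarrow> int list) \<Rightarrow> bool" where
  "simple_col_orderings v m n A \<omega> \<longleftrightarrow>
     (\<forall>j<n. simple_ordering v (entry A ` col_cells m n A j) (\<omega> j))"

definition ordering_perm :: "nat \<Rightarrow> (nat \<Rightarrow> int list) \<Rightarrow> int \<Rightarrow> int" where
  "ordering_perm l \<omega> = foldr (\<circ>) (map (\<lambda>i. cycle_of_list (\<omega> i)) [0..<l]) id"

definition compatible ::
    "nat \<Rightarrow> nat \<Rightarrow> pf_array \<Rightarrow> (nat \<Rightarrow> int list) \<Rightarrow> (nat \<Rightarrow> int list) \<Rightarrow> bool" where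
  "compatible m n A \<omega>r \<omega>c \<longleftrightarrow>
     cyclic_on (ordering_perm n \<omega>c \<circ> ordering_perm m \<omega>r) (entries m n A)"

definition reverse_ordering :: "(nat \<Rightarrow> int list) \<Rightarrow> nat \<Rightarrow> int list" where
  "reverse_ordering \<omega> = (\<lambda>i. rev (\<omega> i))"

section \<open>Path and circuit decompositions\<close>

definition complete_edges :: "'a set \<Rightarrow> 'a set set" where
  "complete_edges V = {{x, y} | x y. x \<in> V \<and> y \<in> V \<and> x \<noteq> y}"

definition partial_sums :: "int list \<Rightarrow> int list" where
  "partial_sums ts = map (\<lambda>j. sum_list (take j ts)) [0..<Suc (length ts)]"

definition translate :: "int \<Rightarrow> int \<Rightarrow> int list \<Rightarrow> int list" where
  "translate v a P = map (\<lambda>x. (x + a) mod v) P"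

definition path_decomposition :: "int \<Rightarrow> nat \<Rightarrow> (nat \<Rightarrow> int list) \<Rightarrow> int list set" where
  "path_decomposition v l \<omega> = {translate v a (partial_sums (\<omega> i)) | a i. a \<in> {0..<v} \<and> i < l}"

text \<open>
  A closed walk through \<open>x\<^sub>0, \<dots>, x\<^sub>l\<^sub>-\<^sub>1\<close> and back to \<open>x\<^sub>0\<close> is given by the
  list of these \<open>l\<close> vertices (the first one is not repeated at the end).  The circuit it
  represents does not depend on the starting point and the direction, so a circuit is the
  class of all lists obtained by rotation and reversal.
\<close>

definition circuit :: "'a list \<Rightarrow> 'a list set" where
  "circuit c = {rotate j c | j. True} \<union> {rotate j (rev c) | j. True}"

definition walk_edges :: "'a list \<Rightarrow> 'a set list" where
  "walk_edges c = map (\<lambda>j. {c ! j, c ! (Suc j mod length c)}) [0..<length c]"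

definition closed_trail :: "'a set set \<Rightarrow> 'a list \<Rightarrow> bool" where
  "closed_trail E c \<longleftrightarrow> c \<noteq> [] \<and> set (walk_edges c) \<subseteq> E \<and> distinct (walk_edges c)"

definition circuit_decomposition :: "'a set set \<Rightarrow> 'a list set set \<Rightarrow> bool" where
  "circuit_decomposition E \<D> \<longleftrightarrow>
     (\<forall>C\<in>\<D>. \<exists>c. C = circuit c \<and> closed_trail E c) \<and>
     (\<forall>e\<in>E. \<exists>!C. C \<in> \<D> \<and> (\<exists>c\<in>C. e \<in> set (walk_edges c)))"

definition path_period :: "int \<Rightarrow> int list \<Rightarrow> nat" where
  "path_period v P = (LEAST l. 0 < l \<and> (int l * (last P - hd P)) mod v = 0)"

definition path_circuit :: "int \<Rightarrow> int list \<Rightarrow> int list set" where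
  "path_circuit v P =
     circuit (concat (map (\<lambda>i. translate v (int i * (last P - hd P)) (butlast P))
                          [0..<path_period v P]))"

definition circuits_of :: "int \<Rightarrow> int list set \<Rightarrow> int list set set" where
  "circuits_of v \<D> = path_circuit v ` \<D>"

section \<open>Orientable surfaces\<close>

definition chart :: "'b topology \<Rightarrow> 'b set \<Rightarrow> ('b \<Rightarrow> complex) \<Rightarrow> bool" where
  "chart S U \<phi> \<longleftrightarrow>
     openin S U \<and> open (\<phi> ` U) \<and>
     homeomorphic_map (subtopology S U) (top_of_set (\<phi> ` U)) \<phi>"

text \<open>
  Second countability is not listed, as it follows from compactness.
\<close>

definition surface :: "'b topology \<Rightarrow> bool" where
  "surface S \<longleftrightarrow>
     compact_space S \<and> connected_space S \<and> Hausdorff_space S \<and>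
     (\<forall>p\<in>topspace S. \<exists>U \<phi>. p \<in> U \<and> chart S U \<phi>)"

text \<open>
  A homeomorphism \<open>f\<close> between open subsets of the plane preserves orientation if it has local
  degree 1 at each point \<open>z\<close>, i.e. small positively oriented circles around \<open>z\<close> are mapped to
  curves winding once, in the positive direction, around \<open>f z\<close>.
\<close>

definition orientation_preserving :: "complex set \<Rightarrow> (complex \<Rightarrow> complex) \<Rightarrow> bool" where
  "orientation_preserving G f \<longleftrightarrow>
     (\<forall>z r. 0 < r \<and> cball z r \<subseteq> G \<longrightarrow> winding_number (f \<circ> circlepath z r) (f z) = 1)"

definition orientable :: "'b topology \<Rightarrow> bool" where
  "orientable S \<longleftrightarrow>
     (\<exists>\<A>. (\<forall>(U, \<phi>)\<in>\<A>. chart S U \<phi>) \<and> topspace S = (\<Union>(U, \<phi>)\<in>\<A>. U) \<and>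
          (\<forall>(U, \<phi>)\<in>\<A>. \<forall>(W, \<theta>)\<in>\<A>.
             orientation_preserving (\<phi> ` (U \<inter> W)) (\<theta> \<circ> inv_into U \<phi>)))"

section \<open>Embeddings and biembeddings\<close>

text \<open>
  The geometric realization, in barycentric coordinates, of a finite simple graph with vertex
  set \<open>V\<close> and edge set \<open>E\<close>; it carries the topology of pointwise convergence.
\<close>

definition realization :: "'a set \<Rightarrow> 'a set set \<Rightarrow> ('a \<Rightarrow> real) set" where
  "realization V E =
     {w. (\<forall>x. 0 \<le> w x) \<and> (\<Sum>x\<in>V. w x) = 1 \<and>
         (\<exists>s \<in> E \<union> (\<lambda>x. {x}) ` V. \<forall>x. w x \<noteq> 0 \<longrightarrow> x \<in> s)}"

definition edge_realization :: "'a set \<Rightarrow> 'a set set \<Rightarrow> 'a set \<Rightarrow> ('a \<Rightarrow> real) set" where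
  "edge_realization V E e = {w \<in> realization V E. \<forall>x. w x \<noteq> 0 \<longrightarrow> x \<in> e}"

definition edge_point :: "'a \<Rightarrow> 'a \<Rightarrow> real \<Rightarrow> 'a \<Rightarrow> real" where
  "edge_point x y t = (\<lambda>u. (if u = x then 1 - t else 0) + (if u = y then t else 0))"

definition graph_embedding ::
    "'a set \<Rightarrow> 'a set set \<Rightarrow> 'b topology \<Rightarrow> (('a \<Rightarrow> real) \<Rightarrow> 'b) \<Rightarrow> bool" where
  "graph_embedding V E S \<psi> \<longleftrightarrow>
     continuous_map (top_of_set (realization V E)) S \<psi> \<and> inj_on \<psi> (realization V E)"

definition faces ::
    "'a set \<Rightarrow> 'a set set \<Rightarrow> 'b topology \<Rightarrow> (('a \<Rightarrow> real) \<Rightarrow> 'b) \<Rightarrow> 'b set set" where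
  "faces V E S \<psi> =
     connected_components_of (subtopology S (topspace S - \<psi> ` realization V E))"

definition cellular ::
    "'a set \<Rightarrow> 'a set set \<Rightarrow> 'b topology \<Rightarrow> (('a \<Rightarrow> real) \<Rightarrow> 'b) \<Rightarrow> bool" where
  "cellular V E S \<psi> \<longleftrightarrow>
     (\<forall>F\<in>faces V E S \<psi>.
        subtopology S F homeomorphic_space top_of_set (ball (0::complex) 1))"

text \<open>
  The boundary of the (open disc) face \<open>F\<close> is the circuit \<open>C\<close> if there is a map of
  the closed disc into the surface which is a homeomorphism from the open disc onto \<open>F\<close> and
  along the unit circle, divided into \<open>l\<close> equal arcs, runs through the \<open>l\<close> consecutive
  edges of \<open>C\<close>.
\<close>

definition face_boundary ::
    "'b topology \<Rightarrow> (('a \<Rightarrow> real) \<Rightarrow> 'b) \<Rightarrow> 'b set \<Rightarrow> 'a list set \<Rightarrow> bool" where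
  "face_boundary S \<psi> F C \<longleftrightarrow>
     (\<exists>c g. C = circuit c \<and> c \<noteq> [] \<and>
        continuous_map (top_of_set (cball (0::complex) 1)) S g \<and>
        homeomorphic_map (top_of_set (ball 0 1)) (subtopology S F) g \<and>
        (\<forall>j<length c. \<forall>t\<in>{0..1}.
           g (cis (2 * pi * (real j + t) / real (length c))) =
           \<psi> (edge_point (c ! j) (c ! (Suc j mod length c)) t)))"

definition on_boundary ::
    "'a set \<Rightarrow> 'a set set \<Rightarrow> 'b topology \<Rightarrow> (('a \<Rightarrow> real) \<Rightarrow> 'b) \<Rightarrow> 'a set \<Rightarrow> 'b set \<Rightarrow> bool" where
  "on_boundary V E S \<psi> e F \<longleftrightarrow> \<psi> ` edge_realization V E e \<subseteq> S frontier_of F"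

definition biembedding ::
    "'a set \<Rightarrow> 'a set set \<Rightarrow> 'a list set set \<Rightarrow> 'a list set set \<Rightarrow>
     'b topology \<Rightarrow> (('a \<Rightarrow> real) \<Rightarrow> 'b) \<Rightarrow> bool" where
  "biembedding V E \<D> \<D>' S \<psi> \<longleftrightarrow>
     circuit_decomposition E \<D> \<and> circuit_decomposition E \<D>' \<and>
     graph_embedding V E S \<psi> \<and>
     (\<exists>\<B> \<W>. \<B> \<union> \<W> = faces V E S \<psi> \<and> \<B> \<inter> \<W> = {} \<and>
        (\<forall>e\<in>E. (\<exists>!F. F \<in> \<B> \<and> on_boundary V E S \<psi> e F) \<and>
               (\<exists>!F. F \<in> \<W> \<and> on_boundary V E S \<psi> e F)) \<and>
        (\<exists>\<beta>. bij_betw \<beta> \<B> \<D> \<and> (\<forall>F\<in>\<B>. face_boundary S \<psi> F (\<beta> F))) \<and>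
        (\<exists>\<gamma>. bij_betw \<gamma> \<W> \<D>' \<and> (\<forall>F\<in>\<W>. face_boundary S \<psi> F (\<gamma> F))))"

end

(*
Orient every edge of the complete graph as (x, x + t) with t an entry of the array. A circuit
of the row decomposition continues the arc (x, x + t) by the predecessor of t in its row, a
circuit of the column decomposition by the successor of t in its column; each arc lies on exactly
one circuit of either kind. Take one closed disc per circuit and glue their boundaries along the
graph. At every vertex x the corners of the discs alternate in colour, and passing a black and
a white corner leads from the arc with difference t to the one with difference
omega_c (omega_r t). Since omega_c o omega_r is a single cycle, the corners at x fit together to
one disc, so that the quotient is a closed surface.

The surface is a branched covering of the sphere: the black discs of length l are mapped by
z ^ l, the white ones by 1 / cnj z ^ l, and these maps agree on the graph, which goes to the unit
circle. With face charts z and cnj z, and vertex charts in which the covering becomes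
exp (c u ^ N), the transition maps are lifts of one holomorphic map through another, hence
holomorphic; injective holomorphic maps have local degree 1, and so the surface is orientable.
*)

theory Submission
  imports Defs
begin

section \<open>Charts with holomorphic transition maps\<close>

text \<open>Orientability is the clause that shapes the construction: it demands winding number 1
  for all transition maps, and explicit transitions between a vertex chart and a face chart would
  involve branches of logarithms and roots. Composing the charts with the covering \<open>w\<close>
  leaves only powers and exponentials, and a continuous injective solution \<open>h\<close> of
  \<open>w \<circ> \<Phi> \<circ> h = w \<circ> \<Psi>\<close> is holomorphic wherever the
  derivative of \<open>w \<circ> \<Phi>\<close> does not vanish. The possible branch points, namely
  the vertices and the face centres, lie in one chart each, so they never meet the overlap of two
  different charts. Both faces at an edge run along it in the direction of its arc. They would thus
  orient the surface in opposite ways, which is why one colour is conjugated throughout. The surface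
  is to be a topology on \<open>complex\<close>. The plane only supplies names for the points; the
  open sets come from the quotient.\<close>

definition quotient_topology :: "'a topology \<Rightarrow> ('a \<Rightarrow> 'b) \<Rightarrow> 'b topology" where
  "quotient_topology X f =
     topology (\<lambda>U. U \<subseteq> f ` topspace X \<and> openin X {x \<in> topspace X. f x \<in> U})"

lemma openin_quotient_topology:
  "openin (quotient_topology X f) U \<longleftrightarrow>
     U \<subseteq> f ` topspace X \<and> openin X {x \<in> topspace X. f x \<in> U}"
proof -
  have "istopology (\<lambda>U. U \<subseteq> f ` topspace X \<and> openin X {x \<in> topspace X. f x \<in> U})"
    unfolding istopology_def
  proof (intro conjI allI impI)
    fix U V assume *: "U \<subseteq> f ` topspace X \<and> openin X {x \<in> topspace X. f x \<in> U}"
      "V \<subseteq> f ` topspace X \<and> openin X {x \<in> topspace X. f x \<in> V}"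
    have "{x \<in> topspace X. f x \<in> U \<inter> V} = {x \<in> topspace X. f x \<in> U} \<inter> {x \<in> topspace X. f x \<in> V}"
      by auto
    then show "openin X {x \<in> topspace X. f x \<in> U \<inter> V}" using * by auto
  next
    fix \<K> assume *: "\<forall>K\<in>\<K>. K \<subseteq> f ` topspace X \<and> openin X {x \<in> topspace X. f x \<in> K}"
    have "{x \<in> topspace X. f x \<in> \<Union>\<K>} = \<Union>((\<lambda>K. {x \<in> topspace X. f x \<in> K}) ` \<K>)" by auto
    then show "openin X {x \<in> topspace X. f x \<in> \<Union>\<K>}" using * by auto
  qed auto
  then show ?thesis unfolding quotient_topology_def by (simp add: topology_inverse')
qed

lemma topspace_quotient_topology [simp]: "topspace (quotient_topology X f) = f ` topspace X"
proof
  show "topspace (quotient_topology X f) \<subseteq> f ` topspace X"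
    using openin_topspace[of "quotient_topology X f"] by (simp only: openin_quotient_topology)
  have "{x \<in> topspace X. f x \<in> f ` topspace X} = topspace X" by auto
  then have "openin (quotient_topology X f) (f ` topspace X)"
    by (simp add: openin_quotient_topology)
  then show "f ` topspace X \<subseteq> topspace (quotient_topology X f)" by (rule openin_subset)
qed

lemma quotient_map_quotient_topology: "quotient_map X (quotient_topology X f) f"
  by (simp add: quotient_map_def openin_quotient_topology)

text \<open>Normality passes to images under continuous closed maps, and points of the image are
  closed as images of points. This separates the points of the glued space without exhibiting
  neighbourhoods.\<close>

lemma Hausdorff_space_closed_map_image:
  assumes "compact_space X" "Hausdorff_space X" "continuous_map X Y f" "closed_map X Y f"
    and "f ` topspace X = topspace Y"
  shows "Hausdorff_space Y"
proof -
  have "normal_space X"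
    using assms(1,2) by (simp add: compact_Hausdorff_or_regular_imp_normal_space)
  then have "normal_space Y" using assms by (meson normal_space_continuous_closed_map_image)
  moreover have "t1_space Y" unfolding t1_space_closedin_singleton
  proof
    fix y assume "y \<in> topspace Y"
    then obtain x where x: "x \<in> topspace X" "y = f x" using assms(5) by blast
    have "closedin X {x}"
      using assms(2) x by (simp add: Hausdorff_imp_t1_space closedin_t1_singleton)
    then have "closedin Y (f ` {x})" using assms(4) unfolding closed_map_def by blast
    then show "closedin Y {y}" using x by simp
  qed
  ultimately show ?thesis by (simp add: normal_t1_imp_Hausdorff_space)
qed

section \<open>Local degree of injective holomorphic maps, and derivatives of lifts\<close>

text \<open>After substitution the winding number is, up to the factor 1 / (2 pi i), the integral of
  \<open>deriv f u / (f u - f z)\<close>. Injectivity makes the completed difference quotient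
  \<open>Q\<close> zero-free, so the integrand is \<open>g u / (u - z)\<close> with \<open>g\<close>
  holomorphic and \<open>g z = 1\<close>, and Cauchy's formula evaluates it.\<close>

lemma winding_number_injective_holomorphic:
  assumes hol: "f holomorphic_on G" and "open G" and inj: "inj_on f G"
    and "0 < r" and sub: "cball z r \<subseteq> G"
  shows "winding_number (f \<circ> circlepath z r) (f z) = 1"
proof -
  let ?\<gamma> = "circlepath z r"
  define Q where "Q = (\<lambda>w. if w = z then deriv f z else (f w - f z) / (w - z))"
  define g where "g = (\<lambda>w. deriv f w / Q w)"
  have z: "z \<in> G" using assms(4) sub by auto
  have path: "path_image ?\<gamma> \<subseteq> G" "z \<notin> path_image ?\<gamma>" using assms(4) sub by auto
  have ne: "f w \<noteq> f z" if "w \<in> G" "w \<noteq> z" for w using that inj z by (meson inj_onD)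
  have "deriv f z \<noteq> 0" using holomorphic_injective_imp_regular[OF hol assms(2) inj z] .
  then have Q0: "Q w \<noteq> 0" if "w \<in> G" for w using ne that by (simp add: Q_def)
  have "Q holomorphic_on G"
    unfolding Q_def using z assms(2) by (intro pole_lemma[OF hol]) (simp add: interior_open)
  then have g: "g holomorphic_on G"
    unfolding g_def using Q0 hol assms(2) by (intro holomorphic_intros) auto
  have "((\<lambda>u. g u / (u - z)) has_contour_integral (2 * of_real pi * \<i> * g z)) ?\<gamma>"
  proof (rule Cauchy_integral_circlepath)
    show "continuous_on (cball z r) g"
      using holomorphic_on_imp_continuous_on[OF g] sub by (rule continuous_on_subset)
    show "g holomorphic_on ball z r"
      by (rule holomorphic_on_subset[OF g]) (use sub ball_subset_cball in blast)
  qed (use assms(4) in simp)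
  moreover have "g z = 1" using Q0[OF z] by (simp add: g_def Q_def)
  ultimately have int: "contour_integral ?\<gamma> (\<lambda>u. g u / (u - z)) = 2 * of_real pi * \<i>"
    by (simp add: contour_integral_unique)
  have ana: "f analytic_on G" using hol assms(2) by (simp add: analytic_on_open)
  have vfp: "valid_path (f \<circ> ?\<gamma>)" using valid_path_compose_analytic[OF _ ana] path(1) by simp
  have nfp: "f z \<notin> path_image (f \<circ> ?\<gamma>)" using ne path by (force simp: path_image_compose)
  have "winding_number (f \<circ> ?\<gamma>) (f z) =
      1 / (2 * pi * \<i>) * contour_integral (f \<circ> ?\<gamma>) (\<lambda>w. 1 / (w - f z))"
    using winding_number_valid_path[OF vfp nfp] by simp
  also have "contour_integral (f \<circ> ?\<gamma>) (\<lambda>w. 1 / (w - f z)) =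
      contour_integral ?\<gamma> (\<lambda>w. deriv f w * (1 / (f w - f z)))"
    using path(1) by (intro contour_integral_comp_analyticW[OF ana]) auto
  also have "\<dots> = contour_integral ?\<gamma> (\<lambda>u. g u / (u - z))"
    using path by (intro contour_integral_eq) (auto simp: g_def Q_def)
  finally have *: "winding_number (f \<circ> ?\<gamma>) (f z) =
      1 / (2 * pi * \<i>) * contour_integral ?\<gamma> (\<lambda>u. g u / (u - z))" .
  show ?thesis by (subst *) (simp add: int)
qed

text \<open>The slope \<open>S\<close> of \<open>G\<close>, completed by \<open>b\<close> at
  \<open>h z\<close>, is continuous there, so \<open>S (h x)\<close> tends to \<open>b\<close>. The
  difference quotient of \<open>F\<close> divided by \<open>S (h x)\<close> is that of
  \<open>h\<close>; injectivity of \<open>h\<close> makes \<open>h x - h z\<close> non-zero, so that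
  it cancels.\<close>

lemma has_field_derivative_lift:
  fixes F G h :: "complex \<Rightarrow> complex"
  assumes "open A" "z \<in> A" "isCont h z" "inj_on h A"
    and lift: "\<And>x. x \<in> A \<Longrightarrow> G (h x) = F x"
    and F: "(F has_field_derivative a) (at z)"
    and G: "(G has_field_derivative b) (at (h z))" "b \<noteq> 0"
  shows "(h has_field_derivative a / b) (at z)"
proof -
  define S where "S = (\<lambda>y. if y = h z then b else (G y - G (h z)) / (y - h z))"
  have "(\<lambda>y. (G y - G (h z)) / (y - h z)) \<midarrow>h z\<rightarrow> b"
    using G(1) by (simp add: has_field_derivative_iff)
  then have "S \<midarrow>h z\<rightarrow> b" by (rule Lim_transform_eventually) (auto simp: S_def eventually_at_filter)
  then have "isCont S (h z)" by (simp add: isCont_def S_def)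
  then have "isCont (\<lambda>x. S (h x)) z" by (rule isCont_o2[OF assms(3)])
  then have 1: "(\<lambda>x. S (h x)) \<midarrow>z\<rightarrow> b" by (simp add: isCont_def S_def)
  have 2: "(\<lambda>x. (F x - F z) / (x - z)) \<midarrow>z\<rightarrow> a" using F by (simp add: has_field_derivative_iff)
  have 3: "(\<lambda>x. ((F x - F z) / (x - z)) / S (h x)) \<midarrow>z\<rightarrow> a / b" by (intro tendsto_divide 1 2 G(2))
  have ev: "\<forall>\<^sub>F x in at z. x \<in> A \<and> x \<noteq> z" using eventually_nhds_in_open[OF assms(1,2)]
    by (auto simp: eventually_at_filter elim: eventually_mono)
  have ev1: "\<forall>\<^sub>F x in at z. S (h x) \<noteq> 0" using tendsto_imp_eventually_ne[OF 1 G(2)] .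
  have "\<forall>\<^sub>F x in at z. ((F x - F z) / (x - z)) / S (h x) = (h x - h z) / (x - z)" using ev ev1
  proof eventually_elim
    case (elim x)
    then have "h x \<noteq> h z" using assms(2,4) by (auto dest: inj_onD)
    then show ?case using elim lift[of x] lift[OF assms(2)] by (auto simp: S_def divide_simps)
  qed
  from Lim_transform_eventually[OF 3 this]
  show ?thesis by (simp add: has_field_derivative_iff)
qed

lemma homeomorphic_map_inv_into:
  assumes "homeomorphic_map X Y f"
  shows "homeomorphic_map Y X (inv_into (topspace X) f)"
proof -
  obtain g where g: "homeomorphic_maps X Y f g" using assms by (auto simp: homeomorphic_map_maps)
  have inj: "inj_on f (topspace X)" and im: "f ` topspace X = topspace Y"
    using assms by (auto simp: homeomorphic_eq_everything_map)
  have "homeomorphic_map Y X g" using g homeomorphic_maps_map by blast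
  moreover have "g y = inv_into (topspace X) f y" if "y \<in> topspace Y" for y
    using g that inj im unfolding homeomorphic_maps_def continuous_map_def
    by (metis Pi_iff inv_into_f_f)
  ultimately show ?thesis by (rule homeomorphic_map_eq)
qed

text \<open>A chart read backwards. For a quotient space, maps out of a disc are the natural data;
  their inverses become the charts.\<close>

definition parametrization :: "'b topology \<Rightarrow> (complex \<Rightarrow> 'b) \<Rightarrow> bool" where
  "parametrization S \<Psi> \<longleftrightarrow>
     openin S (\<Psi> ` ball 0 1) \<and>
     homeomorphic_map (top_of_set (ball 0 1)) (subtopology S (\<Psi> ` ball 0 1)) \<Psi>"

lemma parametrization_inj: "parametrization S \<Psi> \<Longrightarrow> inj_on \<Psi> (ball 0 1)"
  by (auto simp: parametrization_def homeomorphic_map_def)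

lemma chart_parametrization:
  assumes "parametrization S \<Psi>"
  shows "chart S (\<Psi> ` ball 0 1) (inv_into (ball 0 1) \<Psi>)"
proof -
  have inj: "inj_on \<Psi> (ball 0 1)" using assms by (rule parametrization_inj)
  then have "inv_into (ball 0 1) \<Psi> ` \<Psi> ` ball 0 1 = ball 0 1" by (simp add: inv_into_image_cancel)
  then show ?thesis using assms homeomorphic_map_inv_into[of "top_of_set (ball 0 1)" _ \<Psi>]
    by (auto simp: parametrization_def chart_def)
qed

text \<open>A continuous map from the compact disc to a Hausdorff space is a quotient map onto its
  image, and the last hypothesis makes the open disc saturated. The restriction to it is therefore
  again a quotient map, and an injective quotient map is a homeomorphism.\<close>

lemma parametrization_of_closed_disc:
  assumes "Hausdorff_space S" "continuous_map (top_of_set (cball 0 1)) S \<Psi>"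
    and "inj_on \<Psi> (ball 0 1)" "openin S (\<Psi> ` ball 0 1)"
    and "\<Psi> ` ball 0 1 \<inter> \<Psi> ` sphere 0 1 = {}"
  shows "parametrization S \<Psi>"
proof -
  let ?D = "top_of_set (cball (0::complex) 1)"
  have q: "quotient_map ?D (subtopology S (\<Psi> ` cball 0 1)) \<Psi>"
  proof (rule continuous_imp_quotient_map)
    show "continuous_map ?D (subtopology S (\<Psi> ` cball 0 1)) \<Psi>"
      using assms(2) by (simp add: continuous_map_in_subtopology)
    show "compact_space ?D" by (simp add: compact_space_subtopology)
    show "Hausdorff_space (subtopology S (\<Psi> ` cball 0 1))"
      using assms(1) by (rule Hausdorff_space_subtopology)
    show "\<Psi> ` topspace ?D = topspace (subtopology S (\<Psi> ` cball 0 1))"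
      using continuous_map_image_subset_topspace[OF assms(2)] by simp blast
  qed
  have pre: "{x \<in> topspace ?D. \<Psi> x \<in> \<Psi> ` ball 0 1} = ball 0 1"
  proof -
    have "x \<in> ball 0 1" if "norm x \<le> 1" "\<Psi> x \<in> \<Psi> ` ball 0 1" for x
    proof (rule ccontr)
      assume "x \<notin> ball 0 1"
      then have "x \<in> sphere 0 1" using that by auto
      then show False using assms(5) that(2) by blast
    qed
    moreover have "norm x \<le> 1" if "x \<in> ball 0 1" for x :: complex using that by simp
    ultimately show ?thesis by fastforce
  qed
  have op: "openin (subtopology S (\<Psi> ` cball 0 1)) (\<Psi> ` ball 0 1)" unfolding openin_subtopology
    using assms(4) ball_subset_cball[of "0::complex" 1] by (intro exI[of _ "\<Psi> ` ball 0 1"]) blast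
  have "quotient_map (subtopology ?D (ball 0 1))
      (subtopology (subtopology S (\<Psi> ` cball 0 1)) (\<Psi> ` ball 0 1)) \<Psi>"
    by (rule quotient_map_restriction[OF q pre]) (simp add: op)
  moreover have "\<Psi> ` cball 0 1 \<inter> \<Psi> ` ball 0 1 = \<Psi> ` ball 0 1" by auto
  moreover have "cball (0::complex) 1 \<inter> ball 0 1 = ball 0 1" by auto
  ultimately have "quotient_map (top_of_set (ball 0 1)) (subtopology S (\<Psi> ` ball 0 1)) \<Psi>"
    by (simp add: subtopology_subtopology)
  then show ?thesis using assms(3,4) by (simp add: parametrization_def homeomorphic_map_def)
qed

text \<open>The transition map \<open>h\<close> is a lift of \<open>w \<circ> \<Psi>\<close> through
  \<open>w \<circ> \<Phi>\<close>, so it is complex differentiable, and injective holomorphic maps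
  wind once. The nested \<open>inv_into\<close> recovers \<open>\<Psi>\<close> from its chart, as
  the definition of orientability is stated for charts.\<close>

lemma transition_orientation_preserving:
  assumes \<Psi>: "parametrization S \<Psi>" and \<Phi>: "parametrization S \<Phi>"
    and w\<Psi>: "\<And>u. u \<in> ball 0 1 \<Longrightarrow> \<Psi> u \<in> \<Phi> ` ball 0 1 \<Longrightarrow>
           \<exists>d. ((w \<circ> \<Psi>) has_field_derivative d) (at u)"
    and w\<Phi>: "\<And>u. u \<in> ball 0 1 \<Longrightarrow> \<Phi> u \<in> \<Psi> ` ball 0 1 \<Longrightarrow>
           \<exists>d. d \<noteq> 0 \<and> ((w \<circ> \<Phi>) has_field_derivative d) (at u)"
  shows "orientation_preserving (inv_into (ball 0 1) \<Psi> ` (\<Psi> ` ball 0 1 \<inter> \<Phi> ` ball 0 1))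
     (inv_into (ball 0 1) \<Phi> \<circ> inv_into (\<Psi> ` ball 0 1) (inv_into (ball 0 1) \<Psi>))"
proof -
  let ?B = "ball (0::complex) 1"
  let ?U = "\<Psi> ` ?B" and ?W = "\<Phi> ` ?B"
  let ?\<psi> = "inv_into ?B \<Psi>" and ?\<phi> = "inv_into ?B \<Phi>"
  have inj: "inj_on \<Psi> ?B" "inj_on \<Phi> ?B" using \<Psi> \<Phi> by (auto intro: parametrization_inj)
  define A where "A = {u \<in> ?B. \<Psi> u \<in> ?W}"
  have A: "?\<psi> ` (?U \<inter> ?W) = A"
  proof
    show "?\<psi> ` (?U \<inter> ?W) \<subseteq> A"
    proof
      fix v assume "v \<in> ?\<psi> ` (?U \<inter> ?W)"
      then obtain u where u: "u \<in> ?B" "\<Psi> u \<in> ?W" "v = ?\<psi> (\<Psi> u)" by blast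
      then have "v = u" using inj(1) by simp
      then show "v \<in> A" using u by (simp add: A_def)
    qed
    show "A \<subseteq> ?\<psi> ` (?U \<inter> ?W)"
    proof
      fix u assume u: "u \<in> A"
      then have "u = ?\<psi> (\<Psi> u)" "\<Psi> u \<in> ?U \<inter> ?W" using inj(1) by (auto simp: A_def)
      then show "u \<in> ?\<psi> ` (?U \<inter> ?W)" by blast
    qed
  qed
  define h where "h = ?\<phi> \<circ> \<Psi>"
  have inv: "inv_into ?U ?\<psi> u = \<Psi> u" if "u \<in> ?B" for u
  proof (rule inv_into_f_eq)
    show "inj_on ?\<psi> ?U" by (rule inj_on_inv_into) simp
  qed (use inj(1) that in simp_all)
  have c\<Psi>: "continuous_map (top_of_set ?B) S \<Psi>"
    using \<Psi> by (auto simp: parametrization_def continuous_map_in_subtopology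
        dest!: homeomorphic_imp_continuous_map)
  have oW: "openin S ?W" using \<Phi> by (simp add: parametrization_def)
  have "openin (top_of_set ?B) A"
    using openin_continuous_map_preimage[OF c\<Psi> oW] by (simp add: A_def)
  then have "open A" by (metis open_ball openin_open_eq)
  have c\<Psi>A: "continuous_map (top_of_set A) (subtopology S ?W) \<Psi>"
  proof -
    have "?B \<inter> A = A" by (auto simp: A_def)
    then have "continuous_map (top_of_set A) S \<Psi>"
      using continuous_map_from_subtopology[OF c\<Psi>, of A] by (simp add: subtopology_subtopology)
    then show ?thesis by (auto simp: continuous_map_in_subtopology A_def)
  qed
  have "continuous_map (subtopology S ?W) (top_of_set ?B) ?\<phi>"
    using \<Phi> homeomorphic_map_inv_into[of "top_of_set ?B" _ \<Phi>] homeomorphic_imp_continuous_map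
    by (auto simp: parametrization_def)
  then have "continuous_map (top_of_set A) (top_of_set ?B) h"
    unfolding h_def by (rule continuous_map_compose[OF c\<Psi>A])
  then have ch: "continuous_on A h" by (simp add: continuous_map_in_subtopology)
  have hA: "\<Phi> (h x) = \<Psi> x" "h x \<in> ?B" if "x \<in> A" for x
    using that f_inv_into_f[of "\<Psi> x" \<Phi> ?B] inv_into_into[of "\<Psi> x" \<Phi> ?B]
    unfolding A_def h_def by auto
  have injh: "inj_on h A"
  proof (rule inj_onI)
    fix x y assume xy: "x \<in> A" "y \<in> A" "h x = h y"
    then have "\<Psi> x = \<Psi> y" using hA(1)[of x] hA(1)[of y] by simp
    then show "x = y" using xy inj(1) unfolding A_def by (blast dest: inj_onD)
  qed
  have lift: "(w \<circ> \<Phi>) (h x) = (w \<circ> \<Psi>) x" if "x \<in> A" for x using hA[OF that] by simp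
  have holo: "h holomorphic_on A" unfolding holomorphic_on_def
  proof
    fix z assume z: "z \<in> A"
    have "h z \<in> ?B" "\<Phi> (h z) \<in> ?U" using z hA[OF z] by (auto simp: A_def)
    then obtain b where b: "b \<noteq> 0" "((w \<circ> \<Phi>) has_field_derivative b) (at (h z))" using w\<Phi> by blast
    obtain a where a: "((w \<circ> \<Psi>) has_field_derivative a) (at z)" using z w\<Psi> by (auto simp: A_def)
    have "isCont h z" using ch \<open>open A\<close> z by (simp add: continuous_on_eq_continuous_at)
    from has_field_derivative_lift[OF \<open>open A\<close> z this injh lift a b(2,1)]
    show "h field_differentiable at z within A"
      by (meson field_differentiable_at_within field_differentiable_def)
  qed
  show ?thesis unfolding A orientation_preserving_def
  proof (intro allI impI)
    fix z r assume zr: "0 < r \<and> cball z r \<subseteq> A"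
    have eq: "(?\<phi> \<circ> inv_into ?U ?\<psi>) u = h u" if "u \<in> A" for u
      using that inv[of u] by (simp add: A_def h_def)
    have zA: "z \<in> A" using zr by auto
    have "winding_number ((?\<phi> \<circ> inv_into ?U ?\<psi>) \<circ> circlepath z r) ((?\<phi> \<circ> inv_into ?U ?\<psi>) z) =
      winding_number (h \<circ> circlepath z r) (h z)" unfolding eq[OF zA]
    proof (rule winding_number_cong)
      fix t :: real assume "0 \<le> t" "t \<le> 1"
      then have "circlepath z r t \<in> path_image (circlepath z r)" by (simp add: path_image_def)
      then have "circlepath z r t \<in> A" using zr by auto
      then show "((?\<phi> \<circ> inv_into ?U ?\<psi>) \<circ> circlepath z r) t = (h \<circ> circlepath z r) t"
        using eq by simp
    qed
    then show "winding_number ((?\<phi> \<circ> inv_into ?U ?\<psi>) \<circ> circlepath z r) ((?\<phi> \<circ> inv_into ?U ?\<psi>) z) = 1"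
      using winding_number_injective_holomorphic[OF holo \<open>open A\<close> injh] zr by simp
  qed
qed

text \<open>A chart compared with itself gets its own \<open>w\<close>, because the overlap contains
  the centre of the chart, where the covering may fail to be regular. With the inverse of
  \<open>\<Psi>\<close> as \<open>w\<close>, the composition \<open>w \<circ> \<Psi>\<close> is the
  identity.\<close>

lemma transition_same_orientation_preserving:
  assumes \<Psi>: "parametrization S \<Psi>"
  shows "orientation_preserving (inv_into (ball 0 1) \<Psi> ` (\<Psi> ` ball 0 1 \<inter> \<Psi> ` ball 0 1))
     (inv_into (ball 0 1) \<Psi> \<circ> inv_into (\<Psi> ` ball 0 1) (inv_into (ball 0 1) \<Psi>))"
proof -
  have inj: "inj_on \<Psi> (ball 0 1)" using \<Psi> by (rule parametrization_inj)
  define w where "w = inv_into (ball 0 1) \<Psi>"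
  have "((w \<circ> \<Psi>) has_field_derivative 1) (at u)" if "u \<in> ball 0 1" for u
  proof (rule has_field_derivative_transform_within_open[where S = "ball 0 1" and f = "\<lambda>x. x"])
    show "x = (w \<circ> \<Psi>) x" if "x \<in> ball 0 1" for x using inj that by (simp add: w_def)
  qed (use that in auto)
  then have "\<exists>d. d \<noteq> 0 \<and> ((w \<circ> \<Psi>) has_field_derivative d) (at u)" if "u \<in> ball 0 1" for u
    using that by (intro exI[of _ 1]) simp
  then show ?thesis by (intro transition_orientation_preserving[OF \<Psi> \<Psi>, where w = w]) blast+
qed

text \<open>The restriction to \<open>\<Psi> \<noteq> \<Phi>\<close> is what lets a branched
  covering serve as \<open>w\<close>: a branch point inside a single chart imposes no
  condition.\<close>

lemma orientable_parametrized:
  assumes par: "\<And>\<Psi>. \<Psi> \<in> P \<Longrightarrow> parametrization S \<Psi>"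
    and cover: "topspace S = (\<Union>\<Psi>\<in>P. \<Psi> ` ball 0 1)"
    and w: "\<And>\<Psi> \<Phi> u. \<Psi> \<in> P \<Longrightarrow> \<Phi> \<in> P \<Longrightarrow> \<Psi> \<noteq> \<Phi> \<Longrightarrow> u \<in> ball 0 1 \<Longrightarrow> \<Psi> u \<in> \<Phi> ` ball 0 1 \<Longrightarrow>
           \<exists>d. d \<noteq> 0 \<and> ((w \<circ> \<Psi>) has_field_derivative d) (at u)"
  shows "orientable S" unfolding orientable_def
proof (intro exI[of _ "(\<lambda>\<Psi>. (\<Psi> ` ball 0 1, inv_into (ball 0 1) \<Psi>)) ` P"] conjI)
  have "orientation_preserving (inv_into (ball 0 1) \<Psi> ` (\<Psi> ` ball 0 1 \<inter> \<Phi> ` ball 0 1))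
     (inv_into (ball 0 1) \<Phi> \<circ> inv_into (\<Psi> ` ball 0 1) (inv_into (ball 0 1) \<Psi>))"
    if "\<Psi> \<in> P" "\<Phi> \<in> P" for \<Psi> \<Phi>
  proof (cases "\<Psi> = \<Phi>")
    case True
    then show ?thesis using transition_same_orientation_preserving par that by blast
  next
    case False
    show ?thesis
    proof (rule transition_orientation_preserving[where w = w and S = S])
      show "\<exists>d. ((w \<circ> \<Psi>) has_field_derivative d) (at u)"
        if "u \<in> ball 0 1" "\<Psi> u \<in> \<Phi> ` ball 0 1" for u using w[OF \<open>\<Psi> \<in> P\<close> \<open>\<Phi> \<in> P\<close> False that] by blast
      show "\<exists>d. d \<noteq> 0 \<and> ((w \<circ> \<Phi>) has_field_derivative d) (at u)"
        if "u \<in> ball 0 1" "\<Phi> u \<in> \<Psi> ` ball 0 1" for u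
        using w[OF \<open>\<Phi> \<in> P\<close> \<open>\<Psi> \<in> P\<close> False[symmetric] that] .
    qed (use par that in simp_all)
  qed
  then show "\<forall>(U, \<phi>)\<in>(\<lambda>\<Psi>. (\<Psi> ` ball 0 1, inv_into (ball 0 1) \<Psi>)) ` P.
       \<forall>(W, \<theta>)\<in>(\<lambda>\<Psi>. (\<Psi> ` ball 0 1, inv_into (ball 0 1) \<Psi>)) ` P.
          orientation_preserving (\<phi> ` (U \<inter> W)) (\<theta> \<circ> inv_into U \<phi>)" by auto
  show "\<forall>(U, \<phi>)\<in>(\<lambda>\<Psi>. (\<Psi> ` ball 0 1, inv_into (ball 0 1) \<Psi>)) ` P. chart S U \<phi>"
    using par chart_parametrization by blast
  show "topspace S = (\<Union>(U, \<phi>)\<in>(\<lambda>\<Psi>. (\<Psi> ` ball 0 1, inv_into (ball 0 1) \<Psi>)) ` P. U)"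
    unfolding cover by auto
qed

lemma Hausdorff_space_euclidean_t2: "Hausdorff_space (euclidean :: 'a::t2_space topology)"
proof -
  have "\<exists>U V. open U \<and> open V \<and> x \<in> U \<and> y \<in> V \<and> disjnt U V" if "x \<noteq> y" for x y :: 'a
    using hausdorff[OF that] by (auto simp: disjnt_def)
  then show ?thesis by (simp add: Hausdorff_space_def)
qed

section \<open>Parametrizations of the disc and of its boundary\<close>

lemma cyclic_on_enumeration:
  assumes "cyclic_on f S" "s \<in> S"
  shows "bij_betw (\<lambda>k. (f ^^ k) s) {..<card S} S" "(f ^^ card S) s = s" "0 < card S"
proof -
  have S: "S = orbit f s" using assms by (auto simp: cyclic_on_alldef)
  then have s: "s \<in> orbit f s" using assms(2) by simp
  define n where "n = funpow_dist1 f s s"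
  have im: "S = (\<lambda>k. (f ^^ k) s) ` {0..<n}"
    unfolding n_def S by (rule orbit_conv_funpow_dist1[OF s])
  have inj: "inj_on (\<lambda>k. (f ^^ k) s) {0..<n}" unfolding n_def by (rule inj_on_funpow_dist1[OF s])
  have card: "card S = n" using im card_image[OF inj] by simp
  show "bij_betw (\<lambda>k. (f ^^ k) s) {..<card S} S"
    unfolding card using im inj by (simp add: bij_betw_def lessThan_atLeast0)
  show "(f ^^ card S) s = s" unfolding card n_def by (rule funpow_dist1_prop[OF s])
  show "0 < card S" unfolding card n_def by simp
qed

text \<open>Meant for a disjoint union of circles indexed by \<open>nat\<close>: a slice
  \<open>{f} \<times> U\<close> is open, so continuity may be tested on one circle at a
  time.\<close>

lemma continuous_on_discrete_Times:
  fixes g :: "'a::discrete_topology \<times> 'b::topological_space \<Rightarrow> 'c::topological_space"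
  assumes "\<And>f. f \<in> A \<Longrightarrow> continuous_on B (\<lambda>z. g (f, z))"
  shows "continuous_on (A \<times> B) g" unfolding continuous_on_topological
proof (intro ballI allI impI)
  fix x V assume x: "x \<in> A \<times> B" and V: "open V" "g x \<in> V"
  obtain f z where fz: "x = (f, z)" "f \<in> A" "z \<in> B" using x by auto
  obtain U where U: "open U" "z \<in> U" "\<forall>z'\<in>B. z' \<in> U \<longrightarrow> g (f, z') \<in> V"
    using assms[OF fz(2)] V fz unfolding continuous_on_topological by metis
  show "\<exists>U. open U \<and> x \<in> U \<and> (\<forall>y\<in>A \<times> B. y \<in> U \<longrightarrow> g y \<in> V)"
    using U fz by (intro exI[of _ "{f} \<times> U"]) (auto intro: open_Times simp: open_discrete)
qed

lemma periodic_mod: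
  fixes g :: "int \<Rightarrow> 'a"
  assumes "\<And>i. g (i + k) = g i"
  shows "g (i mod k) = g i"
proof -
  have add: "g (i + int n * k) = g i" for i n
  proof (induction n)
    case (Suc n)
    then show ?case using assms[of "i + int n * k"] by (simp add: algebra_simps)
  qed simp
  show ?thesis
  proof (cases "0 \<le> i div k")
    case True
    then show ?thesis using add[of "i mod k" "nat (i div k)"] by (simp add: mod_div_mult_eq)
  next
    case False
    then show ?thesis using add[of i "nat (- (i div k))"] by (simp add: minus_div_mult_eq_mod)
  qed
qed

text \<open>The exponential covering of the punctured disc by the upper half-plane, scaled so that a
  full turn is a translation by 1. A boundary parameter \<open>s\<close> of a face with
  \<open>l\<close> edges then sits at \<open>turn (s / l)\<close>, and exactly the real arguments
  land on the unit circle.\<close>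

definition turn :: "complex \<Rightarrow> complex" where
  "turn y = exp (2 * of_real pi * \<i> * y)"

lemma turn_add: "turn (y + y') = turn y * turn y'" by (simp add: turn_def exp_add ring_distribs)

lemma turn_power: "turn y ^ n = turn (of_nat n * y)"
  by (simp add: turn_def exp_of_nat_mult[symmetric] mult_ac)

lemma turn_eq_iff: "turn y = turn y' \<longleftrightarrow> (\<exists>n::int. y = y' + of_int n)"
proof -
  have "turn y = turn y' \<longleftrightarrow> (\<exists>n::int. 2 * of_real pi * \<i> * y = 2 * of_real pi * \<i> * (y' + of_int n))"
    unfolding turn_def exp_eq by (simp add: algebra_simps)
  then show ?thesis by simp
qed

lemma turn_of_int [simp]: "turn (of_int n) = 1"
  using turn_eq_iff[of "of_int n" 0] by (simp add: turn_def)

lemma norm_turn: "norm (turn y) = exp (- (2 * pi * Im y))" by (simp add: turn_def)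

lemma norm_turn_eq_1 [simp]: "norm (turn y) = 1 \<longleftrightarrow> Im y = 0" by (simp add: norm_turn)

lemma norm_turn_le_1 [simp]: "norm (turn y) \<le> 1 \<longleftrightarrow> 0 \<le> Im y"
proof -
  have "\<not> pi \<le> 0" using pi_gt_zero by linarith
  then show ?thesis by (simp add: norm_turn zero_le_mult_iff)
qed

lemma turn_of_real: "turn (of_real s) = cis (2 * pi * s)"
  by (simp add: turn_def cis_conv_exp mult_ac)

lemma cnj_turn: "cnj (turn y) = turn (- cnj y)" by (simp add: turn_def exp_cnj)

lemma inverse_turn: "inverse (turn y) = turn (- y)" by (simp add: turn_def exp_minus)

lemma continuous_on_turn [continuous_intros]:
  "continuous_on A f \<Longrightarrow> continuous_on A (\<lambda>x. turn (f x))"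
  unfolding turn_def by (intro continuous_intros)

lemma turn_Arg2pi:
  assumes "norm z = 1"
  shows "turn (of_real (Arg2pi z / (2 * pi))) = z"
proof -
  have "turn (of_real (Arg2pi z / (2 * pi))) = exp (\<i> * of_real (Arg2pi z))"
    unfolding turn_of_real by (simp add: cis_conv_exp)
  then show ?thesis using assms by (simp only: complex_norm_eq_1_exp)
qed

text \<open>By the open mapping theorem. These images are the plane neighbourhoods from which the
  preimage of a vertex chart is assembled.\<close>

lemma open_turn_image:
  assumes "l \<noteq> 0" "open U"
  shows "open ((\<lambda>M. turn ((a + 3/4 * M) / of_nat l)) ` U)"
proof (rule open_mapping_thm[where S = UNIV])
  let ?g = "\<lambda>M. turn ((a + 3/4 * M) / of_nat l)"
  show "?g holomorphic_on UNIV" unfolding turn_def using assms by (intro holomorphic_intros) auto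
  show "\<not> ?g constant_on UNIV"
  proof
    assume "?g constant_on UNIV"
    \<comment> \<open>Moving \<open>M\<close> by \<open>2/3 * l\<close> adds a half turn, so the two
      values are negatives of each other and cannot agree.\<close>
    then have "?g 0 = ?g (2/3 * of_nat l)" unfolding constant_on_def by (metis UNIV_I)
    then obtain n :: int where "(a + 3/4 * 0) / of_nat l = (a + 3/4 * (2/3 * of_nat l)) / of_nat l + of_int n"
      unfolding turn_eq_iff by blast
    moreover have "(a + 3/4 * (2/3 * of_nat l)) / of_nat l = a / of_nat l + 1/2"
      using assms(1) by (simp add: add_divide_distrib)
    ultimately have "of_int n + (1/2 :: complex) = 0" by (simp add: add.assoc)
    then have "Re (of_int n + (1/2 :: complex)) = Re 0" by (rule arg_cong)
    then have "real_of_int n + 1/2 = 0" by simp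
    then have "2 * n = -1" by linarith
    then show False by presburger
  qed
qed (use assms in auto)

section \<open>Division of the disc into sectors\<close>

text \<open>The \<open>N\<close>-th power opens a sector of angle \<open>pi / N\<close> onto a
  half-plane: the upper one for even \<open>i\<close>, the lower one for odd
  \<open>i\<close>.\<close>

lemma rcis_sector_power:
  assumes "0 < N"
  shows "rcis r ((\<phi> + real i * pi) / real N) ^ N = (-1) ^ i * rcis (r ^ N) \<phi>"
proof -
  have "rcis r ((\<phi> + real i * pi) / real N) ^ N = rcis (r ^ N) (\<phi> + real i * pi)"
    unfolding DeMoivre2 using assms by simp
  also have "\<dots> = rcis (r ^ N) \<phi> * cis (real i * pi)" by (simp add: rcis_def cis_mult)
  also have "cis (real i * pi) = (-1) ^ i"
    using Complex.DeMoivre[of pi i] unfolding cis_pi by (rule sym)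
  finally show ?thesis by (simp add: mult.commute)
qed

text \<open>The index \<open>i\<close> for which the argument of \<open>u\<close> lies between
  \<open>i * pi / N\<close> and \<open>(i + 1) * pi / N\<close>. A sector contains its initial ray
  but not its closing ray, and the origin falls into sector 0 because \<open>Arg2pi 0\<close> is
  0.\<close>

definition sector :: "nat \<Rightarrow> complex \<Rightarrow> nat" where
  "sector N u = nat \<lfloor>real N * Arg2pi u / pi\<rfloor>"

lemma sector_rep:
  assumes "0 < N"
  obtains \<phi> where "0 \<le> \<phi>" "\<phi> < pi" "sector N u < 2 * N"
    "u = rcis (norm u) ((\<phi> + real (sector N u) * pi) / real N)"
proof
  let ?t = "real N * Arg2pi u / pi" and ?i = "sector N u"
  let ?\<phi> = "real N * Arg2pi u - real ?i * pi"
  have t0: "0 \<le> ?t" using Arg2pi_ge_0[of u] by simp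
  have i: "real ?i = of_int \<lfloor>?t\<rfloor>" unfolding sector_def using t0 by simp
  have "real ?i \<le> ?t" "?t < real ?i + 1" unfolding i by linarith+
  then have 1: "real ?i * pi \<le> real N * Arg2pi u" "real N * Arg2pi u < (real ?i + 1) * pi"
    by (simp_all add: field_simps)
  then show "0 \<le> ?\<phi>" "?\<phi> < pi" by (simp_all add: algebra_simps)
  have "real N * Arg2pi u < real N * (2 * pi)"
    using assms Arg2pi_lt_2pi[of u] by (intro mult_strict_left_mono) auto
  moreover have "real N * (2 * pi) = real (2 * N) * pi" by simp
  ultimately have "real ?i * pi < real (2 * N) * pi" using 1(1) by linarith
  then show "?i < 2 * N" using pi_gt_zero by (simp only: mult_less_cancel_right_pos of_nat_less_iff)
  have "(?\<phi> + real ?i * pi) / real N = Arg2pi u" using assms by simp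
  then show "u = rcis (norm u) ((?\<phi> + real ?i * pi) / real N)"
    using Arg2pi_eq[of u] by (simp only: rcis_def cis_conv_exp)
qed

lemma sector_rcis:
  assumes "0 < N" "0 < r" "0 \<le> \<phi>" "\<phi> < pi" "i < 2 * N"
  shows "sector N (rcis r ((\<phi> + real i * pi) / real N)) = i"
proof -
  let ?\<theta> = "(\<phi> + real i * pi) / real N"
  have "\<phi> + real i * pi < (real i + 1) * pi" using assms by (simp add: algebra_simps)
  also have "\<dots> \<le> real (2 * N) * pi" using assms(5) by (intro mult_right_mono) auto
  finally have "?\<theta> < 2 * pi" using assms(1) by (simp add: field_simps)
  then have "Arg2pi (rcis r ?\<theta>) = ?\<theta>"
    using assms by (intro Arg2pi_unique[of r]) (auto simp: rcis_def cis_conv_exp)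
  then have "real N * Arg2pi (rcis r ?\<theta>) / pi = \<phi> / pi + real i"
    using assms(1) by (simp add: field_simps)
  moreover have "\<lfloor>\<phi> / pi + real i\<rfloor> = int i" using assms by (simp add: floor_eq_iff)
  ultimately show ?thesis by (simp add: sector_def)
qed

lemma rcis_upper_inj:
  assumes "rcis r \<phi> = rcis r' \<phi>'" "0 \<le> r" "0 \<le> r'" "0 \<le> \<phi>" "\<phi> < pi" "0 \<le> \<phi>'" "\<phi>' < pi"
  shows "r = r' \<and> (r = 0 \<or> \<phi> = \<phi>')"
proof -
  have r: "r = r'" using assms(1-3) by (metis abs_of_nonneg complex_mod_rcis)
  show ?thesis
  proof (cases "r = 0")
    case False
    then have *: "Arg2pi (rcis r \<phi>) = \<phi>" "Arg2pi (rcis r' \<phi>') = \<phi>'"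
      using assms r pi_gt_zero by (intro Arg2pi_unique[of r]; simp add: rcis_def cis_conv_exp)+
    have "\<phi> = \<phi>'" using arg_cong[OF assms(1), of Arg2pi] unfolding * .
    then show ?thesis using r by simp
  qed (use r in simp)
qed

text \<open>\<open>True\<close> stands for black. In a vertex chart the white corners occupy lower
  half-planes; conjugation brings them to the upper half-plane, which \<open>turn\<close> sends into
  the disc.\<close>

definition reflect :: "bool \<Rightarrow> complex \<Rightarrow> complex" where
  "reflect c z = (if c then z else cnj z)"

lemma norm_reflect [simp]: "norm (reflect c z) = norm z" by (simp add: reflect_def)

lemma reflect_reflect [simp]: "reflect c (reflect c z) = z" by (simp add: reflect_def)

lemma reflect_of_real [simp]: "reflect c (of_real t) = of_real t" by (simp add: reflect_def)

lemma continuous_on_reflect [continuous_intros]: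
  "continuous_on A g \<Longrightarrow> continuous_on A (\<lambda>z. reflect c (g z))"
  by (cases c) (auto simp: reflect_def intro: continuous_intros)

lemma Im_reflect_eq_0: "Im (reflect c z) = 0 \<longleftrightarrow> Im z = 0" by (simp add: reflect_def)

section \<open>The surface of a face 2-coloured combinatorial map\<close>

text \<open>Every edge carries one fixed direction, and face \<open>f\<close> passes through the
  arcs \<open>arc f j\<close> in that direction, periodically in the integer \<open>j\<close>.
  \<open>succ c\<close> continues an arc along the face of colour \<open>c\<close>;
  \<open>arc_ex\<close> and \<open>arc_eqD\<close> put every arc exactly once on a face of each
  colour. A corner at a vertex has an incoming and an outgoing arc: \<open>rot\<close> leads from
  the outgoing arc of a black corner to that of the white corner with the same incoming arc, and
  \<open>rot_cyclic\<close> says that the corners at a vertex close up in a single cycle.\<close>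

locale face_system =
  fixes arcs :: "'e set" and src tgt :: "'e \<Rightarrow> int"
    and F :: nat and len :: "nat \<Rightarrow> nat" and arc :: "nat \<Rightarrow> int \<Rightarrow> 'e"
    and black :: "nat \<Rightarrow> bool" and succ :: "bool \<Rightarrow> 'e \<Rightarrow> 'e" and rot :: "'e \<Rightarrow> 'e"
  assumes finite_arcs: "finite arcs"
    and len_pos: "f < F \<Longrightarrow> 0 < len f"
    and arc_in: "f < F \<Longrightarrow> arc f j \<in> arcs"
    and arc_period: "f < F \<Longrightarrow> arc f (j + int (len f)) = arc f j"
    and arc_succ: "f < F \<Longrightarrow> arc f (j + 1) = succ (black f) (arc f j)"
    and arc_eqD: "f < F \<Longrightarrow> f' < F \<Longrightarrow> black f = black f' \<Longrightarrow> arc f i = arc f' j \<Longrightarrow>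
           f = f' \<and> i mod int (len f) = j mod int (len f)"
    and arc_ex: "a \<in> arcs \<Longrightarrow> \<exists>f j. f < F \<and> black f = c \<and> arc f j = a"
    and src_succ: "a \<in> arcs \<Longrightarrow> src (succ c a) = tgt a"
    and src_ne_tgt: "a \<in> arcs \<Longrightarrow> src a \<noteq> tgt a"
    and ends_inj: "a \<in> arcs \<Longrightarrow> b \<in> arcs \<Longrightarrow> {src a, tgt a} = {src b, tgt b} \<Longrightarrow> a = b"
    and rot_succ: "a \<in> arcs \<Longrightarrow> rot (succ True a) = succ False a"
    and rot_cyclic: "x \<in> src ` arcs \<Longrightarrow> cyclic_on rot {a \<in> arcs. src a = x}"
begin

definition V where "V = src ` arcs"

definition E where "E = (\<lambda>a. {src a, tgt a}) ` arcs"

lemma finite_V: "finite V" by (simp add: V_def finite_arcs)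

lemma arc_cong:
  assumes "f < F" "i mod int (len f) = j mod int (len f)"
  shows "arc f i = arc f j"
  using periodic_mod[of "arc f", OF arc_period[OF assms(1)]] assms(2) by metis

lemma src_arc_Suc: "f < F \<Longrightarrow> src (arc f (j + 1)) = tgt (arc f j)"
  by (simp add: arc_succ src_succ arc_in)

lemma tgt_arc_pred: "f < F \<Longrightarrow> tgt (arc f (j - 1)) = src (arc f j)"
  using src_arc_Suc[of f "j - 1"] by simp

lemma succ_in: "a \<in> arcs \<Longrightarrow> succ c a \<in> arcs"
proof -
  assume "a \<in> arcs"
  then obtain f j where "f < F" "black f = c" "arc f j = a" using arc_ex by blast
  then show ?thesis using arc_in[of f "j + 1"] arc_succ[of f j] by simp
qed

text \<open>Faces can be walked backwards: the two successors sit at the same position of the same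
  face, and positions may be shifted by -1.\<close>

lemma succ_inj:
  assumes "a \<in> arcs" "b \<in> arcs" "succ c a = succ c b"
  shows "a = b"
proof -
  obtain f i where f: "f < F" "black f = c" "arc f i = a" using arc_ex[OF assms(1)] by blast
  obtain g j where g: "g < F" "black g = c" "arc g j = b" using arc_ex[OF assms(2)] by blast
  have "arc f (i + 1) = arc g (j + 1)" using f g assms(3) by (simp add: arc_succ)
  then have "f = g \<and> (i + 1) mod int (len f) = (j + 1) mod int (len f)"
    using f g by (intro arc_eqD) auto
  moreover from this have "i mod int (len f) = j mod int (len f)"
    by (metis add_diff_cancel_right' mod_diff_left_eq)
  ultimately show ?thesis using f g arc_cong by metis
qed

lemma tgt_in_V: "a \<in> arcs \<Longrightarrow> tgt a \<in> V"
  using src_succ[of a True] succ_in[of a True] unfolding V_def by (metis imageI)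

section \<open>The boundary of a face as a closed path in the graph\<close>

text \<open>The point of the realized graph reached at time \<open>s\<close> when the boundary of
  \<open>f\<close> is traversed at one edge per unit of time.\<close>

definition pt :: "nat \<Rightarrow> real \<Rightarrow> int \<Rightarrow> real" where
  "pt f s = edge_point (src (arc f \<lfloor>s\<rfloor>)) (tgt (arc f \<lfloor>s\<rfloor>)) (frac s)"

lemma pt_edge:
  assumes "f < F" "0 \<le> t" "t \<le> 1"
  shows "pt f (of_int j + t) = edge_point (src (arc f j)) (tgt (arc f j)) t"
proof (cases "t = 1")
  case True
  have "\<lfloor>of_int j + t\<rfloor> = j + 1" "frac (of_int j + t) = 0" using True by (simp_all add: frac_def)
  then have "pt f (of_int j + t) = edge_point (tgt (arc f j)) (tgt (arc f (j + 1))) 0"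
    unfolding pt_def by (simp only: src_arc_Suc[OF assms(1)])
  also have "\<dots> = edge_point (src (arc f j)) (tgt (arc f j)) t"
    using True by (simp add: edge_point_def fun_eq_iff)
  finally show ?thesis .
next
  case False
  then have "\<lfloor>of_int j + t\<rfloor> = j" using assms by (simp add: floor_eq_iff)
  then show ?thesis by (simp add: pt_def frac_def)
qed

text \<open>The support of the barycentric coordinates distinguishes vertices from inner points of
  edges, and a support with two elements determines the arc by \<open>ends_inj\<close>. As
  \<open>t = 1\<close> is excluded, a vertex always appears as the source of an arc.\<close>

lemma edge_point_eqD:
  assumes "a \<in> arcs" "b \<in> arcs" "0 \<le> t" "t < 1" "0 \<le> t'" "t' < 1"
    and eq: "edge_point (src a) (tgt a) t = edge_point (src b) (tgt b) t'"
  shows "(t = 0 \<and> t' = 0 \<and> src a = src b) \<or> (t \<noteq> 0 \<and> t' = t \<and> a = b)"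
proof -
  have supp: "{u. edge_point (src a) (tgt a) t u \<noteq> 0} = (if t = 0 then {src a} else {src a, tgt a})"
    if "a \<in> arcs" "0 \<le> t" "t < 1" for a t using that src_ne_tgt[of a] by (auto simp: edge_point_def)
  have card: "card {src a, tgt a} = 2" if "a \<in> arcs" for a using src_ne_tgt[OF that] by simp
  have S: "(if t = 0 then {src a} else {src a, tgt a}) = (if t' = 0 then {src b} else {src b, tgt b})"
    using supp[of a t] supp[of b t'] eq assms by simp
  show ?thesis
  proof (cases "t = 0")
    case True
    have "t' = 0"
    proof (rule ccontr)
      assume "t' \<noteq> 0"
      then have "{src b, tgt b} = {src a}" using S True by simp
      then show False using card[OF assms(2)] by simp
    qed
    then show ?thesis using S True by simp
  next
    case False
    have "t' \<noteq> 0"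
    proof
      assume "t' = 0"
      then have "{src a, tgt a} = {src b}" using S False by simp
      then show False using card[OF assms(1)] by simp
    qed
    then have ab: "a = b" using S False ends_inj assms(1,2) by simp
    have "edge_point (src a) (tgt a) t (tgt a) = t" "edge_point (src a) (tgt a) t' (tgt a) = t'"
      using src_ne_tgt[OF assms(1)] by (auto simp: edge_point_def)
    moreover have "edge_point (src a) (tgt a) t (tgt a) = edge_point (src a) (tgt a) t' (tgt a)"
      using fun_cong[OF eq, of "tgt a"] unfolding ab .
    ultimately show ?thesis using False ab by argo
  qed
qed

text \<open>All identifications made by the gluing are read off from this dichotomy between vertices
  and inner points of edges.\<close>

lemma pt_eqD:
  assumes "f < F" "f' < F" "pt f s = pt f' s'"
  shows "(frac s = 0 \<and> frac s' = 0 \<and> src (arc f \<lfloor>s\<rfloor>) = src (arc f' \<lfloor>s'\<rfloor>)) \<or>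
    (frac s \<noteq> 0 \<and> frac s' = frac s \<and> arc f \<lfloor>s\<rfloor> = arc f' \<lfloor>s'\<rfloor>)"
  using edge_point_eqD[OF arc_in[OF assms(1)] arc_in[OF assms(2)]
      frac_ge_0 frac_lt_1 frac_ge_0 frac_lt_1 assms(3)[unfolded pt_def]] by blast

lemma pt_period:
  assumes "f < F"
  shows "pt f (s + of_int (n * int (len f))) = pt f s"
proof -
  have "\<lfloor>s + of_int (n * int (len f))\<rfloor> = \<lfloor>s\<rfloor> + n * int (len f)" by linarith
  moreover from this have "frac (s + of_int (n * int (len f))) = frac s" by (simp add: frac_def)
  moreover have "arc f (\<lfloor>s\<rfloor> + n * int (len f)) = arc f \<lfloor>s\<rfloor>" by (rule arc_cong[OF assms]) simp
  ultimately show ?thesis by (simp add: pt_def)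
qed

lemma continuous_on_edge_point: "continuous_on A (\<lambda>t. edge_point x y (g t))"
  if "continuous_on A g" unfolding edge_point_def
proof (rule continuous_on_coordinatewise_then_product)
  fix i show "continuous_on A (\<lambda>t. (if i = x then 1 - g t else 0) + (if i = y then g t else 0))"
    using that by (cases "i = x"; cases "i = y") (auto intro!: continuous_intros)
qed

lemma continuous_on_pt:
  assumes "f < F"
  shows "continuous_on {0..real n} (pt f)"
proof (induction n)
  case (Suc n)
  have "continuous_on {real n..real (Suc n)} (pt f)"
  proof (rule continuous_on_eq)
    show "continuous_on {real n..real (Suc n)}
        (\<lambda>s. edge_point (src (arc f (int n))) (tgt (arc f (int n))) (s - real n))"
      by (intro continuous_on_edge_point continuous_intros)
    show "edge_point (src (arc f (int n))) (tgt (arc f (int n))) (s - real n) = pt f s"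
      if "s \<in> {real n..real (Suc n)}" for s
      using pt_edge[OF assms, of "s - real n" "int n"] that by simp
  qed
  moreover have "{0..real (Suc n)} = {0..real n} \<union> {real n..real (Suc n)}" by auto
  ultimately show ?case using Suc by (simp add: continuous_on_closed_Un del: of_nat_Suc)
qed auto

definition bd :: "nat \<Rightarrow> complex \<Rightarrow> int \<Rightarrow> real" where
  "bd f z = pt f (real (len f) * Arg2pi z / (2 * pi))"

text \<open>\<open>Arg2pi\<close> recovers the parameter only up to full turns, which the
  periodicity of \<open>pt\<close> absorbs.\<close>

lemma bd_turn:
  assumes "f < F"
  shows "bd f (turn (of_real (s / real (len f)))) = pt f s"
proof -
  let ?z = "turn (of_real (s / real (len f)))"
  have "turn (of_real (Arg2pi ?z / (2 * pi))) = ?z" by (rule turn_Arg2pi) simp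
  then obtain n :: int where "complex_of_real (Arg2pi ?z / (2 * pi)) = of_real (s / real (len f)) + of_int n"
    unfolding turn_eq_iff by blast
  then have "Arg2pi ?z / (2 * pi) = s / real (len f) + of_int n"
    by (metis (no_types, lifting) of_real_add of_real_eq_iff of_real_of_int_eq)
  then have "real (len f) * Arg2pi ?z / (2 * pi) = s + of_int (n * int (len f))"
    using len_pos[OF assms] by (simp add: field_simps)
  then show ?thesis by (simp only: bd_def pt_period[OF assms])
qed

lemma boundary_turn:
  assumes "f < F" "norm z = 1"
  obtains s where "z = turn (of_real (s / real (len f)))" "0 \<le> s" "s \<le> len f"
proof
  let ?s = "real (len f) * (Arg2pi z / (2 * pi))"
  show "z = turn (of_real (?s / real (len f)))"
    using turn_Arg2pi[OF assms(2)] len_pos[OF assms(1)] by simp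
  show "0 \<le> ?s" using Arg2pi_ge_0[of z] by simp
  have "Arg2pi z / (2 * pi) \<le> 1" using Arg2pi_lt_2pi[of z] by simp
  then have "?s \<le> real (len f) * 1" by (intro mult_left_mono) auto
  then show "?s \<le> len f" by simp
qed

text \<open>\<open>Arg2pi\<close> jumps at 1, so continuity is not visible in the definition of
  \<open>bd\<close>. The circle is a quotient of the interval \<open>{0..len f}\<close>, on which
  \<open>bd f\<close> becomes the continuous path \<open>pt f\<close>.\<close>

lemma continuous_on_bd:
  assumes "f < F"
  shows "continuous_on (sphere 0 1) (bd f)"
proof -
  let ?g = "\<lambda>s. turn (of_real (s / real (len f)))"
  let ?I = "{0..real (len f)}"
  have l: "len f \<noteq> 0" using len_pos[OF assms] by simp
  have cg: "continuous_on ?I ?g" using l by (intro continuous_intros) auto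
  have im: "?g ` ?I = sphere 0 1"
  proof
    show "?g ` ?I \<subseteq> sphere 0 1" by auto
    show "sphere 0 1 \<subseteq> ?g ` ?I"
    proof
      fix z :: complex assume "z \<in> sphere 0 1"
      then have "norm z = 1" by simp
      then obtain s where "z = ?g s" "0 \<le> s" "s \<le> len f" by (rule boundary_turn[OF assms])
      then show "z \<in> ?g ` ?I" by (intro image_eqI[of _ _ s]) auto
    qed
  qed
  have "quotient_map (top_of_set ?I) (top_of_set (sphere 0 1)) ?g"
  proof (rule continuous_imp_quotient_map)
    show "continuous_map (top_of_set ?I) (top_of_set (sphere 0 1)) ?g" using cg im by auto
    show "compact_space (top_of_set ?I)" by (simp add: compact_space_subtopology)
    show "Hausdorff_space (top_of_set (sphere (0::complex) 1))"
      by (simp add: Hausdorff_space_subtopology)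
  qed (use im in simp)
  moreover have "continuous_map (top_of_set ?I) euclidean (bd f \<circ> ?g)"
  proof -
    have "bd f \<circ> ?g = pt f" by (rule ext) (simp only: comp_def bd_turn[OF assms])
    then show ?thesis using continuous_on_pt[OF assms] by simp
  qed
  ultimately have "continuous_map (top_of_set (sphere 0 1)) euclidean (bd f)"
    by (rule continuous_compose_quotient_map)
  then show ?thesis by simp
qed

section \<open>The glued space\<close>

definition K :: "(nat \<times> complex) set" where "K = {..<F} \<times> cball 0 1"

text \<open>Points of \<open>K\<close> are to be glued exactly when their labels agree: an inner
  point is its own label, a boundary point is labelled by its place in the graph.\<close>

definition label :: "nat \<times> complex \<Rightarrow> nat \<times> complex + (int \<Rightarrow> real)" where
  "label p = (if norm (snd p) = 1 then Inr (bd (fst p) (snd p)) else Inl p)"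

text \<open>Labels have to be turned into complex numbers, since the surface is a topology on
  \<open>complex\<close>. A representative \<open>(f, z)\<close> in \<open>K\<close> is chosen and
  placed at \<open>3 * f + z\<close>: discs of radius 1 whose centres are at least 3 apart do not
  meet, so the coding is injective. Nothing else about its values matters.\<close>

definition code :: "nat \<times> complex + (int \<Rightarrow> real) \<Rightarrow> complex" where
  "code c = (let p = inv_into K label c in 3 * of_nat (fst p) + snd p)"

definition glue :: "nat \<times> complex \<Rightarrow> complex" where
  "glue p = code (label p)"

definition S :: "complex topology" where
  "S = quotient_topology (top_of_set K) glue"

text \<open>Every point of the graph is the label of a boundary point, so the embedding is defined
  without choosing a face at each edge.\<close>

definition graph_map :: "(int \<Rightarrow> real) \<Rightarrow> complex" where
  "graph_map w = code (Inr w)"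

definition face :: "nat \<Rightarrow> complex set" where
  "face f = glue ` ({f} \<times> ball 0 1)"

lemma compact_K: "compact K"
  unfolding K_def by (intro compact_Times) (auto simp: finite_imp_compact)

lemma K_separated:
  assumes "p \<in> K" "p' \<in> K" "3 * of_nat (fst p) + snd p = 3 * of_nat (fst p') + snd p'"
  shows "p = p'"
proof -
  have "3 * (of_nat (fst p) - of_nat (fst p') :: complex) = snd p' - snd p"
    using assms(3) by (simp add: algebra_simps)
  then have "norm (3 * (of_nat (fst p) - of_nat (fst p') :: complex)) \<le> norm (snd p') + norm (snd p)"
    by (simp add: norm_triangle_ineq4)
  also have "\<dots> \<le> 2" using assms(1,2) by (auto simp: K_def)
  also have "norm (3 * (of_nat (fst p) - of_nat (fst p') :: complex)) =
      3 * \<bar>real (fst p) - real (fst p')\<bar>"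
    by (simp only: norm_mult norm_numeral) (metis norm_of_real of_real_diff of_real_of_nat_eq real_norm_def)
  finally have *: "3 * \<bar>real (fst p) - real (fst p')\<bar> \<le> 2" .
  have "fst p = fst p'"
  proof (rule ccontr)
    assume "fst p \<noteq> fst p'"
    then have "fst p + 1 \<le> fst p' \<or> fst p' + 1 \<le> fst p" by linarith
    then have "real (fst p) + 1 \<le> real (fst p') \<or> real (fst p') + 1 \<le> real (fst p)"
      using of_nat_mono[of "fst p + 1" "fst p'", where 'a = real]
        of_nat_mono[of "fst p' + 1" "fst p", where 'a = real] by auto
    then have "1 \<le> \<bar>real (fst p) - real (fst p')\<bar>" by auto
    then show False using * by simp
  qed
  then show ?thesis using assms(3) by (simp add: prod_eq_iff)
qed

lemma code_inj:
  assumes "p \<in> K" "p' \<in> K" "code (label p) = code (label p')"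
  shows "label p = label p'"
proof -
  let ?i = "\<lambda>p. inv_into K label (label p)"
  have "?i p \<in> K" "?i p' \<in> K" using assms(1,2) by (auto intro: inv_into_into)
  moreover have "3 * of_nat (fst (?i p)) + snd (?i p) = 3 * of_nat (fst (?i p')) + snd (?i p')"
    using assms(3) by (simp add: code_def Let_def)
  ultimately have "?i p = ?i p'" by (rule K_separated)
  moreover have "label (?i p) = label p" "label (?i p') = label p'"
    using assms(1,2) by (auto intro: f_inv_into_f)
  ultimately show ?thesis by metis
qed

lemma glue_eq_iff: "p \<in> K \<Longrightarrow> p' \<in> K \<Longrightarrow> glue p = glue p' \<longleftrightarrow> label p = label p'"
  using code_inj[of p p'] by (auto simp: glue_def)

lemma glue_boundary: "norm z = 1 \<Longrightarrow> glue (f, z) = graph_map (bd f z)"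
  by (simp add: glue_def graph_map_def label_def)

lemma glue_turn: "f < F \<Longrightarrow> glue (f, turn (of_real (s / real (len f)))) = graph_map (pt f s)"
  using glue_boundary[of "turn (of_real (s / real (len f)))" f] bd_turn[of f s]
  by (simp only: norm_turn_eq_1 Im_complex_of_real)

lemma turn_in_K: "f < F \<Longrightarrow> (f, turn (of_real s)) \<in> K" by (simp add: K_def)

lemma label_turn: "f < F \<Longrightarrow> label (f, turn (of_real (s / real (len f)))) = Inr (pt f s)"
  using bd_turn[of f s] unfolding label_def
  by (simp only: norm_turn_eq_1 Im_complex_of_real fst_conv snd_conv refl if_True)

lemma graph_map_pt_eq_iff: "f < F \<Longrightarrow> f' < F \<Longrightarrow> graph_map (pt f s) = graph_map (pt f' s') \<longleftrightarrow> pt f s = pt f' s'"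
  using glue_eq_iff[OF turn_in_K turn_in_K, of f f' "s / real (len f)" "s' / real (len f')"]
  by (simp only: glue_turn label_turn sum.inject)

section \<open>The geometric realization as the image of the boundary circles\<close>

lemma realization_edge:
  assumes "w \<in> realization V E" "a \<in> arcs" and supp: "\<And>x. w x \<noteq> 0 \<Longrightarrow> x \<in> {src a, tgt a}"
  shows "w = edge_point (src a) (tgt a) (w (tgt a))" "0 \<le> w (tgt a)" "w (tgt a) \<le> 1"
proof -
  have ab: "src a \<noteq> tgt a" "src a \<in> V" "tgt a \<in> V"
    using assms(2) src_ne_tgt tgt_in_V by (auto simp: V_def)
  have nn: "0 \<le> w x" for x using assms(1) by (auto simp: realization_def)
  have "(\<Sum>x\<in>V. w x) = (\<Sum>x\<in>{src a, tgt a}. w x)"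
    using supp ab by (intro sum.mono_neutral_right finite_V) auto
  then have 1: "w (src a) + w (tgt a) = 1" using assms(1) ab by (simp add: realization_def)
  show "w = edge_point (src a) (tgt a) (w (tgt a))"
  proof
    fix u show "w u = edge_point (src a) (tgt a) (w (tgt a)) u"
      using 1 ab supp[of u] by (auto simp: edge_point_def)
  qed
  show "0 \<le> w (tgt a)" "w (tgt a) \<le> 1" using nn[of "src a"] nn[of "tgt a"] 1 by simp_all
qed

text \<open>Vertices form no separate case, since each one is the source of an arc.\<close>

lemma realization_eq:
  "realization V E = {edge_point (src a) (tgt a) t | a t. a \<in> arcs \<and> 0 \<le> t \<and> t \<le> 1}"
proof (intro set_eqI iffI)
  fix w assume w: "w \<in> realization V E"
  obtain s where s: "s \<in> E \<union> (\<lambda>x. {x}) ` V" "\<And>x. w x \<noteq> 0 \<Longrightarrow> x \<in> s"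
    using w by (auto simp: realization_def)
  obtain a where a: "a \<in> arcs" "s \<subseteq> {src a, tgt a}" using s(1) by (auto simp: E_def V_def)
  then have "\<And>x. w x \<noteq> 0 \<Longrightarrow> x \<in> {src a, tgt a}" using s(2) by blast
  note realization_edge[OF w a(1) this]
  then show "w \<in> {edge_point (src a) (tgt a) t | a t. a \<in> arcs \<and> 0 \<le> t \<and> t \<le> 1}" using a(1) by blast
next
  fix w assume "w \<in> {edge_point (src a) (tgt a) t | a t. a \<in> arcs \<and> 0 \<le> t \<and> t \<le> 1}"
  then obtain a t where a: "a \<in> arcs" "0 \<le> t" "t \<le> 1" and w: "w = edge_point (src a) (tgt a) t"
    by blast
  have ab: "src a \<noteq> tgt a" "src a \<in> V" "tgt a \<in> V"
    using a(1) src_ne_tgt tgt_in_V by (auto simp: V_def)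
  have "(\<Sum>x\<in>V. w x) = (\<Sum>x\<in>{src a, tgt a}. w x)"
    using ab by (intro sum.mono_neutral_right finite_V) (auto simp: w edge_point_def)
  also have "\<dots> = 1" using ab by (simp add: w edge_point_def)
  finally have 1: "(\<Sum>x\<in>V. w x) = 1" .
  have 2: "\<forall>x. 0 \<le> w x" using a by (simp add: w edge_point_def)
  have 3: "{src a, tgt a} \<in> E \<union> (\<lambda>x. {x}) ` V" using a(1) by (simp add: E_def)
  have 4: "\<forall>x. w x \<noteq> 0 \<longrightarrow> x \<in> {src a, tgt a}" by (simp add: w edge_point_def)
  show "w \<in> realization V E" unfolding realization_def using 1 2 3 4 by blast
qed

lemma pt_realization: "f < F \<Longrightarrow> pt f s \<in> realization V E" unfolding realization_eq pt_def
  using arc_in frac_ge_0[of s] frac_lt_1[of s] less_imp_le by blast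

lemma realization_pt:
  assumes "w \<in> realization V E"
  obtains f s where "f < F" "w = pt f s"
proof -
  obtain a t where a: "a \<in> arcs" "0 \<le> t" "t \<le> 1" "w = edge_point (src a) (tgt a) t"
    using assms unfolding realization_eq by blast
  obtain f j where f: "f < F" "arc f j = a" using arc_ex[OF a(1)] by blast
  show ?thesis using that[of f "of_int j + t"] f a pt_edge[of f t j] by simp
qed

definition rim :: "(nat \<times> complex) set" where "rim = {..<F} \<times> sphere 0 1"

lemma rim_subset: "rim \<subseteq> K" by (auto simp: rim_def K_def)

lemma compact_rim: "compact rim"
  unfolding rim_def by (intro compact_Times) (auto simp: finite_imp_compact)

lemma continuous_on_rim: "continuous_on rim (\<lambda>p. bd (fst p) (snd p))"
  unfolding rim_def by (rule continuous_on_discrete_Times) (simp add: continuous_on_bd)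

lemma rim_image: "(\<lambda>p. bd (fst p) (snd p)) ` rim = realization V E"
proof
  show "(\<lambda>p. bd (fst p) (snd p)) ` rim \<subseteq> realization V E"
    unfolding rim_def bd_def using pt_realization by auto
  show "realization V E \<subseteq> (\<lambda>p. bd (fst p) (snd p)) ` rim"
  proof
    fix w assume "w \<in> realization V E"
    then obtain f s where f: "f < F" "w = pt f s" by (rule realization_pt)
    then show "w \<in> (\<lambda>p. bd (fst p) (snd p)) ` rim" using bd_turn[OF f(1), of s]
      by (intro image_eqI[of _ _ "(f, turn (of_real (s / real (len f))))"])
        (auto simp: rim_def simp del: of_real_divide)
  qed
qed

section \<open>Separation and compactness of the quotient\<close>

lemma topspace_S [simp]: "topspace S = glue ` K" by (simp add: S_def)

lemma quotient_glue: "quotient_map (top_of_set K) S glue"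
  unfolding S_def by (rule quotient_map_quotient_topology)

lemma openin_S: "openin S U \<longleftrightarrow> U \<subseteq> glue ` K \<and> openin (top_of_set K) {p \<in> K. glue p \<in> U}"
  by (simp add: S_def openin_quotient_topology)

lemma continuous_glue: "continuous_map (top_of_set K) S glue"
  using quotient_glue by (rule quotient_imp_continuous_map)

text \<open>Saturating a compact set \<open>C\<close> adds only boundary points, namely those whose
  \<open>bd\<close>-value is taken on \<open>C \<inter> rim\<close>. These values form a compact,
  hence closed set, so its preimage in the compact \<open>rim\<close> is compact again.\<close>

lemma closed_glue: "closed_map (top_of_set K) S glue" unfolding closed_map_def
proof (intro allI impI)
  fix C assume "closedin (top_of_set K) C"
  then have C: "C \<subseteq> K" "compact C" by (auto simp: closedin_compact_eq compact_K)
  let ?b = "\<lambda>p. bd (fst p) (snd p)"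
  let ?B = "?b ` (C \<inter> rim)"
  have "compact (C \<inter> rim)" using C(2) compact_rim by (simp add: compact_Int)
  then have "compact ?B"
    by (intro compact_continuous_image continuous_on_subset[OF continuous_on_rim]) auto
  then have "closed ?B" by (rule compact_imp_closed)
  then have "closedin (top_of_set rim) (rim \<inter> ?b -` ?B)"
    by (intro continuous_closedin_preimage continuous_on_rim)
  then have "compact (rim \<inter> ?b -` ?B)" using closedin_compact_eq[OF compact_rim] by blast
  then have "compact (C \<union> (rim \<inter> ?b -` ?B))" using C(2) by (rule compact_Un[rotated])
  moreover have "{p \<in> K. glue p \<in> glue ` C} = C \<union> (rim \<inter> ?b -` ?B)"
  proof (intro set_eqI iffI)
    fix p assume "p \<in> {p \<in> K. glue p \<in> glue ` C}"
    then obtain c where c: "p \<in> K" "c \<in> C" "glue p = glue c" by blast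
    then have l: "label p = label c" using C(1) by (metis glue_eq_iff subsetD)
    show "p \<in> C \<union> (rim \<inter> ?b -` ?B)"
    proof (cases "norm (snd p) = 1")
      case True
      then have "norm (snd c) = 1" "?b p = ?b c" using l by (auto simp: label_def split: if_splits)
      then have "c \<in> C \<inter> rim" "p \<in> rim" using c C(1) True by (auto simp: rim_def K_def)
      then show ?thesis using \<open>?b p = ?b c\<close> by blast
    next
      case False
      then have "p = c" using l by (auto simp: label_def split: if_splits)
      then show ?thesis using c by simp
    qed
  next
    fix p assume p: "p \<in> C \<union> (rim \<inter> ?b -` ?B)"
    then consider "p \<in> C" | c where "p \<in> rim" "c \<in> C" "c \<in> rim" "?b p = ?b c" by auto
    then show "p \<in> {p \<in> K. glue p \<in> glue ` C}"
    proof cases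
      case 1 then show ?thesis using C(1) by auto
    next
      case 2
      then have "label p = label c" by (auto simp: label_def rim_def)
      then have "glue p = glue c" by (simp add: glue_def)
      then show ?thesis using 2 rim_subset by blast
    qed
  qed
  ultimately have "closedin (top_of_set K) {p \<in> K. glue p \<in> glue ` C}"
    using C(1) rim_subset by (auto simp: closedin_compact_eq[OF compact_K])
  moreover have "glue ` C \<subseteq> glue ` K" using C(1) by blast
  ultimately show "closedin S (glue ` C)"
    using quotient_glue unfolding quotient_map_closedin by simp
qed

lemma Hausdorff_S: "Hausdorff_space S"
proof (rule Hausdorff_space_closed_map_image[OF _ _ continuous_glue closed_glue])
  show "compact_space (top_of_set K)" by (simp add: compact_space_subtopology compact_K)
  show "Hausdorff_space (top_of_set K)"
    by (intro Hausdorff_space_subtopology Hausdorff_space_euclidean_t2)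
qed simp

lemma compact_S: "compact_space S"
proof -
  have "compactin S (glue ` K)"
    by (rule image_compactin[OF _ continuous_glue]) (simp add: compactin_subtopology compact_K)
  then show ?thesis by (simp add: compact_space_def)
qed

section \<open>The open faces\<close>

lemma glue_face_eq:
  assumes "f < F" "norm z < 1" "p \<in> K" "glue p = glue (f, z)"
  shows "p = (f, z)"
proof -
  have "label p = label (f, z)" using assms by (subst glue_eq_iff[symmetric]) (auto simp: K_def)
  then show ?thesis using assms(2) by (auto simp: label_def split: if_splits)
qed

lemma openin_face_part:
  assumes "f < F" "open U" "U \<subseteq> ball 0 1"
  shows "openin S (glue ` ({f} \<times> U))" unfolding openin_S
proof
  have "{p \<in> K. glue p \<in> glue ` ({f} \<times> U)} = K \<inter> ({f} \<times> U)"
  proof (intro set_eqI iffI)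
    fix p assume "p \<in> {p \<in> K. glue p \<in> glue ` ({f} \<times> U)}"
    then obtain z where z: "p \<in> K" "z \<in> U" "glue p = glue (f, z)" by blast
    then have "p = (f, z)" using assms by (intro glue_face_eq) auto
    then show "p \<in> K \<inter> ({f} \<times> U)" using z by auto
  qed auto
  moreover have "open ({f} \<times> U)" using assms(2) by (intro open_Times) (auto simp: open_discrete)
  ultimately show "openin (top_of_set K) {p \<in> K. glue p \<in> glue ` ({f} \<times> U)}"
    by (simp add: openin_open_Int)
  show "glue ` ({f} \<times> U) \<subseteq> glue ` K" using assms by (intro image_mono) (auto simp: K_def)
qed

lemma openin_face: "f < F \<Longrightarrow> openin S (face f)" unfolding face_def by (rule openin_face_part) auto

lemma continuous_glue_disc:
  assumes "f < F"
  shows "continuous_map (top_of_set (cball 0 1)) S (\<lambda>z. glue (f, z))"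
proof -
  have "continuous_map (top_of_set (cball 0 1)) (top_of_set K) (\<lambda>z. (f, z))"
    using assms by (auto simp: K_def intro!: continuous_intros)
  from continuous_map_compose[OF this continuous_glue] show ?thesis by (simp add: comp_def)
qed

text \<open>\<open>h\<close> will be the identity or complex conjugation. Being an involution, it
  turns images of open sets into preimages, which are open by continuity.\<close>

lemma parametrization_face:
  assumes f: "f < F" and h: "continuous_on UNIV h" "\<And>z. h (h z) = z" "\<And>z. norm (h z) = norm z"
  shows "parametrization S (\<lambda>z. glue (f, h z))" "(\<lambda>z. glue (f, h z)) ` ball 0 1 = face f"
proof -
  have hU: "h ` U = h -` U" for U using h(2) by (auto simp: image_iff) metis
  have hb: "h ` ball 0 1 = ball 0 1" unfolding hU using h(3) by auto
  have im: "(\<lambda>z. glue (f, h z)) ` U = glue ` ({f} \<times> h ` U)" for U by auto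
  show img: "(\<lambda>z. glue (f, h z)) ` ball 0 1 = face f" unfolding im hb face_def ..
  have "homeomorphic_map (top_of_set (ball 0 1)) (subtopology S (face f)) (\<lambda>z. glue (f, h z))"
  proof (rule bijective_open_imp_homeomorphic_map)
    have ch: "continuous_map (top_of_set (ball 0 1)) (top_of_set (cball 0 1)) h"
      using continuous_on_subset[OF h(1)] h(3) by auto
    have "continuous_map (top_of_set (ball 0 1)) S (\<lambda>z. glue (f, h z))"
      using continuous_map_compose[OF ch continuous_glue_disc[OF f]] by (simp add: comp_def)
    then show "continuous_map (top_of_set (ball 0 1)) (subtopology S (face f)) (\<lambda>z. glue (f, h z))"
      using img by (auto simp: continuous_map_in_subtopology)
    show "open_map (top_of_set (ball 0 1)) (subtopology S (face f)) (\<lambda>z. glue (f, h z))"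
      unfolding open_map_def
    proof (intro allI impI)
      fix U assume "openin (top_of_set (ball (0::complex) 1)) U"
      then have U: "open U" "U \<subseteq> ball 0 1" by (auto simp: openin_open_eq)
      have "open (h ` U)" unfolding hU using U(1) h(1) by (rule open_vimage)
      moreover have "h ` U \<subseteq> ball 0 1" using U(2) hb by blast
      ultimately have "openin S (glue ` ({f} \<times> h ` U))" by (rule openin_face_part[OF f])
      then show "openin (subtopology S (face f)) ((\<lambda>z. glue (f, h z)) ` U)"
        unfolding im openin_open_subtopology[OF openin_face[OF f]]
        using \<open>h ` U \<subseteq> ball 0 1\<close> by (auto simp: face_def)
    qed
    show "inj_on (\<lambda>z. glue (f, h z)) (topspace (top_of_set (ball 0 1)))"
    proof (rule inj_onI)
      fix z z' assume z: "z \<in> topspace (top_of_set (ball 0 1))" "z' \<in> topspace (top_of_set (ball 0 1))"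
        "glue (f, h z) = glue (f, h z')"
      then have "(f, h z) = (f, h z')" using f h(3) by (intro glue_face_eq) (auto simp: K_def)
      then show "z = z'" using h(2) by (metis prod.inject)
    qed
    have "face f \<subseteq> glue ` K" using openin_subset[OF openin_face[OF f]] by simp
    then show "(\<lambda>z. glue (f, h z)) ` topspace (top_of_set (ball 0 1)) = topspace (subtopology S (face f))"
      using img by auto
  qed
  then show "parametrization S (\<lambda>z. glue (f, h z))"
    unfolding parametrization_def img using openin_face[OF f] by simp
qed

lemma face_eq: "face f = (\<lambda>z. glue (f, z)) ` ball 0 1" by (auto simp: face_def)

lemma graph_map_bd: "p \<in> rim \<Longrightarrow> graph_map (bd (fst p) (snd p)) = glue p"
  using glue_boundary[of "snd p" "fst p"] by (simp add: rim_def mem_Times_iff)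

section \<open>The embedded graph and the components of its complement\<close>

text \<open>The realization is a quotient of the compact \<open>rim\<close> under \<open>bd\<close>,
  so continuity may be tested after composition with \<open>bd\<close>, where
  \<open>graph_map\<close> becomes \<open>glue\<close>.\<close>

lemma continuous_graph_map: "continuous_map (top_of_set (realization V E)) S graph_map"
proof -
  let ?b = "\<lambda>p. bd (fst p) (snd p)"
  have "quotient_map (top_of_set rim) (top_of_set (realization V E)) ?b"
  proof (rule continuous_imp_quotient_map)
    show "continuous_map (top_of_set rim) (top_of_set (realization V E)) ?b"
      using continuous_on_rim rim_image by auto
    show "compact_space (top_of_set rim)" by (simp add: compact_space_subtopology compact_rim)
    show "Hausdorff_space (top_of_set (realization V E))"
      by (intro Hausdorff_space_subtopology Hausdorff_space_euclidean_t2)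
  qed (use rim_image in simp)
  moreover have "continuous_map (top_of_set rim) S (graph_map \<circ> ?b)"
  proof (rule continuous_map_eq)
    have "rim = K \<inter> rim" using rim_subset by auto
    then show "continuous_map (top_of_set rim) S glue"
      using continuous_map_from_subtopology[OF continuous_glue, of rim]
      by (metis subtopology_subtopology)
    show "glue p = (graph_map \<circ> ?b) p" if "p \<in> topspace (top_of_set rim)" for p
      using that graph_map_bd by simp
  qed
  ultimately show ?thesis by (rule continuous_compose_quotient_map)
qed

lemma graph_map_image: "graph_map ` realization V E = glue ` rim"
  unfolding rim_image[symmetric] image_image using graph_map_bd by (intro image_cong) auto

lemma graph_embedding_graph_map: "graph_embedding V E S graph_map" unfolding graph_embedding_def
proof
  show "inj_on graph_map (realization V E)"
  proof (rule inj_onI)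
    fix w w' assume w: "w \<in> realization V E" "w' \<in> realization V E" "graph_map w = graph_map w'"
    obtain f s where f: "f < F" "w = pt f s" using w(1) by (rule realization_pt)
    obtain f' s' where f': "f' < F" "w' = pt f' s'" using w(2) by (rule realization_pt)
    show "w = w'" using w(3) graph_map_pt_eq_iff[OF f(1) f'(1)] f f' by simp
  qed
qed (rule continuous_graph_map)

lemma topspace_minus_graph: "topspace S - graph_map ` realization V E = (\<Union>f<F. face f)"
proof
  show "topspace S - graph_map ` realization V E \<subseteq> (\<Union>f<F. face f)"
  proof
    fix y assume "y \<in> topspace S - graph_map ` realization V E"
    then obtain f z where p: "(f, z) \<in> K" "(f, z) \<notin> rim" "y = glue (f, z)"
      unfolding graph_map_image by auto
    then have "f < F" "norm z < 1" by (auto simp: K_def rim_def)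
    then have "y \<in> face f" unfolding face_eq p(3) by auto
    then show "y \<in> (\<Union>f<F. face f)" using \<open>f < F\<close> by auto
  qed
  show "(\<Union>f<F. face f) \<subseteq> topspace S - graph_map ` realization V E"
  proof
    fix y assume "y \<in> (\<Union>f<F. face f)"
    then obtain f z where f: "f < F" "norm z < 1" "y = glue (f, z)" by (auto simp: face_def)
    have "y \<notin> glue ` rim"
    proof
      assume "y \<in> glue ` rim"
      then obtain p where p: "p \<in> rim" "glue p = glue (f, z)" using f(3) by auto
      then have "p = (f, z)" using f rim_subset by (intro glue_face_eq) auto
      then show False using p(1) f(2) by (simp add: rim_def)
    qed
    moreover have "y \<in> topspace S" using f by (auto simp: K_def)
    ultimately show "y \<in> topspace S - graph_map ` realization V E" unfolding graph_map_image by simp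
  qed
qed

lemma face_disjoint:
  assumes "f < F" "f' < F" "f \<noteq> f'"
  shows "face f \<inter> face f' = {}"
proof (rule ccontr)
  assume "face f \<inter> face f' \<noteq> {}"
  then obtain z z' where z: "norm z < 1" "norm z' < 1" "glue (f', z') = glue (f, z)"
    by (force simp: face_def)
  then have "(f', z') = (f, z)" using assms by (intro glue_face_eq) (auto simp: K_def)
  then show False using assms(3) by simp
qed

lemma face_nonempty: "face f \<noteq> {}" by (simp add: face_def)

lemma inj_on_face: "inj_on face {..<F}"
  using face_disjoint face_nonempty by (metis inf.idem inj_onI lessThan_iff)

lemma connectedin_face:
  assumes "f < F"
  shows "connectedin S (face f)"
proof -
  have "continuous_map (top_of_set (ball 0 1)) S (\<lambda>z. glue (f, z))"
    using continuous_map_from_subtopology[OF continuous_glue_disc[OF assms], of "ball 0 1"]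
    by (simp add: subtopology_subtopology Int_absorb1 ball_subset_cball)
  then have "connectedin S ((\<lambda>z. glue (f, z)) ` ball 0 1)"
    by (rule connectedin_continuous_map_image) (simp add: connectedin_subtopology)
  then show ?thesis unfolding face_eq .
qed

text \<open>The open discs are disjoint, connected and open, and they fill the complement of the
  graph. Each is therefore also closed in it and makes up a whole component.\<close>

lemma faces_eq: "faces V E S graph_map = face ` {..<F}"
proof -
  define Y where "Y = subtopology S (topspace S - graph_map ` realization V E)"
  have topY: "topspace Y = (\<Union>f<F. face f)" unfolding Y_def using topspace_minus_graph by auto
  have sub: "face f \<subseteq> (\<Union>f<F. face f)" if "f < F" for f using that by auto
  have op: "openin Y (face f)" if "f < F" for f
  proof -
    have "openin S (\<Union>f<F. face f)" using openin_face by auto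
    then show ?thesis unfolding Y_def topspace_minus_graph
      using openin_face[OF that] sub[OF that] by (simp add: openin_open_subtopology)
  qed
  have conn: "connectedin Y (face f)" if "f < F" for f
    unfolding Y_def topspace_minus_graph connectedin_subtopology
    using connectedin_face[OF that] sub[OF that] by simp
  have cl: "closedin Y (face f)" if f: "f < F" for f
  proof -
    have "topspace Y - face f = (\<Union>f'\<in>{..<F} - {f}. face f')"
      unfolding topY using face_disjoint f by blast
    moreover have "openin Y (\<Union>f'\<in>{..<F} - {f}. face f')" using op by auto
    ultimately show ?thesis unfolding closedin_def using op[OF f] openin_subset by metis
  qed
  have comp: "face f \<in> connected_components_of Y" if f: "f < F" for f
  proof -
    obtain y where y: "y \<in> face f" using face_nonempty by auto
    have "y \<in> topspace Y" using y f topY by auto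
    define C where "C = connected_component_of_set Y y"
    have C: "C \<in> connected_components_of Y"
      unfolding C_def connected_component_in_connected_components_of by fact
    have "face f \<subseteq> C"
      unfolding C_def using conn[OF f] y by (simp add: connected_component_of_maximal)
    moreover have "C \<subseteq> face f"
    proof -
      have "connectedin Y C" using C by (rule connectedin_connected_components_of)
      moreover have "C \<inter> face f \<noteq> {}" using y \<open>face f \<subseteq> C\<close> by auto
      ultimately show ?thesis using op[OF f] cl[OF f] connectedin_clopen_cases by (metis disjnt_def)
    qed
    ultimately have "C = face f" by auto
    then show ?thesis using C by simp
  qed
  have "connected_components_of Y = face ` {..<F}"
  proof
    show "face ` {..<F} \<subseteq> connected_components_of Y" using comp by auto
    show "connected_components_of Y \<subseteq> face ` {..<F}"
    proof
      fix C assume C: "C \<in> connected_components_of Y"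
      then obtain y where y: "y \<in> C" "y \<in> topspace Y"
        using nonempty_connected_components_of connected_components_of_subset by blast
      then obtain f where f: "f < F" "y \<in> face f" using topY by auto
      then have "C = face f" using C comp[OF f(1)] y pairwise_disjoint_connected_components_of[of Y]
        by (metis disjnt_iff pairwiseD)
      then show "C \<in> face ` {..<F}" using f by auto
    qed
  qed
  then show ?thesis by (simp add: faces_def Y_def)
qed

lemma homeomorphic_map_face:
  assumes "f < F"
  shows "homeomorphic_map (top_of_set (ball 0 1)) (subtopology S (face f)) (\<lambda>z. glue (f, z))"
  using parametrization_face[OF assms, of "\<lambda>z. z"] by (simp add: parametrization_def)

lemma cellular_graph_map: "cellular V E S graph_map" unfolding cellular_def faces_eq
proof
  fix G assume "G \<in> face ` {..<F}"
  then obtain f where f: "f < F" "G = face f" by auto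
  then show "subtopology S G homeomorphic_space top_of_set (ball (0::complex) 1)"
    using homeomorphic_map_face homeomorphic_map_imp_homeomorphic_space homeomorphic_space_sym by blast
qed

section \<open>Boundary circuits and frontiers of the faces\<close>

definition face_walk :: "nat \<Rightarrow> int list" where
  "face_walk f = map (\<lambda>j. src (arc f (int j))) [0..<len f]"

lemma face_walk_next:
  assumes "f < F" "j < len f"
  shows "face_walk f ! j = src (arc f (int j))"
    "face_walk f ! (Suc j mod len f) = tgt (arc f (int j))"
proof -
  show "face_walk f ! j = src (arc f (int j))" using assms by (simp add: face_walk_def)
  have "face_walk f ! (Suc j mod len f) = src (arc f (int (Suc j mod len f)))"
    using len_pos[OF assms(1)] by (simp add: face_walk_def)
  also have "arc f (int (Suc j mod len f)) = arc f (int j + 1)"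
    by (rule arc_cong[OF assms(1)]) (simp add: zmod_int add.commute)
  finally show "face_walk f ! (Suc j mod len f) = tgt (arc f (int j))"
    by (simp add: src_arc_Suc[OF assms(1)])
qed

text \<open>The gluing map of the disc itself serves as \<open>g\<close>: the point of the circle at
  parameter \<open>s\<close> in the equal division into \<open>len f\<close> arcs is
  \<open>turn (s / len f)\<close>.\<close>

lemma face_boundary_face:
  assumes f: "f < F"
  shows "face_boundary S graph_map (face f) (circuit (face_walk f))" unfolding face_boundary_def
proof (intro exI[of _ "face_walk f"] exI[of _ "\<lambda>z. glue (f, z)"] conjI allI impI ballI)
  show "face_walk f \<noteq> []" using len_pos[OF f] by (simp add: face_walk_def)
  have l: "length (face_walk f) = len f" by (simp add: face_walk_def)
  fix j and t :: real assume j: "j < length (face_walk f)" and t: "t \<in> {0..1}"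
  have "cis (2 * pi * (real j + t) / real (len f)) = turn (of_real ((real j + t) / real (len f)))"
    by (simp only: turn_of_real times_divide_eq_right)
  then have "glue (f, cis (2 * pi * (real j + t) / real (len f))) = graph_map (pt f (real j + t))"
    by (simp only: glue_turn[OF f])
  also have "pt f (real j + t) = edge_point (src (arc f (int j))) (tgt (arc f (int j))) t"
    using pt_edge[OF f, of t "int j"] t by simp
  finally show "glue (f, cis (2 * pi * (real j + t) / real (length (face_walk f)))) =
      graph_map (edge_point (face_walk f ! j) (face_walk f ! (Suc j mod length (face_walk f))) t)"
    using face_walk_next[OF f, of j] j l by simp
qed (use continuous_glue_disc[OF f] homeomorphic_map_face[OF f] in auto)

lemma frontier_face:
  assumes f: "f < F"
  shows "S frontier_of face f = glue ` ({f} \<times> sphere 0 1)"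
proof -
  have cl: "S closure_of face f = glue ` ({f} \<times> cball 0 1)"
  proof
    have "closedin (top_of_set K) ({f} \<times> cball 0 1)"
      using f by (simp add: closedin_compact_eq[OF compact_K] compact_Times) (auto simp: K_def)
    then have "closedin S (glue ` ({f} \<times> cball 0 1))"
      using closed_glue by (simp add: closed_map_def)
    moreover have "face f \<subseteq> glue ` ({f} \<times> cball 0 1)" unfolding face_def by (intro image_mono) auto
    ultimately show "S closure_of face f \<subseteq> glue ` ({f} \<times> cball 0 1)"
      by (rule closure_of_minimal[rotated])
    have "(\<lambda>z. glue (f, z)) ` (top_of_set (cball 0 1) closure_of ball 0 1)
        \<subseteq> S closure_of ((\<lambda>z. glue (f, z)) ` ball 0 1)"
      using continuous_glue_disc[OF f] by (rule continuous_map_image_closure_subset)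
    moreover have "top_of_set (cball 0 1) closure_of ball (0::complex) 1 = cball 0 1"
      by (simp add: closure_of_subtopology Int_absorb1 ball_subset_cball)
    ultimately show "glue ` ({f} \<times> cball 0 1) \<subseteq> S closure_of face f" unfolding face_eq by auto
  qed
  have "S frontier_of face f = S closure_of face f - face f"
    using openin_face[OF f] by (simp add: frontier_of_def interior_of_openin)
  also have "\<dots> = glue ` ({f} \<times> sphere 0 1)"
  proof
    have "cball 0 1 = ball 0 1 \<union> sphere (0::complex) 1" by auto
    then have "glue ` ({f} \<times> cball 0 1) = face f \<union> glue ` ({f} \<times> sphere 0 1)"
      unfolding face_def by auto
    then show "S closure_of face f - face f \<subseteq> glue ` ({f} \<times> sphere 0 1)" unfolding cl by auto
    show "glue ` ({f} \<times> sphere 0 1) \<subseteq> S closure_of face f - face f"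
    proof
      fix y assume "y \<in> glue ` ({f} \<times> sphere 0 1)"
      then obtain z where z: "norm z = 1" "y = glue (f, z)" by auto
      then have "(f, z) \<in> rim" using f by (simp add: rim_def)
      then have "y \<notin> face f" using topspace_minus_graph f z(2) unfolding graph_map_image by blast
      then show "y \<in> S closure_of face f - face f" unfolding cl using z by auto
    qed
  qed
  finally show ?thesis .
qed

text \<open>For the converse the midpoint of the edge suffices: it is no vertex, so the boundary
  parameter at which the face reaches it determines the arc.\<close>

lemma on_boundary_face:
  assumes f: "f < F" and a: "a \<in> arcs"
  shows "on_boundary V E S graph_map {src a, tgt a} (face f) \<longleftrightarrow> (\<exists>j. arc f j = a)"
proof
  assume "\<exists>j. arc f j = a"
  then obtain j where j: "arc f j = a" by blast
  show "on_boundary V E S graph_map {src a, tgt a} (face f)"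
    unfolding on_boundary_def frontier_face[OF f]
  proof
    fix y assume "y \<in> graph_map ` edge_realization V E {src a, tgt a}"
    then obtain w where w: "w \<in> realization V E" "\<And>x. w x \<noteq> 0 \<Longrightarrow> x \<in> {src a, tgt a}" "y = graph_map w"
      by (auto simp: edge_realization_def)
    note wa = realization_edge[OF w(1) a w(2)]
    have "w = edge_point (src a) (tgt a) (w (tgt a))" by (rule wa(1))
    also have "\<dots> = pt f (of_int j + w (tgt a))" using pt_edge[OF f wa(2,3), of j] j by simp
    finally have "y = glue (f, turn (of_real ((of_int j + w (tgt a)) / real (len f))))"
      unfolding w(3) glue_turn[OF f] by (rule arg_cong)
    then show "y \<in> glue ` ({f} \<times> sphere 0 1)" by (simp del: of_real_divide of_real_add)
  qed
next
  assume *: "on_boundary V E S graph_map {src a, tgt a} (face f)"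
  define w where "w = edge_point (src a) (tgt a) (1/2)"
  obtain g i where g: "g < F" "arc g i = a" using arc_ex[OF a] by blast
  have wp: "w = pt g (of_int i + 1/2)" using pt_edge[OF g(1), of "1/2" i] g(2) by (simp add: w_def)
  then have "w \<in> realization V E" using pt_realization[OF g(1)] by simp
  then have "w \<in> edge_realization V E {src a, tgt a}"
    by (auto simp: edge_realization_def w_def edge_point_def split: if_splits)
  then have "graph_map w \<in> glue ` ({f} \<times> sphere 0 1)"
    using * frontier_face[OF f] by (auto simp: on_boundary_def)
  then obtain z where z: "norm z = 1" "graph_map w = glue (f, z)" by auto
  obtain s where s: "z = turn (of_real (s / real (len f)))" using boundary_turn[OF f z(1)] by blast
  have "graph_map (pt g (of_int i + 1/2)) = graph_map (pt f s)"
    using z(2) unfolding wp s glue_turn[OF f] .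
  then have "pt g (of_int i + 1/2) = pt f s" using graph_map_pt_eq_iff[OF g(1) f] by blast
  from pt_eqD[OF g(1) f this] have "arc g \<lfloor>of_int i + 1/2 :: real\<rfloor> = arc f \<lfloor>s\<rfloor>"
    by (auto simp: frac_def)
  then show "\<exists>j. arc f j = a" using g(2) by auto
qed

text \<open>Each closed disc touches the connected graph, so the unions of the graph with one disc
  are connected, and they share points.\<close>

lemma connected_S:
  assumes "connected (realization V E)"
  shows "connected_space S"
proof -
  let ?R = "graph_map ` realization V E"
  let ?D = "\<lambda>f. glue ` ({f} \<times> cball 0 1)"
  have R: "connectedin S ?R" using continuous_graph_map by (rule connectedin_continuous_map_image)
      (use assms in \<open>simp add: connectedin_subtopology\<close>)
  have D: "connectedin S (?R \<union> ?D f)" if f: "f < F" for f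
  proof (rule connectedin_Un[OF R])
    have "connectedin S ((\<lambda>z. glue (f, z)) ` cball 0 1)"
      using continuous_glue_disc[OF f] by (rule connectedin_continuous_map_image)
        (simp add: connectedin_subtopology)
    moreover have "(\<lambda>z. glue (f, z)) ` cball 0 1 = ?D f" by auto
    ultimately show "connectedin S (?D f)" by simp
    have "glue (f, 1) \<in> glue ` rim" "glue (f, 1) \<in> ?D f" using f by (auto simp: rim_def)
    then show "?R \<inter> ?D f \<noteq> {}" unfolding graph_map_image by blast
  qed
  have top: "topspace S = (\<Union>f<F. ?R \<union> ?D f)"
    unfolding graph_map_image topspace_S by (auto simp: K_def rim_def)
  have "connectedin S (\<Union>((\<lambda>f. ?R \<union> ?D f) ` {..<F}))"
  proof (cases "F = 0")
    case False
    then have "(0, 1) \<in> rim" by (simp add: rim_def)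
    then have "glue (0, 1) \<in> \<Inter>((\<lambda>f. ?R \<union> ?D f) ` {..<F})" unfolding graph_map_image by blast
    show ?thesis
    proof (rule connectedin_Union)
      show "\<Inter>((\<lambda>f. ?R \<union> ?D f) ` {..<F}) \<noteq> {}" using \<open>glue (0, 1) \<in> _\<close> by blast
    qed (use D in blast)
  qed simp
  then show ?thesis unfolding top[symmetric] using connectedin_topspace[of S] by simp
qed

subsection \<open>Charts around the vertices\<close>

definition around :: "int \<Rightarrow> 'e set" where "around x = {a \<in> arcs. src a = x}"

definition deg :: "int \<Rightarrow> nat" where "deg x = card (around x)"

definition base :: "int \<Rightarrow> 'e" where "base x = (SOME a. a \<in> around x)"

text \<open>The arcs leaving \<open>x\<close> in cyclic order, from an arbitrary
  \<open>base x\<close>. The index \<open>deg x\<close>, which repeats the index 0, occurs at the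
  last white corner.\<close>

definition spoke :: "int \<Rightarrow> nat \<Rightarrow> 'e" where "spoke x k = (rot ^^ k) (base x)"

lemma base_around: "x \<in> V \<Longrightarrow> base x \<in> around x"
  unfolding base_def V_def around_def by (rule someI_ex) blast

lemma
  assumes "x \<in> V"
  shows spoke_bij: "bij_betw (spoke x) {..<deg x} (around x)"
    and spoke_deg: "spoke x (deg x) = spoke x 0"
    and deg_pos: "0 < deg x"
proof -
  have "cyclic_on rot (around x)" using rot_cyclic assms unfolding V_def around_def by blast
  note * = cyclic_on_enumeration[OF this base_around[OF assms]]
  show "bij_betw (spoke x) {..<deg x} (around x)" using *(1) unfolding spoke_def[abs_def] deg_def .
  show "spoke x (deg x) = spoke x 0" using *(2) by (simp add: spoke_def deg_def)
  show "0 < deg x" using *(3) by (simp add: deg_def)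
qed

lemma spoke_Suc: "spoke x (Suc k) = rot (spoke x k)" by (simp add: spoke_def)

lemma spoke_around:
  assumes "x \<in> V" "k \<le> deg x"
  shows "spoke x k \<in> around x"
proof (cases "k = deg x")
  case True
  then show ?thesis using spoke_deg[OF assms(1)] base_around[OF assms(1)] by (simp add: spoke_def)
next
  case False
  then show ?thesis using spoke_bij[OF assms(1)] assms(2) by (auto simp: bij_betw_def)
qed

text \<open>Arcs recur along a face, so a position is determined only modulo the length of the face;
  by \<open>corner_map_cong\<close> the choice has no effect.\<close>

definition place :: "bool \<Rightarrow> 'e \<Rightarrow> nat \<times> int" where
  "place c a = (SOME p. fst p < F \<and> black (fst p) = c \<and> arc (fst p) (snd p) = a)"

lemma place:
  assumes "a \<in> arcs" "place c a = (f, s)"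
  shows "f < F" "black f = c" "arc f s = a"
proof -
  have "\<exists>p. fst p < F \<and> black (fst p) = c \<and> arc (fst p) (snd p) = a"
    using arc_ex[OF assms(1)] by fastforce
  then have "fst (place c a) < F \<and> black (fst (place c a)) = c \<and>
      arc (fst (place c a)) (snd (place c a)) = a" unfolding place_def by (rule someI_ex)
  then show "f < F" "black f = c" "arc f s = a" using assms(2) by auto
qed

text \<open>
  The vertex \<open>x\<close> is surrounded by \<open>2 * deg x\<close> corners, alternately black and white.
  Corner \<open>i\<close> is the position in its face where the arc \<open>spoke x ((i + 1) div 2)\<close> leaves \<open>x\<close>.
\<close>

definition corner :: "int \<Rightarrow> nat \<Rightarrow> nat \<times> int" where
  "corner x i = place (even i) (spoke x ((i + 1) div 2))"

text \<open>
  Near the boundary point with parameter \<open>s\<close>, the face \<open>f\<close> is parametrized by a half-plane.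
  The factor 3/4 lies between 1/2, so that neighbouring vertex charts overlap, and 1, so that
  no vertex chart reaches the next vertex.
\<close>

definition corner_map :: "nat \<times> int \<Rightarrow> complex \<Rightarrow> nat \<times> complex" where
  "corner_map p M = (fst p, turn ((of_int (snd p) + 3/4 * reflect (black (fst p)) M) / of_nat (len (fst p))))"

text \<open>The power opens each of the \<open>2 * deg x\<close> sectors onto a half-plane, and
  \<open>corner_map\<close> carries the half-plane to the part of the face near that corner.\<close>

definition vertex_chart :: "int \<Rightarrow> complex \<Rightarrow> complex" where
  "vertex_chart x u = glue (corner_map (corner x (sector (deg x) u)) (u ^ deg x))"

lemma corner:
  assumes "x \<in> V" "i < 2 * deg x" "corner x i = (f, s)"
  shows "f < F" "black f = even i" "arc f s = spoke x ((i + 1) div 2)" "src (arc f s) = x"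
proof -
  have a: "spoke x ((i + 1) div 2) \<in> around x" using assms by (intro spoke_around) auto
  have 1: "spoke x ((i + 1) div 2) \<in> arcs" "src (spoke x ((i + 1) div 2)) = x"
    using a by (auto simp: around_def)
  note * = place[OF 1(1) assms(3)[unfolded corner_def]]
  show "f < F" "black f = even i" "arc f s = spoke x ((i + 1) div 2)" "src (arc f s) = x"
    using * 1(2) by auto
qed

lemma corner_map_cong:
  assumes "f < F" "arc f s = arc f s'"
  shows "corner_map (f, s) M = corner_map (f, s') M"
proof -
  have "s mod int (len f) = s' mod int (len f)" using arc_eqD[of f f s s'] assms by auto
  then obtain k where k: "s = s' + int (len f) * k" by (metis mod_eqE)
  have "turn ((of_int s + 3/4 * reflect (black f) M) / of_nat (len f)) =
      turn ((of_int s' + 3/4 * reflect (black f) M) / of_nat (len f))"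
    unfolding turn_eq_iff using len_pos[OF assms(1)] k
    by (intro exI[of _ k]) (simp add: field_simps)
  then show ?thesis by (simp add: corner_map_def)
qed

lemma corner_map_in_K:
  assumes "f < F" "0 \<le> Im (reflect (black f) M)"
  shows "corner_map (f, s) M \<in> K" using assms by (simp add: corner_map_def K_def Im_divide_of_nat)

lemma corner_map_real:
  assumes "f < F"
  shows "corner_map (f, s) (of_real t) = (f, turn (of_real ((of_int s + 3/4 * t) / real (len f))))"
  by (simp add: corner_map_def)

lemma glue_corner_map_real:
  assumes "f < F"
  shows "glue (corner_map (f, s) (of_real t)) = graph_map (pt f (of_int s + 3/4 * t))"
  unfolding corner_map_real[OF assms] by (rule glue_turn[OF assms])

lemma pt_outgoing:
  assumes "f < F" "0 \<le> t" "t \<le> 1"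
  shows "pt f (of_int s + 3/4 * t) = edge_point (src (arc f s)) (tgt (arc f s)) (3/4 * t)"
  using assms by (intro pt_edge) auto

lemma pt_incoming:
  assumes "f < F" "-1 \<le> t" "t \<le> 0"
  shows "pt f (of_int s + 3/4 * t) =
    edge_point (src (arc f (s - 1))) (tgt (arc f (s - 1))) (1 + 3/4 * t)"
  using pt_edge[OF assms(1), of "1 + 3/4 * t" "s - 1"] assms by simp

text \<open>In a half-plane the incoming edge lies at \<open>t \<le> 0\<close> and the outgoing edge
  at \<open>t \<ge> 0\<close>. An even corner shares its incoming edge \<open>a\<close> with the
  next corner: the outgoing arcs are \<open>succ True a\<close> and
  \<open>rot (succ True a) = succ False a\<close>, and \<open>succ False\<close> is injective. An
  odd corner shares its outgoing edge with the next one, both having the same spoke.\<close>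

lemma corner_glue:
  assumes x: "x \<in> V" and i: "Suc i < 2 * deg x \<or> (Suc i = 2 * deg x \<and> i' = 0)"
    and i': "Suc i < 2 * deg x \<Longrightarrow> i' = Suc i"
    and t: "\<bar>t\<bar> \<le> 1" "even i \<Longrightarrow> t \<le> 0" "odd i \<Longrightarrow> 0 \<le> t"
  shows "glue (corner_map (corner x i) (of_real t)) = glue (corner_map (corner x i') (of_real t))"
proof -
  obtain f s where fs: "corner x i = (f, s)" by (cases "corner x i")
  obtain f' s' where fs': "corner x i' = (f', s')" by (cases "corner x i'")
  have lt: "i < 2 * deg x" "i' < 2 * deg x" using i i' deg_pos[OF x] by auto
  note c = corner[OF x lt(1) fs] and c' = corner[OF x lt(2) fs']
  have par: "even i' = odd i" using i i' by presburger
  have sp': "spoke x ((i' + 1) div 2) = spoke x ((i + 2) div 2)"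
  proof (cases "Suc i < 2 * deg x")
    case False
    then have "(i + 2) div 2 = deg x" "i' = 0" using i by auto
    then show ?thesis using spoke_deg[OF x] by simp
  qed (use i' in simp)
  have "pt f (of_int s + 3/4 * t) = pt f' (of_int s' + 3/4 * t)"
  proof (cases "even i")
    case True
    then have t: "-1 \<le> t" "t \<le> 0" using t by auto
    have "(i + 2) div 2 = Suc ((i + 1) div 2)" using True by presburger
    then have rot: "arc f' s' = rot (arc f s)" using c(3) c'(3) sp' by (simp add: spoke_Suc)
    have "succ False (arc f' (s' - 1)) = arc f' s'" "succ True (arc f (s - 1)) = arc f s"
      using arc_succ[OF c(1), of "s - 1"] arc_succ[OF c'(1), of "s' - 1"] c(2) c'(2) par True
      by simp_all
    then have "succ False (arc f' (s' - 1)) = succ False (arc f (s - 1))"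
      using rot rot_succ[OF arc_in[OF c(1)], of "s - 1"] by simp
    then have "arc f' (s' - 1) = arc f (s - 1)"
      by (rule succ_inj[OF arc_in[OF c'(1)] arc_in[OF c(1)]])
    then show ?thesis by (simp only: pt_incoming[OF c(1) t] pt_incoming[OF c'(1) t])
  next
    case False
    then have t: "0 \<le> t" "t \<le> 1" using t by auto
    have "(i + 2) div 2 = (i + 1) div 2" using False by presburger
    then have "arc f' s' = arc f s" using c(3) c'(3) sp' by simp
    then show ?thesis by (simp only: pt_outgoing[OF c(1) t] pt_outgoing[OF c'(1) t])
  qed
  then show ?thesis
    unfolding fs fs' glue_corner_map_real[OF c(1)] glue_corner_map_real[OF c'(1)] by simp
qed

lemma corner_apex:
  assumes x: "x \<in> V" and i: "i < 2 * deg x" "i' < 2 * deg x"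
  shows "glue (corner_map (corner x i) 0) = glue (corner_map (corner x i') 0)"
proof -
  obtain f s where fs: "corner x i = (f, s)" by (cases "corner x i")
  obtain f' s' where fs': "corner x i' = (f', s')" by (cases "corner x i'")
  note c = corner[OF x i(1) fs] and c' = corner[OF x i(2) fs']
  have "edge_point y z 0 = edge_point y z' 0" for y z z' :: int
    by (simp add: edge_point_def fun_eq_iff)
  then have "pt f (of_int s + 3/4 * 0) = pt f' (of_int s' + 3/4 * 0)"
    unfolding pt_outgoing[OF c(1) order_refl zero_le_one] pt_outgoing[OF c'(1) order_refl zero_le_one]
    using c(4) c'(4) by simp
  then show ?thesis
    using glue_corner_map_real[OF c(1), of s 0] glue_corner_map_real[OF c'(1), of s' 0]
    unfolding fs fs' by simp
qed

text \<open>Continuity needs the formula on closed sectors, while \<open>sector\<close> is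
  half-open. On the closing ray \<open>\<phi> = pi\<close> the chart already uses the next corner,
  and at the origin it uses corner 0; \<open>corner_glue\<close> and \<open>corner_apex\<close> show
  that the values agree.\<close>

lemma vertex_chart_rcis:
  assumes x: "x \<in> V" and r: "0 \<le> r" "r \<le> 1" and \<phi>: "0 \<le> \<phi>" "\<phi> \<le> pi" and i: "i < 2 * deg x"
  shows "vertex_chart x (rcis r ((\<phi> + real i * pi) / real (deg x))) =
    glue (corner_map (corner x i) ((-1) ^ i * rcis (r ^ deg x) \<phi>))"
proof -
  let ?N = "deg x"
  have N: "0 < ?N" using deg_pos[OF x] .
  let ?u = "rcis r ((\<phi> + real i * pi) / real ?N)"
  have pow: "?u ^ ?N = (-1) ^ i * rcis (r ^ ?N) \<phi>" by (rule rcis_sector_power[OF N])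
  show ?thesis
  proof (cases "r = 0")
    case True
    then show ?thesis
      using corner_apex[OF x i, of 0] N by (simp add: vertex_chart_def sector_def zero_power[OF N])
  next
    case False
    then have r0: "0 < r" using r by simp
    show ?thesis
    proof (cases "\<phi> = pi")
      case False
      then have "sector ?N ?u = i" using \<phi> by (intro sector_rcis N r0 i) auto
      then show ?thesis by (simp only: vertex_chart_def pow)
    next
      case True
      define i' where "i' = (if Suc i = 2 * ?N then 0 else Suc i)"
      have "i' < 2 * ?N" using i N by (auto simp: i'_def)
      have u: "?u = rcis r ((0 + real i' * pi) / real ?N)"
      proof (cases "Suc i = 2 * ?N")
        case True
        then have e: "real i + 1 = 2 * real ?N" by linarith
        have "\<phi> + real i * pi = (real i + 1) * pi" using \<open>\<phi> = pi\<close> by (simp add: algebra_simps)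
        then have "(\<phi> + real i * pi) / real ?N = 2 * pi" using N unfolding e by simp
        then show ?thesis using True by (simp add: i'_def rcis_def)
      next
        case False
        then show ?thesis using \<open>\<phi> = pi\<close> by (simp add: i'_def algebra_simps)
      qed
      have "sector ?N ?u = i'" unfolding u using \<open>i' < 2 * ?N\<close> by (intro sector_rcis N r0) auto
      moreover have m: "(-1) ^ i * rcis (r ^ ?N) \<phi> = of_real ((-1) ^ Suc i * r ^ ?N)"
        using True by (simp add: rcis_def)
      moreover have "glue (corner_map (corner x i) (of_real ((-1) ^ Suc i * r ^ ?N))) =
          glue (corner_map (corner x i') (of_real ((-1) ^ Suc i * r ^ ?N)))"
        using r i by (intro corner_glue[OF x]) (auto simp: i'_def abs_mult power_le_one power_abs)
      ultimately show ?thesis by (simp only: vertex_chart_def pow)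
    qed
  qed
qed

lemma continuous_on_corner_map:
  assumes "continuous_on A g"
  shows "continuous_on A (\<lambda>u. corner_map p (g u))"
proof (cases "len (fst p) = 0")
  case True
  then show ?thesis by (simp add: corner_map_def)
next
  case False
  then show ?thesis unfolding corner_map_def using assms by (intro continuous_intros) auto
qed

lemma reflect_sector:
  assumes "0 \<le> \<phi>" "\<phi> \<le> pi" "0 \<le> r"
  shows "0 \<le> Im (reflect (even i) ((-1) ^ i * rcis r \<phi>))"
  using assms sin_ge_zero[of \<phi>] by (cases "even i") (simp_all add: reflect_def)

text \<open>The disc is covered by finitely many closed sectors, and on each of them the chart is
  \<open>glue\<close> after a continuous map into \<open>K\<close>.\<close>

lemma continuous_vertex_chart:
  assumes x: "x \<in> V"
  shows "continuous_map (top_of_set (cball 0 1)) S (vertex_chart x)"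
proof -
  let ?N = "deg x"
  have N: "0 < ?N" using deg_pos[OF x] .
  define T where "T = (\<lambda>i. (\<lambda>(r, \<phi>). rcis r ((\<phi> + real i * pi) / real ?N)) ` ({0..1} \<times> {0..pi}))"
  define h where "h = (\<lambda>i u. glue (corner_map (corner x i) (u ^ ?N)))"
  have eq: "vertex_chart x u = h i u" if "i < 2 * ?N" "u \<in> T i" for i u
  proof -
    obtain r \<phi> where r: "0 \<le> r" "r \<le> 1" "0 \<le> \<phi>" "\<phi> \<le> pi"
      and u: "u = rcis r ((\<phi> + real i * pi) / real ?N)" using \<open>u \<in> T i\<close> by (auto simp: T_def)
    show ?thesis
      using vertex_chart_rcis[OF x r \<open>i < 2 * ?N\<close>] unfolding u h_def rcis_sector_power[OF N] .
  qed
  have T: "T i \<subseteq> cball 0 1" for i by (auto simp: T_def)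
  show ?thesis
  proof (rule pasting_lemma_closed[where I = "{..<2 * ?N}" and T = T and f = h])
    fix i assume i: "i \<in> {..<2 * ?N}"
    have "compact (T i)" unfolding T_def using N by (intro compact_continuous_image compact_Times)
        (auto simp: case_prod_unfold rcis_def intro!: continuous_intros)
    then show "closedin (top_of_set (cball 0 1)) (T i)"
      using T by (simp add: closed_subset compact_imp_closed)
    obtain f s where fs: "corner x i = (f, s)" by (cases "corner x i")
    note c = corner[OF x _ fs]
    have "corner_map (f, s) (u ^ ?N) \<in> K" if "u \<in> T i" for u
    proof -
      obtain r \<phi> where r: "0 \<le> r" "r \<le> 1" "0 \<le> \<phi>" "\<phi> \<le> pi"
        and u: "u = rcis r ((\<phi> + real i * pi) / real ?N)" using \<open>u \<in> T i\<close> by (auto simp: T_def)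
      have "0 \<le> Im (reflect (even i) (u ^ ?N))"
        unfolding u rcis_sector_power[OF N] using r by (intro reflect_sector) auto
      then show ?thesis using c(1,2) i by (intro corner_map_in_K) auto
    qed
    then have "continuous_map (top_of_set (T i)) (top_of_set K) (\<lambda>u. corner_map (corner x i) (u ^ ?N))"
      unfolding fs by (auto intro!: continuous_on_corner_map continuous_intros)
    from continuous_map_compose[OF this continuous_glue]
    have "continuous_map (top_of_set (T i)) S (h i)" by (simp add: h_def comp_def)
    then show "continuous_map (subtopology (top_of_set (cball 0 1)) (T i)) S (h i)"
      using T[of i] by (simp add: subtopology_subtopology Int_absorb1)
  next
    fix i j u assume "i \<in> {..<2 * ?N}" "j \<in> {..<2 * ?N}" "u \<in> topspace (top_of_set (cball 0 1)) \<inter> T i \<inter> T j"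
    then show "h i u = h j u" using eq[of i u] eq[of j u] by auto
  next
    fix u assume "u \<in> topspace (top_of_set (cball (0::complex) 1))"
    then have u: "norm u \<le> 1" by simp
    obtain \<phi> where p: "0 \<le> \<phi>" "\<phi> < pi" "sector ?N u < 2 * ?N"
      "u = rcis (norm u) ((\<phi> + real (sector ?N u) * pi) / real ?N)" using sector_rep[OF N] by blast
    have "u \<in> T (sector ?N u)"
      unfolding T_def by (rule image_eqI[of _ _ "(norm u, \<phi>)"]) (use p u in auto)
    then show "\<exists>j. j \<in> {..<2 * ?N} \<and> u \<in> T j \<and> vertex_chart x u = h j u" using p(3) eq by blast
  qed simp
qed

section \<open>Injectivity of the vertex charts\<close>

text \<open>The spoke index \<open>(i + 1) div 2\<close> runs from 0 to \<open>deg x - 1\<close>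
  over the black corners and from 1 to \<open>deg x\<close> over the white ones; both ranges are
  full systems of residues modulo \<open>deg x\<close>.\<close>

lemma spoke_index_eq:
  assumes x: "x \<in> V" and i: "i < 2 * deg x" "i' < 2 * deg x" "even i = even i'"
    and eq: "spoke x ((i + 1) div 2) = spoke x ((i' + 1) div 2)"
  shows "i = i'"
proof -
  have N: "0 < deg x" using deg_pos[OF x] .
  have red: "spoke x k = spoke x (k mod deg x)" if "k \<le> deg x" for k
    using that spoke_deg[OF x] by (cases "k = deg x") auto
  define k k' where "k = (i + 1) div 2" and "k' = (i' + 1) div 2"
  have kle: "k \<le> deg x" "k' \<le> deg x" using i unfolding k_def k'_def by auto
  have inj: "inj_on (spoke x) {..<deg x}" using spoke_bij[OF x] by (simp add: bij_betw_def)
  have "spoke x (k mod deg x) = spoke x (k' mod deg x)"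
    using eq red[OF kle(1)] red[OF kle(2)] unfolding k_def k'_def by simp
  then have mod: "k mod deg x = k' mod deg x" using inj N by (auto dest: inj_onD)
  have "k = k'"
  proof (cases "even i")
    case True
    then have "even i'" using i(3) by simp
    with True obtain j j' where "i = 2 * j" "i' = 2 * j'" by (auto elim!: evenE)
    then have "k < deg x" "k' < deg x" using i unfolding k_def k'_def by auto
    then show ?thesis using mod by simp
  next
    case False
    then have "odd i'" using i(3) by simp
    with False have pos: "0 < k" "0 < k'" unfolding k_def k'_def by (auto elim!: oddE)
    show ?thesis
    proof (cases "k = deg x"; cases "k' = deg x")
      assume "k = deg x" "k' \<noteq> deg x" then show ?thesis using mod pos kle by simp
    next
      assume "k \<noteq> deg x" "k' = deg x" then show ?thesis using mod pos kle by simp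
    next
      assume "k \<noteq> deg x" "k' \<noteq> deg x" then show ?thesis using mod pos kle by simp
    qed simp
  qed
  then show ?thesis using i(3) unfolding k_def k'_def by presburger
qed

lemma corner_exists:
  assumes "f < F" "src (arc f s) = x"
  obtains i where "i < 2 * deg x" "even i = black f" "spoke x ((i + 1) div 2) = arc f s"
proof -
  have x: "x \<in> V" using assms arc_in by (auto simp: V_def)
  have N: "0 < deg x" using deg_pos[OF x] .
  have "arc f s \<in> around x" using assms arc_in by (simp add: around_def)
  then obtain k where k: "k < deg x" "spoke x k = arc f s"
    using spoke_bij[OF x] unfolding bij_betw_def by (metis imageE lessThan_iff)
  show ?thesis
  proof (cases "black f")
    case True
    then show ?thesis using that[of "2 * k"] k by simp
  next
    case False
    show ?thesis
    proof (cases "k = 0")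
      case True
      \<comment> \<open>Spoke 0 leaves the last white corner, under its other index
        \<open>deg x\<close>.\<close>
      then have "spoke x ((2 * deg x - 1 + 1) div 2) = arc f s" using N k spoke_deg[OF x] by simp
      then show ?thesis using that[of "2 * deg x - 1"] False N by simp
    next
      case k0: False
      then have "spoke x ((2 * k - 1 + 1) div 2) = arc f s" using k by simp
      then show ?thesis using that[of "2 * k - 1"] False k k0 by simp
    qed
  qed
qed

lemma norm_corner_map_eq_1:
  assumes "f < F"
  shows "norm (snd (corner_map (f, s) M)) = 1 \<longleftrightarrow> Im (reflect (black f) M) = 0"
  using len_pos[OF assms] by (simp add: corner_map_def Im_divide_of_nat)

lemma label_corner_map:
  assumes "f < F"
  shows "label (corner_map (f, s) M) =
    (if Im (reflect (black f) M) = 0 then Inr (pt f (of_int s + 3/4 * Re M)) else Inl (corner_map (f, s) M))"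
proof (cases "Im (reflect (black f) M) = 0")
  case True
  then have "Im M = 0" by (simp add: reflect_def split: if_splits)
  then have "M = of_real (Re M)" by (simp add: complex_eq_iff)
  then have e: "corner_map (f, s) M = (f, turn (of_real ((of_int s + 3/4 * Re M) / real (len f))))"
    using corner_map_real[OF assms, of s "Re M"] by simp
  have "label (corner_map (f, s) M) = Inr (pt f (of_int s + 3/4 * Re M))"
    unfolding e by (rule label_turn[OF assms])
  then show ?thesis using True by simp
next
  case False
  then show ?thesis using norm_corner_map_eq_1[OF assms, of s M] by (simp add: label_def)
qed

text \<open>As \<open>3/4 * t\<close> has absolute value below 1, the parameter stays on the edge
  leaving the vertex or on the edge entering it.\<close>

lemma floor_frac_corner:
  fixes t :: real
  assumes "\<bar>t\<bar> \<le> 1"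
  shows "0 \<le> t \<Longrightarrow> \<lfloor>of_int s + 3/4 * t\<rfloor> = s" "0 \<le> t \<Longrightarrow> frac (of_int s + 3/4 * t) = 3/4 * t"
    "t < 0 \<Longrightarrow> \<lfloor>of_int s + 3/4 * t\<rfloor> = s - 1" "t < 0 \<Longrightarrow> frac (of_int s + 3/4 * t) = 1 + 3/4 * t"
proof -
  show 1: "0 \<le> t \<Longrightarrow> \<lfloor>of_int s + 3/4 * t\<rfloor> = s" using assms by (simp add: floor_eq_iff)
  then show "0 \<le> t \<Longrightarrow> frac (of_int s + 3/4 * t) = 3/4 * t" by (simp add: frac_def)
  show 2: "t < 0 \<Longrightarrow> \<lfloor>of_int s + 3/4 * t\<rfloor> = s - 1" using assms by (simp add: floor_eq_iff)
  show "t < 0 \<Longrightarrow> frac (of_int s + 3/4 * t) = 1 + 3/4 * t" unfolding frac_def by (simp only: 2)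
qed

text \<open>If \<open>t\<close> and \<open>t'\<close> were on different sides, a single arc would
  both leave and enter \<open>x\<close>, that is, be a loop.\<close>

lemma pt_corner_eqD:
  assumes f: "f < F" "f' < F" and src: "src (arc f s) = x" "src (arc f' s') = x"
    and t: "\<bar>t\<bar> \<le> 1" "\<bar>t'\<bar> \<le> 1"
    and eq: "pt f (of_int s + 3/4 * t) = pt f' (of_int s' + 3/4 * t')"
  shows "t = t'" "0 < t \<Longrightarrow> arc f s = arc f' s'" "t < 0 \<Longrightarrow> arc f (s - 1) = arc f' (s' - 1)"
proof -
  note fl = floor_frac_corner[OF t(1), of s] and fl' = floor_frac_corner[OF t(2), of s']
  note D = pt_eqD[OF f eq]
  have in': "tgt (arc f (s - 1)) = x" "tgt (arc f' (s' - 1)) = x" using tgt_arc_pred f src by auto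
  have mixed: False if "arc f s = arc f' (s' - 1)"
    using that src(1) in'(2) src_ne_tgt[OF arc_in[OF f(1)], of s] by simp
  have mixed': False if "arc f (s - 1) = arc f' s'"
    using that src(2) in'(1) src_ne_tgt[OF arc_in[OF f(2)], of s'] by simp
  have "t = t' \<and> (0 < t \<longrightarrow> arc f s = arc f' s') \<and> (t < 0 \<longrightarrow> arc f (s - 1) = arc f' (s' - 1))"
  proof (cases "0 \<le> t"; cases "0 \<le> t'")
    assume *: "0 \<le> t" "0 \<le> t'"
    have "(3/4 * t = 0 \<and> 3/4 * t' = 0 \<and> src (arc f s) = src (arc f' s')) \<or>
        (3/4 * t \<noteq> 0 \<and> 3/4 * t' = 3/4 * t \<and> arc f s = arc f' s')"
      using D unfolding fl(1,2)[OF *(1)] fl'(1,2)[OF *(2)] .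
    then show ?thesis using * by auto
  next
    assume *: "0 \<le> t" "\<not> 0 \<le> t'"
    then have "frac (of_int s' + 3/4 * t') \<noteq> 0" using fl'(4) t(2) by simp
    then have "arc f s = arc f' (s' - 1)" using D fl(1) fl'(3) * by auto
    then show ?thesis using mixed by blast
  next
    assume *: "\<not> 0 \<le> t" "0 \<le> t'"
    then have "frac (of_int s + 3/4 * t) \<noteq> 0" using fl(4) t(1) by simp
    then have "arc f (s - 1) = arc f' s'" using D fl(3) fl'(1) * by auto
    then show ?thesis using mixed' by blast
  next
    assume *: "\<not> 0 \<le> t" "\<not> 0 \<le> t'"
    then have "frac (of_int s + 3/4 * t) \<noteq> 0" using fl(4) t(1) by simp
    then show ?thesis using D fl(3,4) fl'(3,4) * by auto
  qed
  then show "t = t'" "0 < t \<Longrightarrow> arc f s = arc f' s'" "t < 0 \<Longrightarrow> arc f (s - 1) = arc f' (s' - 1)" by auto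
qed

text \<open>A circuit may visit \<open>x\<close> several times, so corners of the same face have to
  be kept apart. Equality of the points makes the integer \<open>d\<close> a difference of two reals
  bounded by 3/4, hence -1, 0 or 1. For 1 or -1 two consecutive arcs of the face would both leave
  \<open>x\<close>, and one of them would be a loop.\<close>

lemma corner_map_corner_eqD:
  assumes f: "f < F" and src: "src (arc f s) = x" "src (arc f s') = x"
    and M: "norm M \<le> 1" "norm M' \<le> 1"
    and eq: "corner_map (f, s) M = corner_map (f, s') M'"
  shows "M = M'" "arc f s = arc f s'"
proof -
  define m m' where "m = reflect (black f) M" and "m' = reflect (black f) M'"
  have l: "len f \<noteq> 0" using len_pos[OF f] by simp
  define a b where "a = 3/4 * m" and "b = 3/4 * m'"
  obtain n :: int where "(of_int s + a) / of_nat (len f) = (of_int s' + b) / of_nat (len f) + of_int n"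
    using eq unfolding corner_map_def a_def b_def m_def m'_def fst_conv snd_conv prod.inject turn_eq_iff
    by blast
  then have n: "of_int s + a = of_int s' + b + of_int n * of_nat (len f)"
    using l by (simp add: field_simps)
  define d where "d = s - s' - n * int (len f)"
  have d: "of_int d = b - a" using n by (simp add: d_def algebra_simps)
  have "real_of_int d = Re (of_int d)" by simp
  also have "\<dots> = 3/4 * Re m' - 3/4 * Re m" unfolding d by (simp add: a_def b_def)
  finally have "real_of_int d = 3/4 * Re m' - 3/4 * Re m" .
  moreover have "\<bar>Re m\<bar> \<le> 1" "\<bar>Re m'\<bar> \<le> 1"
    using M abs_Re_le_cmod[of m] abs_Re_le_cmod[of m'] by (simp_all add: m_def m'_def)
  ultimately have "\<bar>real_of_int d\<bar> < 2" by linarith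
  then have "d = 0 \<or> d = 1 \<or> d = -1" by linarith
  moreover have "d \<noteq> 1"
  proof
    assume "d = 1"
    then have "s = (s' + 1) + n * int (len f)" by (simp add: d_def)
    then have "arc f s = arc f (s' + 1)" by (intro arc_cong[OF f]) simp
    then show False using src src_arc_Suc[OF f, of s'] src_ne_tgt[OF arc_in[OF f], of s'] by simp
  qed
  moreover have "d \<noteq> -1"
  proof
    assume "d = -1"
    then have "s + 1 = s' + n * int (len f)" by (simp add: d_def)
    then have "arc f (s + 1) = arc f s'" by (intro arc_cong[OF f]) simp
    then show False using src src_arc_Suc[OF f, of s] src_ne_tgt[OF arc_in[OF f], of s] by simp
  qed
  ultimately have d0: "d = 0" by blast
  then have "s = s' + n * int (len f)" by (simp add: d_def)
  then show "arc f s = arc f s'" by (intro arc_cong[OF f]) simp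
  have "m = m'" using d d0 by (simp add: a_def b_def)
  then show "M = M'" unfolding m_def m'_def by (metis reflect_reflect)
qed

lemma vertex_chart_corner:
  assumes x: "x \<in> V" and u: "norm u \<le> 1"
  obtains i f s \<phi> where "i < 2 * deg x" "corner x i = (f, s)" "0 \<le> \<phi>" "\<phi> < pi"
    "u = rcis (norm u) ((\<phi> + real i * pi) / real (deg x))"
    "u ^ deg x = (-1) ^ i * rcis (norm u ^ deg x) \<phi>"
    "vertex_chart x u = glue (corner_map (f, s) (u ^ deg x))" "corner_map (f, s) (u ^ deg x) \<in> K"
proof -
  let ?N = "deg x"
  have N: "0 < ?N" using deg_pos[OF x] .
  obtain \<phi> where p: "0 \<le> \<phi>" "\<phi> < pi" "sector ?N u < 2 * ?N"
      "u = rcis (norm u) ((\<phi> + real (sector ?N u) * pi) / real ?N)" using sector_rep[OF N] by blast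
  define i where "i = sector ?N u"
  obtain f s where fs: "corner x i = (f, s)" by (cases "corner x i")
  have pow: "u ^ ?N = (-1) ^ i * rcis (norm u ^ ?N) \<phi>"
    using rcis_sector_power[OF N, of "norm u" \<phi> i] p(4) unfolding i_def by simp
  have i: "i < 2 * ?N" using p(3) by (simp add: i_def)
  note c = corner[OF x i fs]
  have "corner_map (f, s) (u ^ ?N) \<in> K"
    using c(1,2) reflect_sector[of \<phi> "norm u ^ ?N" i] p(1,2) unfolding pow by (intro corner_map_in_K) auto
  moreover have "vertex_chart x u = glue (corner_map (f, s) (u ^ ?N))"
    unfolding vertex_chart_def i_def[symmetric] fs ..
  ultimately show ?thesis using that[OF i fs p(1,2) _ pow] p(4) unfolding i_def by blast
qed

text \<open>Inside a face the label returns the face, the position and the power. On an edge it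
  returns the real value of the power and one arc. The sign of that value gives the parity of the
  sector, since the initial ray goes to the positive axis for even and to the negative axis for odd
  \<open>i\<close>; parity and arc determine the corner.\<close>

lemma vertex_chart_inj:
  assumes x: "x \<in> V"
  shows "inj_on (vertex_chart x) (cball 0 1)"
proof (rule inj_onI)
  fix u u' assume "u \<in> cball 0 1" "u' \<in> cball 0 1" and eq: "vertex_chart x u = vertex_chart x u'"
  then have u: "norm u \<le> 1" "norm u' \<le> 1" by auto
  let ?N = "deg x"
  have N: "0 < ?N" using deg_pos[OF x] .
  obtain i f s \<phi> where
    i: "i < 2 * ?N" and fs: "corner x i = (f, s)" and \<phi>: "0 \<le> \<phi>" "\<phi> < pi"
    and ru: "u = rcis (norm u) ((\<phi> + real i * pi) / real ?N)"
    and pow: "u ^ ?N = (-1) ^ i * rcis (norm u ^ ?N) \<phi>"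
    and vc: "vertex_chart x u = glue (corner_map (f, s) (u ^ ?N))" and K: "corner_map (f, s) (u ^ ?N) \<in> K"
    using vertex_chart_corner[OF x u(1)] by blast
  obtain i' f' s' \<phi>' where
    i': "i' < 2 * ?N" and fs': "corner x i' = (f', s')" and \<phi>': "0 \<le> \<phi>'" "\<phi>' < pi"
    and ru': "u' = rcis (norm u') ((\<phi>' + real i' * pi) / real ?N)"
    and pow': "u' ^ ?N = (-1) ^ i' * rcis (norm u' ^ ?N) \<phi>'"
    and vc': "vertex_chart x u' = glue (corner_map (f', s') (u' ^ ?N))" and K': "corner_map (f', s') (u' ^ ?N) \<in> K"
    using vertex_chart_corner[OF x u(2)] by blast
  note c = corner[OF x i fs] and c' = corner[OF x i' fs']
  have L: "label (corner_map (f, s) (u ^ ?N)) = label (corner_map (f', s') (u' ^ ?N))"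
    using glue_eq_iff[OF K K'] eq vc vc' by simp
  have nrm: "norm (u ^ ?N) \<le> 1" "norm (u' ^ ?N) \<le> 1"
    using u by (simp_all add: norm_power power_le_one)
  have same: "u = u'" if "i = i'" "u ^ ?N = u' ^ ?N"
  proof -
    have "rcis (norm u ^ ?N) \<phi> = rcis (norm u' ^ ?N) \<phi>'" using pow pow' that by simp
    then have rr: "norm u ^ ?N = norm u' ^ ?N \<and> (norm u ^ ?N = 0 \<or> \<phi> = \<phi>')"
      using \<phi> \<phi>' by (intro rcis_upper_inj) auto
    note r = conjunct1[OF rr] conjunct2[OF rr]
    have "norm u = norm u'" using r(1) N by (simp add: power_eq_iff_eq_base)
    moreover have "norm u = 0 \<or> \<phi> = \<phi>'" using r(2) by auto
    ultimately show ?thesis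
    proof (elim disjE)
      assume "norm u = norm u'" "\<phi> = \<phi>'"
      then show ?thesis using ru ru' that(1) by metis
    qed simp
  qed
  show "u = u'"
  proof (cases "Im (reflect (black f) (u ^ ?N)) = 0")
    case False
    then have int: "Im (reflect (black f') (u' ^ ?N)) \<noteq> 0"
        "corner_map (f, s) (u ^ ?N) = corner_map (f', s') (u' ^ ?N)"
      using L unfolding label_corner_map[OF c(1)] label_corner_map[OF c'(1)] by (auto split: if_splits)
    then have ff: "f = f'" by (simp add: corner_map_def)
    note * = corner_map_corner_eqD[OF c(1) c(4) c'(4)[folded ff] nrm int(2)[folded ff]]
    have "spoke x ((i + 1) div 2) = spoke x ((i' + 1) div 2)" using *(2) c(3) c'(3) ff by simp
    moreover have "even i = even i'" using c(2) c'(2) ff by simp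
    ultimately have "i = i'" using spoke_index_eq[OF x i i'] by blast
    then show ?thesis using *(1) by (rule same)
  next
    case True
    then have T': "Im (reflect (black f') (u' ^ ?N)) = 0"
      and eqpt: "pt f (of_int s + 3/4 * Re (u ^ ?N)) = pt f' (of_int s' + 3/4 * Re (u' ^ ?N))"
      using L unfolding label_corner_map[OF c(1)] label_corner_map[OF c'(1)] by (auto split: if_splits)
    have real: "u ^ ?N = of_real (Re (u ^ ?N))" "u' ^ ?N = of_real (Re (u' ^ ?N))"
      using True T' by (simp_all add: complex_eq_iff Im_reflect_eq_0 del: Re_power_real Im_power_real)
    have abs: "\<bar>Re (u ^ ?N)\<bar> \<le> 1" "\<bar>Re (u' ^ ?N)\<bar> \<le> 1"
      using nrm abs_Re_le_cmod order_trans by blast+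
    note * = pt_corner_eqD[OF c(1) c'(1) c(4) c'(4) abs eqpt]
    have eqN: "u ^ ?N = u' ^ ?N" using real *(1) by simp
    have sgn: "Re (w ^ ?N) = (-1) ^ j * norm w ^ ?N"
      if "w ^ ?N = (-1) ^ j * rcis (norm w ^ ?N) \<psi>" "w ^ ?N = of_real (Re (w ^ ?N))" "w \<noteq> 0"
        "0 \<le> \<psi>" "\<psi> < pi" for w j \<psi>
    proof -
      have "Im (w ^ ?N) = (-1) ^ j * (norm w ^ ?N * sin \<psi>)"
        unfolding that(1) by (cases "even j") auto
      then have "sin \<psi> = 0" using that(2,3) by (metis Im_complex_of_real mult_eq_0_iff norm_eq_zero
            power_eq_0_iff zero_neq_neg_one)
      then have "\<psi> = 0" using that(4,5) by (metis less_eq_real_def less_irrefl sin_gt_zero)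
      then show ?thesis unfolding that(1) by (cases "even j") auto
    qed
    show ?thesis
    proof (cases "u = 0 \<or> u' = 0")
      case True
      then have "u ^ ?N = 0" "u' ^ ?N = 0" using eqN N by (auto simp: zero_power)
      then show ?thesis by simp
    next
      case False
      have s1: "Re (u ^ ?N) = (-1) ^ i * norm u ^ ?N" "Re (u' ^ ?N) = (-1) ^ i' * norm u' ^ ?N"
        using sgn[OF pow real(1) _ \<phi>] sgn[OF pow' real(2) _ \<phi>'] False by auto
      have pos: "0 < norm u ^ ?N" "0 < norm u' ^ ?N" using False by auto
      have par: "even i = even i'" using s1 *(1) pos by (cases "even i"; cases "even i'") auto
      have "arc f s = arc f' s'"
      proof (cases "even i")
        case True
        then show ?thesis using *(2) s1(1) pos by simp
      next
        case False
        \<comment> \<open>For odd \<open>i\<close> the common edge is the incoming one; the outgoing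
          arc is its successor on faces of the same colour.\<close>
        then have "arc f (s - 1) = arc f' (s' - 1)" using *(3) s1(1) pos by simp
        then show ?thesis
          using arc_succ[OF c(1), of "s - 1"] arc_succ[OF c'(1), of "s' - 1"] c(2) c'(2) par by simp
      qed
      then have "spoke x ((i + 1) div 2) = spoke x ((i' + 1) div 2)" using c(3) c'(3) by simp
      then have "i = i'" using spoke_index_eq[OF x i i' par] by blast
      then show ?thesis using eqN by (rule same)
    qed
  qed
qed

section \<open>Openness of the vertex charts\<close>

text \<open>The position belongs to a corner \<open>i\<close>, and a preimage in its closed sector
  is found from the \<open>deg x\<close>-th root of the modulus and an angle \<open>\<phi>\<close>
  between 0 and \<open>pi\<close>. For a white face the reflected \<open>m\<close> lies in the lower
  half-plane, which \<open>rcis_sector_power\<close> reaches with a minus sign; hence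
  \<open>pi - Arg2pi m\<close>.\<close>

lemma corner_map_mem_vertex_chart:
  assumes f: "f < F" and src: "src (arc f s) = x" and m: "norm m < 1" "0 \<le> Im m"
  shows "glue (f, turn ((of_int s + 3/4 * m) / of_nat (len f))) \<in> vertex_chart x ` ball 0 1"
proof -
  have x: "x \<in> V" using arc_in[OF f] src by (auto simp: V_def)
  have N: "0 < deg x" using deg_pos[OF x] .
  obtain i where i: "i < 2 * deg x" "even i = black f" "spoke x ((i + 1) div 2) = arc f s"
    using corner_exists[OF f src] by blast
  obtain f' s' where fs': "corner x i = (f', s')" by (cases "corner x i")
  note c = corner[OF x i(1) fs']
  have "arc f s = arc f' s'" using i(3) c(3) by simp
  then have ff: "f' = f" using arc_eqD[OF f c(1), of s s'] i(2) c(2) by simp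
  obtain \<phi> where \<phi>: "0 \<le> \<phi>" "\<phi> \<le> pi" "reflect (even i) m = (-1) ^ i * rcis (norm m) \<phi>"
  proof (cases "even i")
    case True
    have "Arg2pi m \<le> pi" using m(2) by (simp add: Arg2pi_le_pi)
    moreover have "m = rcis (norm m) (Arg2pi m)" using Arg2pi_eq[of m] by (simp only: rcis_def cis_conv_exp)
    ultimately show ?thesis using that[of "Arg2pi m"] True Arg2pi_ge_0[of m] by (simp add: reflect_def)
  next
    case False
    have le: "Arg2pi m \<le> pi" using m(2) by (simp add: Arg2pi_le_pi)
    have e: "m = rcis (norm m) (Arg2pi m)" using Arg2pi_eq[of m] by (simp only: rcis_def cis_conv_exp)
    have "cnj m = rcis (norm m) (- Arg2pi m)" by (subst e) (simp add: rcis_def cis_cnj)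
    also have "\<dots> = - rcis (norm m) (pi - Arg2pi m)" by (simp add: rcis_def cis.ctr complex_eq_iff)
    finally show ?thesis using that[of "pi - Arg2pi m"] le False Arg2pi_ge_0[of m] by (simp add: reflect_def)
  qed
  define r where "r = root (deg x) (norm m)"
  have r: "0 \<le> r" "r < 1" "r ^ deg x = norm m"
    using m(1) N by (simp_all add: r_def real_root_pow_pos2)
  let ?u = "rcis r ((\<phi> + real i * pi) / real (deg x))"
  have "vertex_chart x ?u = glue (corner_map (corner x i) ((-1) ^ i * rcis (r ^ deg x) \<phi>))"
    using r i by (intro vertex_chart_rcis[OF x] \<phi>) auto
  also have "\<dots> = glue (corner_map (f, s') (reflect (black f) m))"
    unfolding fs' ff r(3) \<phi>(3)[symmetric] i(2) ..
  also have "corner_map (f, s') (reflect (black f) m) = corner_map (f, s) (reflect (black f) m)"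
    using \<open>arc f s = arc f' s'\<close> ff by (intro corner_map_cong[OF f]) simp
  also have "\<dots> = (f, turn ((of_int s + 3/4 * m) / of_nat (len f)))" by (simp add: corner_map_def)
  finally show ?thesis using r by (intro image_eqI[of _ _ ?u]) auto
qed

text \<open>\<open>M\<close> ranges over the whole disc and not just its upper half. The wedge then
  sticks out of the face and is open in the ambient space; intersecting with \<open>K\<close> leaves
  the half-disc.\<close>

definition wedge :: "nat \<Rightarrow> int \<Rightarrow> (nat \<times> complex) set" where
  "wedge f s = {f} \<times> (\<lambda>M. turn ((of_int s + 3/4 * M) / of_nat (len f))) ` ball 0 1"

lemma wedgeI: "norm M < 1 \<Longrightarrow> (f, turn ((of_int s + 3/4 * M) / of_nat (len f))) \<in> wedge f s"
  unfolding wedge_def by (intro SigmaI imageI) auto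

lemma wedgeE:
  assumes "p \<in> wedge f s"
  obtains M where "norm M < 1" "p = (f, turn ((of_int s + 3/4 * M) / of_nat (len f)))"
  using assms unfolding wedge_def by (elim SigmaE imageE) auto

lemma open_wedge: "f < F \<Longrightarrow> open (wedge f s)" unfolding wedge_def using len_pos[of f]
  by (intro open_Times open_discrete open_turn_image) auto

text \<open>The image of the chart is open in the quotient iff this preimage is open in
  \<open>K\<close>, which the wedges make visible.\<close>

lemma vertex_chart_preimage:
  assumes x: "x \<in> V"
  shows "{p \<in> K. glue p \<in> vertex_chart x ` ball 0 1} =
    K \<inter> (\<Union>(f, s)\<in>{(f, s). f < F \<and> src (arc f s) = x}. wedge f s)"
    (is "?L = K \<inter> ?R")
proof (intro set_eqI iffI)
  fix p assume "p \<in> K \<inter> ?R"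
  then obtain f s M where f: "f < F" "src (arc f s) = x" "norm M < 1"
    and p: "p = (f, turn ((of_int s + 3/4 * M) / of_nat (len f)))" "p \<in> K" by (auto elim!: wedgeE)
  have "0 \<le> Im M" using p len_pos[OF f(1)] by (simp add: K_def Im_divide_of_nat zero_le_divide_iff)
  then show "p \<in> ?L" using corner_map_mem_vertex_chart[OF f] p by simp
next
  fix p assume p: "p \<in> ?L"
  obtain f z where fz: "p = (f, z)" by (cases p)
  have f: "f < F" "norm z \<le> 1" using p fz by (auto simp: K_def)
  obtain u where u: "norm u < 1" "glue p = vertex_chart x u" using p by auto
  let ?N = "deg x"
  have N: "0 < ?N" using deg_pos[OF x] .
  have "norm u \<le> 1" using u by simp
  then obtain i g s where i: "i < 2 * ?N" and gs: "corner x i = (g, s)"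
    and vc: "vertex_chart x u = glue (corner_map (g, s) (u ^ ?N))" and K: "corner_map (g, s) (u ^ ?N) \<in> K"
    using vertex_chart_corner[OF x] by metis
  note c = corner[OF x i gs]
  have nrm: "norm (u ^ ?N) < 1" using u(1) N by (simp add: norm_power power_less_one_iff)
  have L: "label p = label (corner_map (g, s) (u ^ ?N))"
    using glue_eq_iff[of p, OF _ K] p u(2) vc by simp
  show "p \<in> K \<inter> ?R"
  proof (cases "norm z = 1")
    case False
    then have "p = corner_map (g, s) (u ^ ?N)"
      using L fz unfolding label_corner_map[OF c(1)] by (auto simp: label_def split: if_splits)
    moreover have "corner_map (g, s) (u ^ ?N) \<in> wedge g s"
      unfolding corner_map_def fst_conv snd_conv using nrm by (intro wedgeI) simp
    ultimately show ?thesis using c(1,4) p by auto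
  next
    case True
    obtain s' where s': "z = turn (of_real (s' / real (len f)))" using boundary_turn[OF f(1) True] by blast
    define t where "t = Re (u ^ ?N)"
    have t: "\<bar>t\<bar> < 1" using nrm abs_Re_le_cmod[of "u ^ ?N"] by (simp add: t_def)
    have eq: "pt f s' = pt g (of_int s + 3/4 * t)"
      using L label_turn[OF f(1), of s'] unfolding label_corner_map[OF c(1)] fz s' t_def
      by (auto split: if_splits)
    note D = pt_eqD[OF f(1) c(1) eq] and fl = floor_frac_corner[of t s]
    \<comment> \<open>The point may lie on another face than that of the corner. Its position there
      is the floor of \<open>s'\<close> on an edge leaving \<open>x\<close>, and one more on an edge
      entering \<open>x\<close>.\<close>
    obtain s0 where s0: "src (arc f s0) = x" "s' = of_int s0 + 3/4 * t"
    proof (cases "0 \<le> t")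
      case True
      then have "src (arc f \<lfloor>s'\<rfloor>) = x" "frac s' = 3/4 * t" using D fl t c(4) by auto
      then show ?thesis using that[of "\<lfloor>s'\<rfloor>"] by (simp add: frac_def)
    next
      case False
      then have "frac (of_int s + 3/4 * t) = 1 + 3/4 * t" using fl t by auto
      then have "frac s' = 1 + 3/4 * t" "arc f \<lfloor>s'\<rfloor> = arc g (s - 1)" using D fl t False by auto
      then show ?thesis
        using that[of "\<lfloor>s'\<rfloor> + 1"] src_arc_Suc[OF f(1)] tgt_arc_pred[OF c(1), of s] c(4)
        by (simp add: frac_def)
    qed
    have "z = turn ((of_int s0 + 3/4 * of_real t) / of_nat (len f))" unfolding s' s0(2) by simp
    then have "p \<in> wedge f s0" unfolding fz using t by (simp only: wedgeI norm_of_real)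
    then show ?thesis using s0(1) f(1) p by auto
  qed
qed

lemma parametrization_vertex_chart:
  assumes x: "x \<in> V"
  shows "parametrization S (vertex_chart x)"
proof (rule parametrization_of_closed_disc[OF Hausdorff_S continuous_vertex_chart[OF x]])
  show "inj_on (vertex_chart x) (ball 0 1)"
    using vertex_chart_inj[OF x] by (rule inj_on_subset) auto
  show "vertex_chart x ` ball 0 1 \<inter> vertex_chart x ` sphere 0 1 = {}"
  proof -
    have "ball 0 1 \<inter> sphere (0::complex) 1 = {}" by auto
    moreover have "ball 0 1 \<subseteq> cball (0::complex) 1" "sphere 0 1 \<subseteq> cball (0::complex) 1" by auto
    ultimately show ?thesis
      using inj_on_image_Int[OF vertex_chart_inj[OF x], of "ball 0 1" "sphere 0 1"] by simp
  qed
  have "open (\<Union>(f, s)\<in>{(f, s). f < F \<and> src (arc f s) = x}. wedge f s)"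
    by (intro open_UN ballI) (auto intro: open_wedge)
  then have "openin (top_of_set K) {p \<in> K. glue p \<in> vertex_chart x ` ball 0 1}"
    unfolding vertex_chart_preimage[OF x] by (simp add: openin_open_Int)
  moreover have "vertex_chart x ` ball 0 1 \<subseteq> glue ` K"
    using continuous_map_image_subset_topspace[OF continuous_vertex_chart[OF x]] by auto
  ultimately show "openin S (vertex_chart x ` ball 0 1)" by (simp add: openin_S)
qed

subsection \<open>Orientability\<close>

text \<open>On the unit circle \<open>inverse (cnj z) = z\<close>, so that for either colour the
  boundary parameter \<open>s\<close> goes to \<open>turn s\<close>.\<close>

definition level :: "nat \<times> complex \<Rightarrow> complex" where
  "level p = (if black (fst p) then snd p else inverse (cnj (snd p))) ^ len (fst p)"

text \<open>\<open>inverse (cnj (turn y)) = turn (cnj y)\<close> undoes the reflection of white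
  corners, and the power \<open>len f\<close> turns the integer position into full turns. No trace
  of the corner remains, so the covering has a single formula on the whole vertex chart.\<close>

lemma level_corner_map:
  assumes "f < F"
  shows "level (corner_map (f, s) M) = turn (3/4 * M)"
proof -
  have l: "len f \<noteq> 0" using len_pos[OF assms] by simp
  have "(if black f then turn ((of_int s + 3/4 * reflect (black f) M) / of_nat (len f))
      else inverse (cnj (turn ((of_int s + 3/4 * reflect (black f) M) / of_nat (len f)))))
      = turn ((of_int s + 3/4 * M) / of_nat (len f))"
    by (simp add: cnj_turn inverse_turn reflect_def)
  then have "level (corner_map (f, s) M) = turn (of_nat (len f) * ((of_int s + 3/4 * M) / of_nat (len f)))"
    unfolding level_def corner_map_def fst_conv snd_conv by (simp only: turn_power)
  also have "\<dots> = turn (of_int s + 3/4 * M)" using l by simp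
  finally show ?thesis by (simp add: turn_add)
qed

lemma level_turn:
  assumes "f < F"
  shows "level (f, turn (of_real (s / real (len f)))) = turn (of_real s)"
proof -
  have l: "len f \<noteq> 0" using len_pos[OF assms] by simp
  have "(if black f then turn (of_real (s / real (len f)))
      else inverse (cnj (turn (of_real (s / real (len f)))))) = turn (of_real (s / real (len f)))"
    unfolding cnj_turn inverse_turn by simp
  then have "level (f, turn (of_real (s / real (len f)))) =
      turn (of_nat (len f) * of_real (s / real (len f)))"
    unfolding level_def fst_conv snd_conv by (simp only: turn_power)
  then show ?thesis using l by simp
qed

lemma level_cong:
  assumes "p \<in> K" "p' \<in> K" "glue p = glue p'"
  shows "level p = level p'"
proof -
  have L: "label p = label p'" using glue_eq_iff assms by blast
  obtain f z f' z' where p: "p = (f, z)" "p' = (f', z')" by (cases p, cases p')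
  have f: "f < F" "f' < F" using assms p by (auto simp: K_def)
  show ?thesis
  proof (cases "norm z = 1")
    case False
    then have "p = p'" using L p by (auto simp: label_def split: if_splits)
    then show ?thesis by simp
  next
    case True
    then have "norm z' = 1" using L p by (auto simp: label_def split: if_splits)
    obtain s where s: "z = turn (of_real (s / real (len f)))" using boundary_turn[OF f(1) True] by blast
    obtain s' where s': "z' = turn (of_real (s' / real (len f')))"
      using boundary_turn[OF f(2) \<open>norm z' = 1\<close>] by blast
    have "pt f s = pt f' s'"
      using L unfolding p s s' label_turn[OF f(1)] label_turn[OF f(2)] by simp
    from pt_eqD[OF f this] have "frac s = frac s'" by metis
    then have "s = s' + of_int (\<lfloor>s\<rfloor> - \<lfloor>s'\<rfloor>)" by (simp add: frac_def)
    then have "complex_of_real s = of_real s' + of_int (\<lfloor>s\<rfloor> - \<lfloor>s'\<rfloor>)"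
      by (metis of_real_add of_real_of_int_eq)
    then have "turn (of_real s) = turn (of_real s')" unfolding turn_eq_iff by blast
    then show ?thesis unfolding p s s' level_turn[OF f(1)] level_turn[OF f(2)] .
  qed
qed

text \<open>
  The surface is a branched covering of the sphere; this is the covering map, away from the
  centres of the white faces. It maps the graph to the unit circle, and all vertices to 1.
\<close>

definition cover :: "complex \<Rightarrow> complex" where
  "cover y = level (inv_into K glue y)"

lemma cover_glue: "p \<in> K \<Longrightarrow> cover (glue p) = level p"
  unfolding cover_def by (rule level_cong) (auto intro: inv_into_into f_inv_into_f)

lemma cover_vertex_chart:
  assumes "x \<in> V" "norm u \<le> 1"
  shows "cover (vertex_chart x u) = turn (3/4 * u ^ deg x)"
proof -
  obtain i f s \<phi> where "i < 2 * deg x" "corner x i = (f, s)"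
    and vc: "vertex_chart x u = glue (corner_map (f, s) (u ^ deg x))" and K: "corner_map (f, s) (u ^ deg x) \<in> K"
    by (rule vertex_chart_corner[OF assms]) blast
  then have "f < F" using corner(1)[OF assms(1)] by blast
  then show ?thesis unfolding vc using cover_glue[OF K] level_corner_map by simp
qed

definition face_chart :: "nat \<Rightarrow> complex \<Rightarrow> complex" where
  "face_chart f z = glue (f, reflect (black f) z)"

lemma
  assumes "f < F"
  shows parametrization_face_chart: "parametrization S (face_chart f)"
    and face_chart_image: "face_chart f ` ball 0 1 = face f"
proof -
  have 1: "continuous_on UNIV (reflect (black f))" using continuous_on_reflect continuous_on_id by blast
  note 2 = parametrization_face[OF assms 1 reflect_reflect norm_reflect]
  show "parametrization S (face_chart f)" using 2(1) unfolding face_chart_def[abs_def] .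
  show "face_chart f ` ball 0 1 = face f" using 2(2) unfolding face_chart_def[abs_def] .
qed

lemma cover_face_chart:
  assumes "f < F" "norm z < 1"
  shows "cover (face_chart f z) = (if black f then z else inverse z) ^ len f"
proof -
  have "(f, reflect (black f) z) \<in> K" using assms by (simp add: K_def)
  then show ?thesis unfolding face_chart_def by (simp add: cover_glue level_def reflect_def)
qed

lemma turn_nonzero [simp]: "turn y \<noteq> 0" by (simp add: turn_def)

text \<open>The centre must be avoided for both colours: \<open>z ^ len f\<close> may branch there,
  and \<open>inverse z ^ len f\<close> has a pole. The hypothesis excludes both, because
  \<open>inverse 0 = 0\<close> makes \<open>cover\<close> vanish at the white centres too.\<close>

lemma cover_face_chart_derivative:
  assumes f: "f < F" and z: "norm z < 1" "cover (face_chart f z) \<noteq> 0"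
  shows "\<exists>d. d \<noteq> 0 \<and> ((cover \<circ> face_chart f) has_field_derivative d) (at z)"
proof -
  let ?l = "len f"
  have l: "0 < ?l" using len_pos[OF f] .
  have z0: "z \<noteq> 0" using z(2) l unfolding cover_face_chart[OF f z(1)]
    by (auto simp: zero_power split: if_splits)
  show ?thesis
  proof (cases "black f")
    case True
    have "((\<lambda>z. z ^ ?l) has_field_derivative of_nat ?l * z ^ (?l - 1)) (at z)"
      by (auto intro!: derivative_eq_intros)
    then have "((cover \<circ> face_chart f) has_field_derivative of_nat ?l * z ^ (?l - 1)) (at z)"
      by (rule has_field_derivative_transform_within_open[where S = "ball 0 1"])
        (use z True cover_face_chart[OF f] in auto)
    then show ?thesis using z0 l by (intro exI conjI) auto
  next
    case False
    have "((\<lambda>z. inverse z ^ ?l) has_field_derivative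
        of_nat ?l * inverse z ^ (?l - 1) * - (inverse z ^ 2)) (at z)"
      using z0 by (auto intro!: derivative_eq_intros simp: power2_eq_square)
    then have "((cover \<circ> face_chart f) has_field_derivative
        of_nat ?l * inverse z ^ (?l - 1) * - (inverse z ^ 2)) (at z)"
      by (rule has_field_derivative_transform_within_open[where S = "ball 0 1"])
        (use z False cover_face_chart[OF f] in auto)
    then show ?thesis using z0 l by (intro exI conjI) auto
  qed
qed

lemma cover_vertex_chart_derivative:
  assumes x: "x \<in> V" and u: "norm u < 1" "u \<noteq> 0"
  shows "\<exists>d. d \<noteq> 0 \<and> ((cover \<circ> vertex_chart x) has_field_derivative d) (at u)"
proof -
  let ?N = "deg x"
  have N: "0 < ?N" using deg_pos[OF x] .
  define d where "d = turn (3/4 * u ^ ?N) * (2 * of_real pi * \<i> * (3/4 * (of_nat ?N * u ^ (?N - 1))))"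
  have "((\<lambda>u. turn (3/4 * u ^ ?N)) has_field_derivative d) (at u)"
    unfolding turn_def d_def by (auto intro!: derivative_eq_intros)
  then have "((cover \<circ> vertex_chart x) has_field_derivative d) (at u)"
    by (rule has_field_derivative_transform_within_open[where S = "ball 0 1"])
      (use u cover_vertex_chart[OF x] in auto)
  moreover have "d \<noteq> 0" using N u by (simp add: d_def)
  ultimately show ?thesis by blast
qed

section \<open>Branch points and the atlas\<close>

lemma vertex_chart_0:
  assumes x: "x \<in> V"
  obtains f s where "f < F" "src (arc f s) = x" "vertex_chart x 0 = graph_map (pt f (of_int s))"
    "vertex_chart x 0 = glue (f, turn (of_real (of_int s / real (len f))))"
proof -
  have N: "0 < deg x" using deg_pos[OF x] .
  obtain f s where fs: "corner x 0 = (f, s)" by (cases "corner x 0")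
  have i: "0 < 2 * deg x" using N by simp
  note c = corner[OF x i fs]
  have "vertex_chart x 0 = glue (corner_map (f, s) (of_real 0))"
    using fs N by (simp add: vertex_chart_def sector_def zero_power)
  moreover have "corner_map (f, s) (of_real 0) = (f, turn (of_real (of_int s / real (len f))))"
    unfolding corner_map_real[OF c(1)] by simp
  moreover have "glue (corner_map (f, s) (of_real 0)) = graph_map (pt f (of_int s))"
    unfolding glue_corner_map_real[OF c(1)] by simp
  ultimately show ?thesis using that[OF c(1,4)] by simp
qed

lemma vertex_chart_0_notin_face:
  assumes "x \<in> V" "f < F"
  shows "vertex_chart x 0 \<notin> face f"
proof -
  obtain g s where g: "g < F" "vertex_chart x 0 = graph_map (pt g (of_int s))"
    using vertex_chart_0[OF assms(1)] by metis
  have "vertex_chart x 0 \<in> graph_map ` realization V E"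
    unfolding g(2) using pt_realization[OF g(1)] by blast
  then show ?thesis using topspace_minus_graph assms(2) by blast
qed

text \<open>The covering is 1 at every vertex and \<open>turn (3/4 * u ^ deg y)\<close> in the chart
  at \<open>y\<close>. The argument of \<open>turn\<close> has norm below 1, so it is an integer
  only for \<open>u = 0\<close>: the only vertex in the chart is its centre.\<close>

lemma vertex_chart_0_unique:
  assumes x: "x \<in> V" and y: "y \<in> V" and u: "norm u < 1" "vertex_chart x 0 = vertex_chart y u"
  shows "x = y"
proof -
  have N: "0 < deg x" "0 < deg y" using deg_pos x y by auto
  have "turn 0 = turn (3/4 * u ^ deg y)"
    using cover_vertex_chart[OF x, of 0] cover_vertex_chart[OF y, of u] u N
    by (simp add: zero_power)
  then obtain n :: int where n: "0 = 3/4 * u ^ deg y + of_int n" unfolding turn_eq_iff by blast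
  have "norm (3/4 * u ^ deg y) < 1"
  proof -
    have "norm u ^ deg y \<le> 1" using u(1) by (simp add: power_le_one)
    then show ?thesis by (simp add: norm_mult norm_power)
  qed
  moreover have "3/4 * u ^ deg y = - of_int n" using n by (simp add: eq_neg_iff_add_eq_0)
  ultimately have "norm (complex_of_int n) < 1" by (simp only: norm_minus_cancel)
  then have "n = 0" by simp
  then have "u = 0" using n by simp
  then have eq: "vertex_chart x 0 = vertex_chart y 0" using u by simp
  obtain f s where f: "f < F" "src (arc f s) = x" "vertex_chart x 0 = graph_map (pt f (of_int s))"
    using vertex_chart_0[OF x] by metis
  obtain g s' where g: "g < F" "src (arc g s') = y" "vertex_chart y 0 = graph_map (pt g (of_int s'))"
    using vertex_chart_0[OF y] by metis
  have "pt f (of_int s) = pt g (of_int s')"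
    using eq f(3) g(3) graph_map_pt_eq_iff[OF f(1) g(1)] by simp
  from pt_eqD[OF f(1) g(1) this] show ?thesis using f(2) g(2) by auto
qed

definition charts :: "(complex \<Rightarrow> complex) set" where
  "charts = face_chart ` {..<F} \<union> vertex_chart ` V"

lemma parametrization_charts: "\<Psi> \<in> charts \<Longrightarrow> parametrization S \<Psi>"
  unfolding charts_def using parametrization_face_chart parametrization_vertex_chart by auto

lemma topspace_charts: "topspace S = (\<Union>\<Psi>\<in>charts. \<Psi> ` ball 0 1)"
proof
  show "(\<Union>\<Psi>\<in>charts. \<Psi> ` ball 0 1) \<subseteq> topspace S"
    using parametrization_charts openin_subset unfolding parametrization_def by (intro UN_least) blast
  show "topspace S \<subseteq> (\<Union>\<Psi>\<in>charts. \<Psi> ` ball 0 1)"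
  proof
    fix y assume "y \<in> topspace S"
    then obtain f z where p: "f < F" "norm z \<le> 1" "y = glue (f, z)" by (auto simp: K_def)
    show "y \<in> (\<Union>\<Psi>\<in>charts. \<Psi> ` ball 0 1)"
    proof (cases "norm z = 1")
      case False
      then have "y \<in> face f" using p by (auto simp: face_eq)
      then have "y \<in> face_chart f ` ball 0 1" using face_chart_image[OF p(1)] by simp
      then show ?thesis using p(1) by (auto simp: charts_def)
    next
      case True
      obtain s where s: "z = turn (of_real (s / real (len f)))" using boundary_turn[OF p(1) True] by blast
      \<comment> \<open>The nearest integer is at distance at most 1/2, which the factor 4/3
        stretches to at most 2/3; so the point lies inside the wedge at \<open>j\<close>.\<close>
      define j where "j = round s"
      define x where "x = src (arc f j)"
      have x: "x \<in> V" using arc_in[OF p(1)] by (simp add: x_def V_def)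
      have "\<bar>s - of_int j\<bar> \<le> 1/2" using of_int_round_abs_le[of s] by (simp add: j_def abs_minus_commute)
      then have "norm (complex_of_real (4/3 * (s - of_int j))) < 1"
        unfolding norm_of_real abs_mult by simp
      then have "(f, turn ((of_int j + 3/4 * of_real (4/3 * (s - of_int j))) / of_nat (len f))) \<in> wedge f j"
        by (rule wedgeI)
      moreover have "of_int j + 3/4 * of_real (4/3 * (s - of_int j)) = complex_of_real s"
        by (simp add: field_simps)
      then have "(of_int j + 3/4 * of_real (4/3 * (s - of_int j))) / of_nat (len f) =
          complex_of_real (s / real (len f))" by simp
      ultimately have "(f, z) \<in> wedge f j" unfolding s by (simp only:)
      moreover have "(f, z) \<in> K" using p by (simp add: K_def)
      ultimately have "(f, z) \<in> {p \<in> K. glue p \<in> vertex_chart x ` ball 0 1}"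
        unfolding vertex_chart_preimage[OF x] using p(1) x_def by blast
      then show ?thesis using x p(3) by (auto simp: charts_def)
    qed
  qed
qed

lemma orientable_S: "orientable S"
proof (rule orientable_parametrized[OF parametrization_charts topspace_charts, where w = cover])
  fix \<Psi> \<Phi> u
  assume \<Psi>: "\<Psi> \<in> charts" and \<Phi>: "\<Phi> \<in> charts" and ne: "\<Psi> \<noteq> \<Phi>"
    and "u \<in> ball 0 1" and mem: "\<Psi> u \<in> \<Phi> ` ball 0 1"
  then have u: "norm u < 1" by simp
  consider (face) f where "f < F" "\<Psi> = face_chart f" | (vertex) x where "x \<in> V" "\<Psi> = vertex_chart x"
    using \<Psi> by (auto simp: charts_def)
  then show "\<exists>d. d \<noteq> 0 \<and> ((cover \<circ> \<Psi>) has_field_derivative d) (at u)"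
  proof cases
    case face
    \<comment> \<open>A different chart containing the point must be a vertex chart, where the
      covering takes values of \<open>turn\<close>; this keeps \<open>u\<close> away from the face
      centre.\<close>
    have "cover (\<Psi> u) \<noteq> 0"
    proof -
      have "\<Phi> \<notin> face_chart ` {..<F}"
      proof
        assume "\<Phi> \<in> face_chart ` {..<F}"
        then obtain f' where f': "f' < F" "\<Phi> = face_chart f'" by auto
        have "\<Psi> u \<in> \<Psi> ` ball 0 1" using u by simp
        then have "\<Psi> u \<in> face f" "\<Psi> u \<in> face f'"
          using face_chart_image[OF face(1)] face_chart_image[OF f'(1)] mem
          unfolding face(2) f'(2) by auto
        then have "f = f'" using face_disjoint[OF face(1) f'(1)] by blast
        then show False using ne face f' by simp
      qed
      then obtain y where y: "y \<in> V" "\<Phi> = vertex_chart y" using \<Phi> by (auto simp: charts_def)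
      obtain u' where "norm u' < 1" "\<Psi> u = vertex_chart y u'" using mem unfolding y(2) by auto
      then show ?thesis using cover_vertex_chart[OF y(1), of u'] by simp
    qed
    then show ?thesis using cover_face_chart_derivative[OF face(1) u] unfolding face(2) by simp
  next
    case vertex
    have "u \<noteq> 0"
    proof
      assume u0: "u = 0"
      consider (f) f where "f < F" "\<Phi> = face_chart f" | (v) y where "y \<in> V" "\<Phi> = vertex_chart y"
        using \<Phi> by (auto simp: charts_def)
      then show False
      proof cases
        case f
        then show False
          using mem face_chart_image[OF f(1)] vertex_chart_0_notin_face[OF vertex(1) f(1)]
          unfolding u0 vertex(2) f(2) by simp
      next
        case v
        then obtain u' where "norm u' < 1" "vertex_chart x 0 = vertex_chart y u'"
          using mem unfolding u0 vertex(2) by auto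
        then have "x = y" using vertex_chart_0_unique[OF vertex(1) v(1)] by blast
        then show False using ne vertex v by simp
      qed
    qed
    then show ?thesis using cover_vertex_chart_derivative[OF vertex(1) u] unfolding vertex(2) by simp
  qed
qed

lemma surface_S:
  assumes "connected (realization V E)"
  shows "surface S"
proof -
  have "\<exists>U \<phi>. p \<in> U \<and> chart S U \<phi>" if p: "p \<in> topspace S" for p
  proof -
    obtain \<Psi> where "\<Psi> \<in> charts" "p \<in> \<Psi> ` ball 0 1" using p unfolding topspace_charts by blast
    then show ?thesis using chart_parametrization[OF parametrization_charts, of \<Psi>] by blast
  qed
  then show ?thesis unfolding surface_def using compact_S connected_S[OF assms] Hausdorff_S by blast
qed

section \<open>Connectedness of the graph, and the biembedding\<close>

text \<open>Completeness joins the source of every arc to a fixed vertex \<open>y\<close> by a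
  segment inside the graph. With the edges attached, these segments are connected sets through
  \<open>y\<close>; for the source \<open>y\<close> itself the segment is a point.\<close>

lemma connected_realization:
  assumes complete: "E = complete_edges V"
  shows "connected (realization V E)"
proof (cases "arcs = {}")
  case True
  then show ?thesis unfolding realization_eq by simp
next
  case False
  then obtain a0 where a0: "a0 \<in> arcs" by blast
  define y where "y = src a0"
  have y: "y \<in> V" using a0 by (simp add: y_def V_def)
  define seg where "seg = (\<lambda>(x::int) x'. (\<lambda>t. edge_point x x' t) ` {0..1::real})"
  have seg: "connected (seg x x')" for x x'
    unfolding seg_def by (intro connected_continuous_image continuous_on_edge_point continuous_intros) simp
  have ends: "edge_point x x' 0 \<in> seg x x'" "edge_point x x' 1 \<in> seg x x'" for x x'
    unfolding seg_def by auto
  have vertex: "edge_point x x' 0 = edge_point x z 0" "edge_point x x' 1 = edge_point x' z 0" for x x' z :: int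
    by (simp_all add: edge_point_def fun_eq_iff)
  define star where "star = (\<lambda>a. seg y (src a) \<union> seg (src a) (tgt a))"
  have star: "connected (star a)" for a unfolding star_def
  proof (intro connected_Un seg)
    have "edge_point (src a) (tgt a) 0 \<in> seg y (src a)"
      using ends(2)[of y "src a"] vertex(2)[of y "src a" "tgt a"] by simp
    then show "seg y (src a) \<inter> seg (src a) (tgt a) \<noteq> {}" using ends(1) by blast
  qed
  have "realization V E = (\<Union>a\<in>arcs. star a)"
  proof
    show "realization V E \<subseteq> (\<Union>a\<in>arcs. star a)" unfolding realization_eq star_def seg_def by auto
    have seg_sub: "seg y x \<subseteq> realization V E" if x: "x \<in> V" for x
    proof
      fix w assume "w \<in> seg y x"
      then obtain t where t: "0 \<le> t" "t \<le> 1" "w = edge_point y x t" by (auto simp: seg_def)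
      have "(\<Sum>u\<in>V. w u) = (\<Sum>u\<in>V. if u = y then 1 - t else 0) + (\<Sum>u\<in>V. if u = x then t else 0)"
        unfolding t(3) edge_point_def by (rule sum.distrib)
      also have "\<dots> = 1" using finite_V x y by (simp add: sum.delta)
      finally have sum: "(\<Sum>u\<in>V. w u) = 1" .
      have supp: "{y, x} \<in> E \<union> (\<lambda>x. {x}) ` V"
      proof (cases "x = y")
        case False
        then show ?thesis using x y unfolding complete complete_edges_def by blast
      qed (use x in simp)
      have "\<forall>u. 0 \<le> w u" "\<forall>u. w u \<noteq> 0 \<longrightarrow> u \<in> {y, x}" using t by (simp_all add: edge_point_def)
      then show "w \<in> realization V E" unfolding realization_def using sum supp by blast
    qed
    show "(\<Union>a\<in>arcs. star a) \<subseteq> realization V E"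
    proof
      fix w assume "w \<in> (\<Union>a\<in>arcs. star a)"
      then obtain a where a: "a \<in> arcs" "w \<in> seg y (src a) \<or> w \<in> seg (src a) (tgt a)"
        by (auto simp: star_def)
      then show "w \<in> realization V E"
      proof (elim disjE)
        assume "w \<in> seg y (src a)"
        then show ?thesis using seg_sub[of "src a"] a(1) by (auto simp: V_def)
      next
        assume "w \<in> seg (src a) (tgt a)"
        then obtain t where "w = edge_point (src a) (tgt a) t" "0 \<le> t" "t \<le> 1"
          by (auto simp: seg_def)
        then show ?thesis unfolding realization_eq using a(1) by blast
      qed
    qed
  qed
  moreover have "connected (\<Union>(star ` arcs))"
  proof (rule connected_Union)
    have "edge_point y y 0 \<in> star a" for a
      unfolding star_def using ends(1)[of y "src a"] vertex(1)[of y y "src a"] by simp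
    then show "\<Inter>(star ` arcs) \<noteq> {}" by blast
  qed (use star in blast)
  ultimately show ?thesis by simp
qed

lemma unique_face:
  assumes "e \<in> E"
  shows "\<exists>!G. G \<in> face ` {f. f < F \<and> black f = c} \<and> on_boundary V E S graph_map e G"
proof -
  obtain a where a: "a \<in> arcs" "e = {src a, tgt a}" using assms by (auto simp: E_def)
  obtain f j where f: "f < F" "black f = c" "arc f j = a" using arc_ex[OF a(1)] by blast
  show ?thesis
  proof (rule ex1I[of _ "face f"])
    have "on_boundary V E S graph_map e (face f)"
      using on_boundary_face[OF f(1) a(1)] f(3) unfolding a(2) by blast
    then show "face f \<in> face ` {f. f < F \<and> black f = c} \<and> on_boundary V E S graph_map e (face f)"
      using f by blast
  next
    fix G assume G: "G \<in> face ` {f. f < F \<and> black f = c} \<and> on_boundary V E S graph_map e G"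
    then obtain f' where f': "f' < F" "black f' = c" "G = face f'" by blast
    have "on_boundary V E S graph_map {src a, tgt a} (face f')" using G unfolding f'(3) a(2) by blast
    then obtain j' where "arc f' j' = a" unfolding on_boundary_face[OF f'(1) a(1)] by blast
    then have "black f' = black f" "arc f' j' = arc f j" using f f' by simp_all
    then have "f' = f" by (rule arc_eqD[OF f'(1) f(1), THEN conjunct1])
    then show "G = face f" using f'(3) by simp
  qed
qed

lemma biembedding_S:
  assumes "circuit_decomposition E \<D>" "circuit_decomposition E \<D>'"
    and \<D>: "bij_betw (\<lambda>f. circuit (face_walk f)) {f. f < F \<and> black f} \<D>"
    and \<D>': "bij_betw (\<lambda>f. circuit (face_walk f)) {f. f < F \<and> \<not> black f} \<D>'"
  shows "biembedding V E \<D> \<D>' S graph_map"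
proof -
  define B where "B = (\<lambda>c. {f. f < F \<and> black f = c})"
  have B: "B c \<subseteq> {..<F}" for c by (auto simp: B_def)
  have boundary: "\<exists>\<beta>. bij_betw \<beta> (face ` B c) \<E> \<and> (\<forall>G\<in>face ` B c. face_boundary S graph_map G (\<beta> G))"
    if \<E>: "bij_betw (\<lambda>f. circuit (face_walk f)) (B c) \<E>" for c \<E>
  proof (intro exI conjI ballI)
    have inj: "inj_on face (B c)" using inj_on_face B by (rule inj_on_subset)
    have "bij_betw (inv_into (B c) face) (face ` B c) (B c)"
      using inj by (intro bij_betw_inv_into) (simp add: bij_betw_def)
    then show "bij_betw ((\<lambda>f. circuit (face_walk f)) \<circ> inv_into (B c) face) (face ` B c) \<E>"
      using \<E> by (rule bij_betw_trans)
    fix G assume "G \<in> face ` B c"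
    then obtain f where f: "f \<in> B c" "G = face f" by blast
    have "f < F" using f(1) B by auto
    then show "face_boundary S graph_map G (((\<lambda>f. circuit (face_walk f)) \<circ> inv_into (B c) face) G)"
      unfolding f(2) comp_apply inv_into_f_f[OF inj f(1)] by (rule face_boundary_face)
  qed
  have "B True \<union> B False = {..<F}" "B True \<inter> B False = {}" by (auto simp: B_def)
  then have 1: "face ` B True \<union> face ` B False = faces V E S graph_map"
      "face ` B True \<inter> face ` B False = {}"
    unfolding faces_eq image_Un[symmetric] using inj_on_image_Int[OF inj_on_face B B, of True False]
    by simp_all
  have 2: "\<exists>!G. G \<in> face ` B c \<and> on_boundary V E S graph_map e G" if "e \<in> E" for c e
    using unique_face[OF that, of c] unfolding B_def .
  have 3: "\<exists>\<beta>. bij_betw \<beta> (face ` B True) \<D> \<and> (\<forall>G\<in>face ` B True. face_boundary S graph_map G (\<beta> G))"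
    using \<D> by (intro boundary) (simp add: B_def)
  have 4: "\<exists>\<beta>. bij_betw \<beta> (face ` B False) \<D>' \<and> (\<forall>G\<in>face ` B False. face_boundary S graph_map G (\<beta> G))"
    using \<D>' by (intro boundary) (simp add: B_def)
  show ?thesis unfolding biembedding_def
    by (intro conjI assms(1,2) graph_embedding_graph_map exI[of _ "face ` B True"]
        exI[of _ "face ` B False"] ballI 1 2 3 4)
qed

end

section \<open>Circuits of orderings\<close>

lemma concat_map_upt_const_length:
  assumes "\<And>k. k < n \<Longrightarrow> length (g k) = l" "0 < l"
  shows "concat (map g [0..<n]) = map (\<lambda>j. g (j div l) ! (j mod l)) [0..<n * l]" using assms(1)
proof (induction n)
  case (Suc n)
  have "map (\<lambda>j. g (j div l) ! (j mod l)) [n * l..<n * l + l] = g n"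
    using Suc.prems[of n] assms(2) by (intro nth_equalityI) auto
  moreover have "[0..<Suc n * l] = [0..<n * l] @ [n * l..<n * l + l]"
    using upt_add_eq_append[of 0 "n * l" l] by (simp add: add.commute)
  ultimately show ?case using Suc by simp
qed simp

lemma rotations_rotate: "{rotate j (rotate n c) | j. True} = {rotate j c | j. True}"
proof
  show "{rotate j (rotate n c) | j. True} \<subseteq> {rotate j c | j. True}" by (auto simp: rotate_rotate)
  show "{rotate j c | j. True} \<subseteq> {rotate j (rotate n c) | j. True}"
  proof
    fix d assume "d \<in> {rotate j c | j. True}"
    then obtain j where d: "d = rotate j c" by blast
    \<comment> \<open>The rotation by \<open>n\<close> is undone by continuing it to
      \<open>n * length c\<close>, a multiple of the length.\<close>
    have "rotate (j + (n * length c - n)) (rotate n c) = d"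
    proof (cases "c = []")
      case False
      then have "n \<le> n * length c" by (cases c) auto
      then have "j + (n * length c - n) + n = j + n * length c" by linarith
      then have "rotate (j + (n * length c - n)) (rotate n c) = rotate j (rotate (n * length c) c)"
        by (simp only: rotate_rotate)
      then show ?thesis by (simp add: d rotate_id)
    qed (simp add: d)
    then show "d \<in> {rotate j (rotate n c) | j. True}" by blast
  qed
qed

lemma circuit_rotate: "circuit (rotate n c) = circuit c"
proof -
  have "rev (rotate n c) = rotate (length c - n mod length c) (rev c)"
  proof (cases "c = [] \<or> n mod length c = 0")
    case True
    then have "rotate n c = c" by (auto intro: rotate_id)
    then show ?thesis using True by (auto simp: rotate_id)
  next
    case False
    then have "n mod length c < length c" by simp
    then have "(length c - n mod length c) mod length c = length c - n mod length c"
      using False by (intro mod_less) linarith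
    then have "length c - (length c - n mod length c) mod length c = n mod length c"
      using \<open>n mod length c < length c\<close> by linarith
    then have "rotate (length c - n mod length c) (rev c) = rev (rotate (n mod length c) c)"
      by (simp only: rotate_rev)
    then show ?thesis by (simp only: rotate_conv_mod[of n c, symmetric])
  qed
  then show ?thesis unfolding circuit_def by (simp only: rotations_rotate)
qed

lemma length_walk_edges [simp]: "length (walk_edges c) = length c" by (simp add: walk_edges_def)

lemma walk_edges_rotate: "walk_edges (rotate n c) = rotate n (walk_edges c)"
proof (rule nth_equalityI)
  fix j assume j: "j < length (walk_edges (rotate n c))"
  then have l: "j < length c" "0 < length c" by auto
  have "walk_edges (rotate n c) ! j = {c ! ((n + j) mod length c), c ! ((n + Suc j mod length c) mod length c)}"
    using l by (simp add: walk_edges_def nth_rotate)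
  also have "\<dots> = {c ! ((n + j) mod length c), c ! (Suc ((n + j) mod length c) mod length c)}"
    by (simp add: mod_simps)
  also have "\<dots> = rotate n (walk_edges c) ! j"
    using l by (simp add: nth_rotate) (simp add: walk_edges_def)
  finally show "walk_edges (rotate n c) ! j = rotate n (walk_edges c) ! j" .
qed simp

lemma set_walk_edges_rev: "set (walk_edges (rev c)) = set (walk_edges c)"
proof -
  have sub: "set (walk_edges (rev c)) \<subseteq> set (walk_edges c)" for c :: "'b list"
  proof
    fix e assume "e \<in> set (walk_edges (rev c))"
    then obtain j where j: "j < length c" "e = {rev c ! j, rev c ! (Suc j mod length c)}"
      by (auto simp: walk_edges_def)
    let ?k = "length c - Suc (Suc j mod length c)"
    have l: "0 < length c" using j by auto
    then have m: "Suc j mod length c < length c" by simp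
    have "Suc ?k mod length c = length c - Suc j"
    proof (cases "Suc j = length c")
      case False
      then have "Suc j < length c" using j by simp
      then show ?thesis by simp
    qed (use l in simp)
    then have "e = walk_edges c ! ?k"
      using j m l by (simp add: walk_edges_def rev_nth insert_commute)
    then show "e \<in> set (walk_edges c)" using l by simp
  qed
  show ?thesis using sub[of c] sub[of "rev c"] by simp
qed

lemma circuit_self: "c \<in> circuit c" unfolding circuit_def by (rule UnI1) (auto intro: exI[of _ 0])

lemma set_walk_edges_circuit:
  assumes "c' \<in> circuit c"
  shows "set (walk_edges c') = set (walk_edges c)"
  using assms by (auto simp: circuit_def walk_edges_rotate set_walk_edges_rev)

text \<open>The lists are disjoint, and a cycle maps its list to itself; so an entry of
  \<open>\<omega> i\<close> is affected by the cycle of \<open>\<omega> i\<close> alone, wherever it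
  stands in the composition.\<close>

lemma ordering_perm_nth:
  assumes dist: "\<And>i. i < l \<Longrightarrow> distinct (\<omega> i)"
    and disj: "\<And>i j. i < l \<Longrightarrow> j < l \<Longrightarrow> i \<noteq> j \<Longrightarrow> set (\<omega> i) \<inter> set (\<omega> j) = {}"
    and i: "i < l" and j: "j < length (\<omega> i)"
  shows "ordering_perm l \<omega> (\<omega> i ! j) = \<omega> i ! (Suc j mod length (\<omega> i))"
proof -
  have out: "foldr (\<circ>) (map (\<lambda>i. cycle_of_list (\<omega> i)) ks) id t = t"
    if "\<And>k. k \<in> set ks \<Longrightarrow> t \<notin> set (\<omega> k)" for ks t
    using that by (induction ks) (auto simp: id_outside_supp)
  have fold: "foldr (\<circ>) (map (\<lambda>i. cycle_of_list (\<omega> i)) ks) id t = cycle_of_list (\<omega> i) t"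
    if "distinct ks" "set ks \<subseteq> {..<l}" "i \<in> set ks" "t \<in> set (\<omega> i)" for ks t using that
  proof (induction ks)
    case (Cons k ks)
    have im: "cycle_of_list (\<omega> i) t \<in> set (\<omega> i)"
      using Cons.prems cycle_is_surj[OF dist[OF i]] by blast
    have step: "foldr (\<circ>) (map (\<lambda>i. cycle_of_list (\<omega> i)) (k # ks)) id t =
        cycle_of_list (\<omega> k) (foldr (\<circ>) (map (\<lambda>i. cycle_of_list (\<omega> i)) ks) id t)" by simp
    show ?case
    proof (cases "k = i")
      case True
      have rest: "foldr (\<circ>) (map (\<lambda>i. cycle_of_list (\<omega> i)) ks) id t = t"
      proof (rule out)
        fix k' assume "k' \<in> set ks"
        then have "k' \<noteq> i" "k' < l" using Cons.prems True by auto
        then show "t \<notin> set (\<omega> k')" using disj[OF i, of k'] Cons.prems(4) by blast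
      qed
      show ?thesis unfolding step rest using True by simp
    next
      case False
      then have notin: "cycle_of_list (\<omega> i) t \<notin> set (\<omega> k)"
        using disj[OF i, of k] im Cons.prems(2) by auto
      have rest: "foldr (\<circ>) (map (\<lambda>i. cycle_of_list (\<omega> i)) ks) id t = cycle_of_list (\<omega> i) t"
        using Cons.prems False by (intro Cons.IH) auto
      show ?thesis unfolding step rest using notin by (rule id_outside_supp)
    qed
  qed simp
  have "ordering_perm l \<omega> (\<omega> i ! j) = cycle_of_list (\<omega> i) (\<omega> i ! j)"
    unfolding ordering_perm_def using i j by (intro fold) auto
  also have "\<dots> = map (cycle_of_list (\<omega> i)) (\<omega> i) ! j" using j by simp
  also have "map (cycle_of_list (\<omega> i)) (\<omega> i) = rotate 1 (\<omega> i)"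
    using cyclic_rotation[OF dist[OF i], of 1] by simp
  also have "rotate 1 (\<omega> i) ! j = \<omega> i ! (Suc j mod length (\<omega> i))"
    using j by (simp add: nth_rotate del: rotate_Suc)
  finally show ?thesis .
qed

lemma length_partial_sums [simp]: "length (partial_sums ts) = Suc (length ts)"
  by (simp add: partial_sums_def)

section \<open>Trails of an ordering\<close>

text \<open>What rows and columns have in common: the lists partition \<open>T\<close>, and
  \<open>T\<close> contains exactly one of \<open>z\<close> and \<open>v - z\<close>, so that the
  pairs \<open>(x, t)\<close> with \<open>t\<close> in \<open>T\<close> direct every edge of the
  complete graph once.\<close>

locale ordering_system =
  fixes v :: int and T :: "int set" and l :: nat and \<omega> :: "nat \<Rightarrow> int list"
  assumes T_range: "T \<subseteq> {0<..<v}"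
    and T_eq: "T = (\<Union>i<l. set (\<omega> i))"
    and distinct: "i < l \<Longrightarrow> distinct (\<omega> i)"
    and disjoint: "i < l \<Longrightarrow> j < l \<Longrightarrow> i \<noteq> j \<Longrightarrow> set (\<omega> i) \<inter> set (\<omega> j) = {}"
    and nonempty: "i < l \<Longrightarrow> \<omega> i \<noteq> []"
    and asymmetric: "t \<in> T \<Longrightarrow> t' \<in> T \<Longrightarrow> (t + t') mod v \<noteq> 0"
    and exhaustive: "0 < z \<Longrightarrow> z < v \<Longrightarrow> z \<in> T \<or> v - z \<in> T"
    and v_pos: "0 < v"
begin

definition steps :: "(int \<times> int) set" where "steps = {0..<v} \<times> T"

definition tip :: "int \<times> int \<Rightarrow> int" where "tip a = (fst a + snd a) mod v"

definition next_step :: "int \<times> int \<Rightarrow> int \<times> int" where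
  "next_step a = (tip a, ordering_perm l \<omega> (snd a))"

definition ordering_sum :: "nat \<Rightarrow> int" where "ordering_sum i = sum_list (\<omega> i)"

text \<open>The vertex reached after \<open>j\<close> steps of the walk that starts at
  \<open>snd p\<close> and repeats the list \<open>\<omega> (fst p)\<close> forever; a full round
  adds \<open>ordering_sum\<close>. As \<open>div\<close> and \<open>mod\<close> round down,
  negative \<open>j\<close> continue the walk backwards.\<close>

definition pos :: "nat \<times> int \<Rightarrow> int \<Rightarrow> int" where
  "pos p j = (let k = int (length (\<omega> (fst p))) in
     (snd p + (j div k) * ordering_sum (fst p) + sum_list (take (nat (j mod k)) (\<omega> (fst p)))) mod v)"

definition trail :: "nat \<times> int \<Rightarrow> int \<Rightarrow> int \<times> int" where
  "trail p j = (pos p j, \<omega> (fst p) ! nat (j mod int (length (\<omega> (fst p)))))"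

text \<open>The additive order of \<open>ordering_sum i\<close> modulo \<open>v\<close>: the number
  of rounds after which the walk closes.\<close>

definition period :: "nat \<Rightarrow> nat" where
  "period i = (LEAST k. 0 < k \<and> (int k * ordering_sum i) mod v = 0)"

definition walk_size :: "nat \<times> int \<Rightarrow> nat" where
  "walk_size p = period (fst p) * length (\<omega> (fst p))"

definition starts :: "(nat \<times> int) set" where "starts = {..<l} \<times> {0..<v}"

lemma period: "0 < period i" "(k * ordering_sum i) mod v = 0 \<longleftrightarrow> int (period i) dvd k"
proof -
  have "0 < nat v \<and> (int (nat v) * ordering_sum i) mod v = 0" using v_pos by simp
  then have p: "0 < period i \<and> (int (period i) * ordering_sum i) mod v = 0"
    unfolding period_def by (rule LeastI)
  then show "0 < period i" by simp
  show "(k * ordering_sum i) mod v = 0 \<longleftrightarrow> int (period i) dvd k"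
  proof
    assume k: "(k * ordering_sum i) mod v = 0"
    let ?r = "k mod int (period i)"
    have "v dvd k * ordering_sum i" "v dvd int (period i) * ordering_sum i" using k p by auto
    moreover have "?r * ordering_sum i = k * ordering_sum i - (k div int (period i)) * (int (period i) * ordering_sum i)"
      by (simp add: minus_div_mult_eq_mod[symmetric] algebra_simps)
    ultimately have "v dvd ?r * ordering_sum i" by (simp add: dvd_diff)
    then have r: "(int (nat ?r) * ordering_sum i) mod v = 0" using p by simp
    have "nat ?r < period i" using p by (simp add: nat_less_iff)
    then have "\<not> (0 < nat ?r \<and> (int (nat ?r) * ordering_sum i) mod v = 0)"
      unfolding period_def by (rule not_less_Least)
    then have "\<not> 0 < nat ?r" using conjI[OF _ r] by (rule contrapos_nn)
    moreover have "0 \<le> ?r" using p by simp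
    ultimately have "?r = 0" by linarith
    then show "int (period i) dvd k" by auto
  next
    assume "int (period i) dvd k"
    then obtain q where "k = int (period i) * q" by blast
    then have e: "k * ordering_sum i = (int (period i) * ordering_sum i) * q" by simp
    have "v dvd int (period i) * ordering_sum i" using p by auto
    then show "(k * ordering_sum i) mod v = 0"
      unfolding e by (simp only: mod_eq_0_iff_dvd dvd_mult2)
  qed
qed

lemma fst_starts: "p \<in> starts \<Longrightarrow> fst p < l" by (simp add: starts_def mem_Times_iff)

lemma length_pos: "p \<in> starts \<Longrightarrow> 0 < length (\<omega> (fst p))" using nonempty[OF fst_starts] by simp

lemma walk_size_pos: "p \<in> starts \<Longrightarrow> 0 < walk_size p"
  unfolding walk_size_def by (intro mult_pos_pos period(1) length_pos)

lemma mod_less_length: "p \<in> starts \<Longrightarrow> nat (j mod int (length (\<omega> (fst p)))) < length (\<omega> (fst p))"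
  using length_pos[of p] by (simp add: nat_less_iff)

lemma trail_in_steps:
  assumes "p \<in> starts"
  shows "trail p j \<in> steps"
proof -
  have "\<omega> (fst p) ! nat (j mod int (length (\<omega> (fst p)))) \<in> T"
    using nth_mem[OF mod_less_length[OF assms, of j]] fst_starts[OF assms] unfolding T_eq by blast
  then show ?thesis using v_pos by (auto simp: steps_def trail_def pos_def Let_def)
qed

lemma trail_Suc:
  assumes p: "p \<in> starts"
  shows "trail p (j + 1) = next_step (trail p j)"
proof -
  define ts where "ts = \<omega> (fst p)"
  define k where "k = int (length ts)"
  have k: "0 < k" using length_pos[OF p] by (simp add: k_def ts_def)
  define r where "r = nat (j mod k)"
  have r: "int r = j mod k" "r < length ts" using k by (auto simp: r_def nat_less_iff k_def)
  have step: "(j + 1) div k * ordering_sum (fst p) + sum_list (take (nat ((j + 1) mod k)) ts)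
      = j div k * ordering_sum (fst p) + sum_list (take r ts) + ts ! r"
    "nat ((j + 1) mod k) = Suc r mod length ts"
  proof -
    have 1: "(j + 1) mod k = (int r + 1) mod k" using r by (simp add: mod_simps)
    have 2: "(j + 1) div k = j div k + (int r + 1) div k"
    proof -
      have e: "j + 1 = (int r + 1) + (j div k) * k" using r(1) div_mult_mod_eq[of j k] by linarith
      show ?thesis by (subst e) (rule div_mult_self1, use k in simp)
    qed
    have take: "sum_list (take (Suc r) ts) = sum_list (take r ts) + ts ! r"
      using r(2) by (simp add: take_Suc_conv_app_nth)
    show "nat ((j + 1) mod k) = Suc r mod length ts"
    proof -
      have "(int r + 1) mod k = int (Suc r mod length ts)" by (simp add: k_def zmod_int add.commute)
      then show ?thesis unfolding 1 by simp
    qed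
    show "(j + 1) div k * ordering_sum (fst p) + sum_list (take (nat ((j + 1) mod k)) ts)
      = j div k * ordering_sum (fst p) + sum_list (take r ts) + ts ! r"
    \<comment> \<open>At the end of a round the index wraps to 0 and the completed partial sum is
      traded for one more \<open>ordering_sum\<close>.\<close>
    proof (cases "Suc r = length ts")
      case True
      then have "int r + 1 = k" by (simp add: k_def)
      then have md: "(j + 1) mod k = 0" "(j + 1) div k = j div k + 1" unfolding 1 2 using k by simp_all
      have "ordering_sum (fst p) = sum_list (take (Suc r) ts)"
        unfolding True ordering_sum_def ts_def by simp
      then have S: "ordering_sum (fst p) = sum_list (take r ts) + ts ! r" unfolding take .
      have "(j div k + 1) * ordering_sum (fst p) =
          j div k * ordering_sum (fst p) + (sum_list (take r ts) + ts ! r)"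
        unfolding S[symmetric] by (simp only: distrib_right mult_1)
      then show ?thesis unfolding md by (simp only: nat_zero_as_int[symmetric] nat_0 take_0 sum_list.Nil
            add_0_right add.assoc)
    next
      case False
      then have "int r + 1 < k" using r(2) by (simp add: k_def)
      then have md: "(j + 1) mod k = int r + 1" "(j + 1) div k = j div k" unfolding 1 2 by simp_all
      have "nat (int r + 1) = Suc r" by simp
      then show ?thesis unfolding md by (simp only: take add.assoc)
    qed
  qed
  have "pos p (j + 1) = (pos p j + ts ! r) mod v"
    unfolding pos_def Let_def ts_def[symmetric] k_def[symmetric] r_def[symmetric]
    using step(1) by (simp add: mod_simps add.assoc)
  moreover have "ordering_perm l \<omega> (ts ! r) = ts ! (Suc r mod length ts)"
    unfolding ts_def using fst_starts[OF p] r(2) unfolding ts_def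
    by (intro ordering_perm_nth distinct disjoint)
  ultimately show ?thesis
    unfolding trail_def next_step_def tip_def fst_conv snd_conv ts_def[symmetric] k_def[symmetric]
      step(2) r_def[symmetric] by simp
qed

text \<open>The entry determines its list by disjointness and its index by distinctness. For the
  same start, equal vertices then force the numbers of full rounds to differ by a multiple of
  \<open>period\<close>.\<close>

lemma trail_eqD:
  assumes p: "p \<in> starts" "p' \<in> starts" and eq: "trail p j = trail p' j'"
  shows "fst p = fst p'" "p = p' \<Longrightarrow> j mod int (walk_size p) = j' mod int (walk_size p)"
proof -
  let ?ts = "\<omega> (fst p)" and ?ts' = "\<omega> (fst p')"
  have mem: "?ts ! nat (j mod int (length ?ts)) = ?ts' ! nat (j' mod int (length ?ts'))"
    using eq by (simp add: trail_def)
  have "?ts ! nat (j mod int (length ?ts)) \<in> set ?ts" "?ts' ! nat (j' mod int (length ?ts')) \<in> set ?ts'"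
    using nth_mem[OF mod_less_length[OF p(1)]] nth_mem[OF mod_less_length[OF p(2)]] by blast+
  then have "set ?ts \<inter> set ?ts' \<noteq> {}" using mem by auto
  then show i: "fst p = fst p'" using disjoint fst_starts[OF p(1)] fst_starts[OF p(2)] by blast
  show "j mod int (walk_size p) = j' mod int (walk_size p)" if "p = p'"
  proof -
    let ?k = "int (length ?ts)"
    have k: "0 < ?k" using length_pos[OF p(1)] by simp
    have "nat (j mod ?k) = nat (j' mod ?k)"
      using mem nth_eq_iff_index_eq[OF distinct[OF fst_starts[OF p(1)]]
          mod_less_length[OF p(1), of j] mod_less_length[OF p(1), of j']]
      unfolding that[symmetric] by blast
    moreover have "0 \<le> j mod ?k" "0 \<le> j' mod ?k" using k by simp_all
    ultimately have mod: "j mod ?k = j' mod ?k" by (simp only: eq_nat_nat_iff)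
    have "pos p j = pos p j'" using eq that by (simp add: trail_def)
    then have "v dvd (snd p + j div ?k * ordering_sum (fst p) + sum_list (take (nat (j mod ?k)) ?ts)) -
        (snd p + j' div ?k * ordering_sum (fst p) + sum_list (take (nat (j' mod ?k)) ?ts))"
      unfolding pos_def Let_def mod_eq_dvd_iff .
    then have "v dvd (j div ?k - j' div ?k) * ordering_sum (fst p)" unfolding mod by (simp add: algebra_simps)
    then have "((j div ?k - j' div ?k) * ordering_sum (fst p)) mod v = 0" by simp
    then have "int (period (fst p)) dvd j div ?k - j' div ?k" by (rule period(2)[THEN iffD1])
    then obtain q where q: "j div ?k - j' div ?k = int (period (fst p)) * q" by (rule dvdE)
    have "j - j' = (j div ?k - j' div ?k) * ?k"
      using mod div_mult_mod_eq[of j ?k] div_mult_mod_eq[of j' ?k] unfolding left_diff_distrib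
      by linarith
    then have "j - j' = int (walk_size p) * q" unfolding q by (simp add: walk_size_def)
    then show ?thesis by (simp add: mod_eq_dvd_iff)
  qed
qed

lemma trail_period:
  assumes p: "p \<in> starts"
  shows "trail p (j + int (walk_size p)) = trail p j"
proof -
  let ?ts = "\<omega> (fst p)"
  let ?k = "int (length ?ts)"
  have k: "?k \<noteq> 0" using length_pos[OF p] by simp
  have mod: "(j + int (walk_size p)) mod ?k = j mod ?k" by (simp add: walk_size_def)
  have div: "(j + int (walk_size p)) div ?k = j div ?k + int (period (fst p))"
    using k by (simp add: walk_size_def)
  have "v dvd int (period (fst p)) * ordering_sum (fst p)"
    using period(2)[of "int (period (fst p))" "fst p"] by auto
  then have "pos p (j + int (walk_size p)) = pos p j"
    unfolding pos_def Let_def mod div mod_eq_dvd_iff by (simp add: algebra_simps)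
  then show ?thesis by (simp add: trail_def mod)
qed

lemma trail_mod: "p \<in> starts \<Longrightarrow> trail p (j mod int (walk_size p)) = trail p j"
  by (rule periodic_mod) (rule trail_period)

text \<open>Both trails follow \<open>next_step\<close>, so an agreement continues forwards; a
  backward shift equals a forward one modulo the common period.\<close>

lemma trail_shift:
  assumes p: "p \<in> starts" "p' \<in> starts" and eq: "trail p j = trail p' j'"
  shows "trail p (j + k) = trail p' (j' + k)"
proof -
  have fwd: "trail p (j + int n) = trail p' (j' + int n)" for n
  proof (induction n)
    case (Suc n)
    then show ?case using trail_Suc[OF p(1), of "j + int n"] trail_Suc[OF p(2), of "j' + int n"]
      by (simp add: algebra_simps)
  qed (simp add: eq)
  have sizes: "walk_size p = walk_size p'" using trail_eqD(1)[OF p eq] by (simp add: walk_size_def)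
  have "trail p (j + k) = trail p (j + k mod int (walk_size p))"
    using trail_mod[OF p(1), of "j + k"] trail_mod[OF p(1), of "j + k mod int (walk_size p)"]
    by (simp add: mod_simps)
  also have "\<dots> = trail p' (j' + k mod int (walk_size p'))"
    using fwd[of "nat (k mod int (walk_size p))"] walk_size_pos[OF p(1)] by (simp add: sizes)
  also have "\<dots> = trail p' (j' + k)"
    using trail_mod[OF p(2), of "j' + k"] trail_mod[OF p(2), of "j' + k mod int (walk_size p')"]
    by (simp add: mod_simps)
  finally show ?thesis .
qed

definition walk :: "nat \<times> int \<Rightarrow> int list" where
  "walk p = map (\<lambda>j. pos p (int j)) [0..<walk_size p]"

lemma length_walk [simp]: "length (walk p) = walk_size p" by (simp add: walk_def)

lemma circuit_walk_cong:
  assumes p: "p \<in> starts" "p' \<in> starts" and eq: "trail p j = trail p' j'"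
  shows "circuit (walk p) = circuit (walk p')"
proof -
  have sizes: "walk_size p = walk_size p'" using trail_eqD(1)[OF p eq] by (simp add: walk_size_def)
  define n where "n = nat ((j - j') mod int (walk_size p))"
  have n: "int n = (j - j') mod int (walk_size p)" using walk_size_pos[OF p(1)] by (simp add: n_def)
  have "walk p' = rotate n (walk p)"
  proof (rule nth_equalityI)
    fix i assume "i < length (walk p')"
    then have i: "i < walk_size p" by (simp add: sizes)
    have "rotate n (walk p) ! i = pos p (int ((n + i) mod walk_size p))"
      using i by (simp add: nth_rotate) (simp add: walk_def)
    also have "\<dots> = fst (trail p (int ((n + i) mod walk_size p)))" by (simp add: trail_def)
    also have "int ((n + i) mod walk_size p) = (j + (int i - j')) mod int (walk_size p)"
      unfolding zmod_int of_nat_add n by (simp add: mod_simps algebra_simps)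
    also have "trail p ((j + (int i - j')) mod int (walk_size p)) = trail p' (j' + (int i - j'))"
      unfolding trail_mod[OF p(1)] by (rule trail_shift[OF p eq])
    also have "fst (trail p' (j' + (int i - j'))) = walk p' ! i"
      using i by (simp add: trail_def walk_def sizes)
    finally show "walk p' ! i = rotate n (walk p) ! i" by simp
  qed (simp add: sizes)
  then show ?thesis by (simp add: circuit_rotate)
qed

lemma fst_trail: "fst (trail p j) = pos p j" by (simp add: trail_def)

lemma tip_trail:
  assumes "p \<in> starts"
  shows "tip (trail p j) = pos p (j + 1)"
  unfolding fst_trail[symmetric] trail_Suc[OF assms] next_step_def by simp

section \<open>Steps as the edges of the complete graph\<close>

definition ends :: "int \<times> int \<Rightarrow> int set" where "ends a = {fst a, tip a}"

lemma walk_edges_walk: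
  assumes p: "p \<in> starts"
  shows "walk_edges (walk p) = map (\<lambda>j. ends (trail p (int j))) [0..<walk_size p]"
proof (rule nth_equalityI)
  fix j assume "j < length (walk_edges (walk p))"
  then have j: "j < walk_size p" by simp
  have "walk p ! (Suc j mod walk_size p) = pos p (int (Suc j mod walk_size p))"
    using walk_size_pos[OF p] by (simp add: walk_def)
  also have "\<dots> = fst (trail p ((int j + 1) mod int (walk_size p)))"
    by (simp add: fst_trail zmod_int add.commute)
  also have "\<dots> = tip (trail p (int j))" unfolding trail_mod[OF p] tip_trail[OF p] fst_trail ..
  finally show "walk_edges (walk p) ! j = map (\<lambda>j. ends (trail p (int j))) [0..<walk_size p] ! j"
    using j by (simp add: walk_edges_def ends_def fst_trail) (simp add: walk_def)
qed simp

lemma set_walk_edges_walk: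
  assumes p: "p \<in> starts"
  shows "set (walk_edges (walk p)) = range (\<lambda>j. ends (trail p j))"
proof
  show "set (walk_edges (walk p)) \<subseteq> range (\<lambda>j. ends (trail p j))"
    unfolding walk_edges_walk[OF p] by auto
  show "range (\<lambda>j. ends (trail p j)) \<subseteq> set (walk_edges (walk p))"
  proof
    fix e assume "e \<in> range (\<lambda>j. ends (trail p j))"
    then obtain j where j: "e = ends (trail p (j mod int (walk_size p)))" using trail_mod[OF p] by auto
    let ?i = "nat (j mod int (walk_size p))"
    have "e = ends (trail p (int ?i))" "?i < walk_size p"
      using j walk_size_pos[OF p] by (simp_all add: nat_less_iff)
    then show "e \<in> set (walk_edges (walk p))"
      unfolding walk_edges_walk[OF p] set_map set_upt by (intro image_eqI[of _ _ ?i]) simp_all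
  qed
qed

lemma tip_range: "0 \<le> tip a" "tip a < v" using v_pos by (simp_all add: tip_def)

lemma tip_neq:
  assumes "a \<in> steps"
  shows "fst a \<noteq> tip a"
proof
  assume "fst a = tip a"
  then have "fst a mod v = (fst a + snd a) mod v" using assms by (auto simp: tip_def steps_def)
  then have "v dvd snd a" by (simp add: mod_eq_dvd_iff)
  moreover have "0 < snd a" "snd a < v" using assms T_range by (auto simp: steps_def)
  ultimately show False using zdvd_not_zless by blast
qed

text \<open>Steps in opposite directions along an edge have differences adding up to 0 modulo
  \<open>v\<close>, which \<open>asymmetric\<close> forbids. In the same direction the differences
  are congruent and lie between 0 and \<open>v\<close>, hence equal.\<close>

lemma ends_inj:
  assumes a: "a \<in> steps" "b \<in> steps" and eq: "ends a = ends b"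
  shows "a = b"
proof -
  have ra: "0 \<le> fst a" "fst a < v" "snd a \<in> T" "0 \<le> fst b" "fst b < v" "snd b \<in> T"
    using a by (auto simp: steps_def)
  have rT: "0 < snd a" "snd a < v" "0 < snd b" "snd b < v" using ra T_range by auto
  have "(fst a = fst b \<and> tip a = tip b) \<or> (fst a = tip b \<and> tip a = fst b)"
    using eq by (auto simp: ends_def doubleton_eq_iff)
  then show ?thesis
  proof
    assume *: "fst a = fst b \<and> tip a = tip b"
    then have "v dvd snd a - snd b" unfolding tip_def by (auto simp: mod_eq_dvd_iff)
    moreover have "\<bar>snd a - snd b\<bar> < v" using rT by linarith
    ultimately have "snd a = snd b" using dvd_imp_le_int[of "snd a - snd b" v] by fastforce
    then show ?thesis using * by (simp add: prod_eq_iff)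
  next
    assume *: "fst a = tip b \<and> tip a = fst b"
    have "tip a = (tip b + snd a) mod v" using * by (simp add: tip_def)
    also have "\<dots> = (fst b + (snd a + snd b)) mod v" by (simp add: tip_def mod_simps algebra_simps)
    finally have "fst b mod v = (fst b + (snd a + snd b)) mod v" using * ra by simp
    then have "v dvd (fst b + (snd a + snd b)) - fst b" unfolding mod_eq_dvd_iff[symmetric] by (rule sym)
    then have "v dvd snd a + snd b" by simp
    then show ?thesis using asymmetric[OF ra(3,6)] by simp
  qed
qed

lemma ends_image: "ends ` steps = complete_edges {0..<v}"
proof
  show "ends ` steps \<subseteq> complete_edges {0..<v}"
  proof
    fix e assume "e \<in> ends ` steps"
    then obtain a where a: "a \<in> steps" "e = ends a" by blast
    have "fst a \<in> {0..<v}" "tip a \<in> {0..<v}"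
      using a(1) tip_range[of a] by (simp_all add: steps_def mem_Times_iff)
    then show "e \<in> complete_edges {0..<v}"
      unfolding complete_edges_def a(2) ends_def using tip_neq[OF a(1)] by blast
  qed
  show "complete_edges {0..<v} \<subseteq> ends ` steps"
  proof
    fix e assume "e \<in> complete_edges {0..<v}"
    then obtain x y where xy: "e = {x, y}" "0 \<le> x" "x < v" "0 \<le> y" "y < v" "x \<noteq> y"
      by (auto simp: complete_edges_def)
    have "(y - x) mod v \<noteq> 0"
    proof
      assume "(y - x) mod v = 0"
      then have "y mod v = x mod v" by (simp add: mod_eq_dvd_iff mod_0_imp_dvd)
      then show False using xy by simp
    qed
    moreover have "0 \<le> (y - x) mod v" "(y - x) mod v < v" using v_pos by auto
    ultimately have "(y - x) mod v \<in> T \<or> v - (y - x) mod v \<in> T" using exhaustive by simp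
    then show "e \<in> ends ` steps"
    proof
      assume t: "(y - x) mod v \<in> T"
      have "e = ends (x, (y - x) mod v)" using xy by (simp add: ends_def tip_def mod_simps)
      then show ?thesis using t xy by (auto simp: steps_def)
    next
      assume t: "v - (y - x) mod v \<in> T"
      have "(y + (v - (y - x) mod v)) mod v = (y - (y - x) mod v + v) mod v" by (simp add: algebra_simps)
      also have "\<dots> = (y - (y - x)) mod v" unfolding mod_add_self2 by (simp add: mod_simps)
      finally have "e = ends (y, v - (y - x) mod v)" using xy by (auto simp: ends_def tip_def)
      then show ?thesis using t xy by (auto simp: steps_def)
    qed
  qed
qed

lemma trail_exists:
  assumes "a \<in> steps"
  obtains p j where "p \<in> starts" "trail p j = a"
proof -
  have "snd a \<in> T" using assms by (simp add: steps_def mem_Times_iff)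
  then obtain i where i: "i < l" "snd a \<in> set (\<omega> i)" unfolding T_eq by blast
  then obtain k where k: "k < length (\<omega> i)" "\<omega> i ! k = snd a" by (auto simp: in_set_conv_nth)
  \<comment> \<open>The start is chosen so that the partial sum in front of the entry leads to
    \<open>fst a\<close>.\<close>
  define p where "p = (i, (fst a - sum_list (take k (\<omega> i))) mod v)"
  have "p \<in> starts" using i v_pos by (simp add: p_def starts_def)
  moreover have "trail p (int k) = a" using k assms
    by (simp add: trail_def pos_def Let_def p_def prod_eq_iff mod_simps steps_def mem_Times_iff)
  ultimately show ?thesis by (rule that)
qed

section \<open>The circuit decomposition of an ordering\<close>

text \<open>The translates chained in \<open>path_circuit\<close> are the rounds of the trail.
  \<open>hd P\<close> and \<open>last P\<close> are reduced, so their difference is the ordering sum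
  only modulo \<open>v\<close>; this suffices, because \<open>translate\<close> reduces
  again.\<close>

lemma path_circuit_eq:
  assumes p: "p \<in> starts"
  shows "path_circuit v (translate v (snd p) (partial_sums (\<omega> (fst p)))) = circuit (walk p)"
proof -
  define ts where "ts = \<omega> (fst p)"
  define P where "P = translate v (snd p) (partial_sums ts)"
  have k: "0 < length ts" using length_pos[OF p] by (simp add: ts_def)
  have nthP: "P ! j = (sum_list (take j ts) + snd p) mod v" if "j \<le> length ts" for j
    using that by (simp add: P_def translate_def partial_sums_def del: upt_Suc)
  have lenP: "length P = Suc (length ts)" by (simp add: P_def translate_def)
  then have ne: "P \<noteq> []" by auto
  have hd: "hd P = snd p mod v" using nthP[of 0] ne by (simp add: hd_conv_nth)
  have last: "last P = (ordering_sum (fst p) + snd p) mod v"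
    using nthP[of "length ts"] lenP ne by (simp add: last_conv_nth ordering_sum_def ts_def)
  have diff: "(c * (last P - hd P)) mod v = (c * ordering_sum (fst p)) mod v" for c
    unfolding hd last
    by (subst (1 2) mod_mult_right_eq[symmetric]) (simp only: mod_diff_eq add_diff_cancel_right')
  have per: "path_period v P = period (fst p)" unfolding path_period_def period_def diff ..
  have "concat (map (\<lambda>i. translate v (int i * (last P - hd P)) (butlast P)) [0..<period (fst p)]) =
      map (\<lambda>j. translate v (int (j div length ts) * (last P - hd P)) (butlast P) ! (j mod length ts))
        [0..<period (fst p) * length ts]"
    using k by (intro concat_map_upt_const_length) (simp_all add: translate_def lenP)
  also have "\<dots> = walk p"
  proof (rule nth_equalityI)
    fix j assume "j < length (map (\<lambda>j. translate v (int (j div length ts) * (last P - hd P)) (butlast P) ! (j mod length ts))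
        [0..<period (fst p) * length ts])"
    then have j: "j < period (fst p) * length ts" by simp
    have m: "j mod length ts < length ts" using k by simp
    have "translate v (int (j div length ts) * (last P - hd P)) (butlast P) ! (j mod length ts) =
       (P ! (j mod length ts) + int (j div length ts) * (last P - hd P)) mod v"
      using m lenP by (simp add: translate_def nth_butlast)
    also have "\<dots> = (P ! (j mod length ts) + (int (j div length ts) * (last P - hd P)) mod v) mod v"
      by (simp add: mod_simps)
    also have "\<dots> = pos p (int j)"
      unfolding diff nthP[OF less_imp_le[OF m]] pos_def Let_def ts_def[symmetric]
      by (simp add: mod_simps zdiv_int[symmetric] zmod_int[symmetric] algebra_simps)
    finally show "map (\<lambda>j. translate v (int (j div length ts) * (last P - hd P)) (butlast P) ! (j mod length ts))
        [0..<period (fst p) * length ts] ! j = walk p ! j"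
      using j by (simp add: walk_def walk_size_def ts_def)
  qed (simp add: walk_size_def ts_def)
  finally show ?thesis unfolding path_circuit_def per ts_def[symmetric] P_def[symmetric] by simp
qed

definition circuits :: "int list set set" where
  "circuits = circuits_of v (path_decomposition v l \<omega>)"

lemma circuits_eq: "circuits = (\<lambda>p. circuit (walk p)) ` starts"
proof -
  have "path_decomposition v l \<omega> =
      (\<lambda>p. translate v (snd p) (partial_sums (\<omega> (fst p)))) ` starts"
  proof (intro set_eqI iffI)
    fix P assume "P \<in> path_decomposition v l \<omega>"
    then obtain a i where "P = translate v a (partial_sums (\<omega> i))" "a \<in> {0..<v}" "i < l"
      unfolding path_decomposition_def by blast
    then show "P \<in> (\<lambda>p. translate v (snd p) (partial_sums (\<omega> (fst p)))) ` starts"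
      by (intro image_eqI[of _ _ "(i, a)"]) (simp_all add: starts_def)
  next
    fix P assume "P \<in> (\<lambda>p. translate v (snd p) (partial_sums (\<omega> (fst p)))) ` starts"
    then obtain p where "p \<in> starts" "P = translate v (snd p) (partial_sums (\<omega> (fst p)))" by blast
    moreover from this have "snd p \<in> {0..<v}" "fst p < l" by (simp_all add: starts_def mem_Times_iff)
    ultimately show "P \<in> path_decomposition v l \<omega>" unfolding path_decomposition_def by blast
  qed
  then have "circuits = (\<lambda>p. path_circuit v (translate v (snd p) (partial_sums (\<omega> (fst p))))) ` starts"
    by (simp add: circuits_def circuits_of_def image_image)
  then show ?thesis using path_circuit_eq by (simp cong: image_cong)
qed

lemma finite_circuits: "finite circuits" unfolding circuits_eq starts_def by simp

text \<open>Different starts may yield one circuit, which counts once in \<open>circuits\<close>.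
  Equal circuits have a common edge, and by \<open>ends_inj\<close> a common edge is a common
  step.\<close>

lemma circuit_walk_eq_iff:
  assumes "p \<in> starts" "p' \<in> starts"
  shows "circuit (walk p) = circuit (walk p') \<longleftrightarrow> (\<exists>j j'. trail p j = trail p' j')"
proof
  assume eq: "circuit (walk p) = circuit (walk p')"
  have "walk p \<in> circuit (walk p')" using circuit_self[of "walk p"] eq by simp
  then have "range (\<lambda>j. ends (trail p j)) = range (\<lambda>j. ends (trail p' j))"
    using set_walk_edges_circuit set_walk_edges_walk[OF assms(1)] set_walk_edges_walk[OF assms(2)] by metis
  then have "ends (trail p 0) \<in> range (\<lambda>j. ends (trail p' j))" by blast
  then obtain j' where "ends (trail p 0) = ends (trail p' j')" by blast
  then have "trail p 0 = trail p' j'" using ends_inj trail_in_steps assms by blast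
  then show "\<exists>j j'. trail p j = trail p' j'" by blast
qed (use circuit_walk_cong[OF assms] in blast)

lemma circuit_decomposition_circuits: "circuit_decomposition (complete_edges {0..<v}) circuits"
  unfolding circuit_decomposition_def
proof (intro conjI ballI)
  fix C assume "C \<in> circuits"
  then obtain p where p: "p \<in> starts" "C = circuit (walk p)" by (auto simp: circuits_eq)
  have "closed_trail (complete_edges {0..<v}) (walk p)" unfolding closed_trail_def
  proof (intro conjI)
    show "walk p \<noteq> []" using walk_size_pos[OF p(1)] length_walk[of p] by (metis less_irrefl list.size(3))
    show "set (walk_edges (walk p)) \<subseteq> complete_edges {0..<v}"
      unfolding set_walk_edges_walk[OF p(1)] ends_image[symmetric] using trail_in_steps[OF p(1)] by auto
    show "distinct (walk_edges (walk p))" unfolding walk_edges_walk[OF p(1)] distinct_map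
    proof (intro conjI inj_onI)
      fix i j assume ij: "i \<in> set [0..<walk_size p]" "j \<in> set [0..<walk_size p]"
        "ends (trail p (int i)) = ends (trail p (int j))"
      then have "trail p (int i) = trail p (int j)" using ends_inj trail_in_steps[OF p(1)] by blast
      then have "int i mod int (walk_size p) = int j mod int (walk_size p)"
        using trail_eqD(2)[OF p(1) p(1)] by blast
      then show "i = j" using ij by simp
    qed simp
  qed
  then show "\<exists>c. C = circuit c \<and> closed_trail (complete_edges {0..<v}) c" using p(2) by blast
next
  fix e assume "e \<in> complete_edges {0..<v}"
  then obtain a where a: "a \<in> steps" "e = ends a" unfolding ends_image[symmetric] by blast
  obtain p j where p: "p \<in> starts" "trail p j = a" using trail_exists[OF a(1)] .
  show "\<exists>!C. C \<in> circuits \<and> (\<exists>c\<in>C. e \<in> set (walk_edges c))"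
  proof (rule ex1I[of _ "circuit (walk p)"])
    have "e \<in> set (walk_edges (walk p))"
      unfolding set_walk_edges_walk[OF p(1)] a(2) p(2)[symmetric] by blast
    then show "circuit (walk p) \<in> circuits \<and> (\<exists>c\<in>circuit (walk p). e \<in> set (walk_edges c))"
      using circuit_self p(1) unfolding circuits_eq by blast
  next
    fix C assume C: "C \<in> circuits \<and> (\<exists>c\<in>C. e \<in> set (walk_edges c))"
    then obtain p' where p': "p' \<in> starts" "C = circuit (walk p')" by (auto simp: circuits_eq)
    have "e \<in> set (walk_edges (walk p'))" using C p'(2) set_walk_edges_circuit by blast
    then obtain j' where "ends a = ends (trail p' j')"
      unfolding set_walk_edges_walk[OF p'(1)] a(2) by blast
    then have "trail p j = trail p' j'" using ends_inj a(1) trail_in_steps[OF p'(1)] p(2) by blast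
    then show "C = circuit (walk p)" using circuit_walk_cong[OF p(1) p'(1)] p'(2) by simp
  qed
qed

text \<open>Faces are to be numbered and to carry a parametrized walk, so the circuits are
  enumerated and one start is chosen for each.\<close>

definition rep :: "nat \<Rightarrow> nat \<times> int" where
  "rep f = (SOME p. p \<in> starts \<and> circuit (walk p) = from_nat_into circuits f)"

lemma rep:
  assumes "f < card circuits"
  shows "rep f \<in> starts" "circuit (walk (rep f)) = from_nat_into circuits f"
proof -
  have "from_nat_into circuits f \<in> circuits" using assms by (intro from_nat_into) auto
  then have "\<exists>p. p \<in> starts \<and> circuit (walk p) = from_nat_into circuits f"
    unfolding circuits_eq by blast
  then have "rep f \<in> starts \<and> circuit (walk (rep f)) = from_nat_into circuits f"
    unfolding rep_def by (rule someI_ex)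
  then show "rep f \<in> starts" "circuit (walk (rep f)) = from_nat_into circuits f" by auto
qed

lemma bij_rep: "bij_betw (\<lambda>f. circuit (walk (rep f))) {..<card circuits} circuits"
  using bij_betw_from_nat_into_finite[OF finite_circuits] rep(2)
  by (subst bij_betw_cong[where g = "from_nat_into circuits"]) auto

lemma rep_exists:
  assumes "a \<in> steps"
  obtains f j where "f < card circuits" "trail (rep f) j = a"
proof -
  obtain p j where p: "p \<in> starts" "trail p j = a" using trail_exists[OF assms] .
  then have "circuit (walk p) \<in> circuits" unfolding circuits_eq by blast
  then have "circuit (walk p) \<in> (\<lambda>f. circuit (walk (rep f))) ` {..<card circuits}"
    using bij_betw_imp_surj_on[OF bij_rep] by simp
  then obtain f where f: "f < card circuits" "circuit (walk (rep f)) = circuit (walk p)" by force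
  then obtain i i' where eq: "trail (rep f) i = trail p i'"
    using circuit_walk_eq_iff[OF rep(1)[OF f(1)] p(1)] by blast
  have "trail (rep f) (i + (j - i')) = trail p (i' + (j - i'))"
    by (rule trail_shift[OF rep(1)[OF f(1)] p(1) eq])
  then show ?thesis using that f(1) p(2) by simp
qed

lemma rep_eqD:
  assumes "f < card circuits" "f' < card circuits" "trail (rep f) j = trail (rep f') j'"
  shows "f = f' \<and> j mod int (walk_size (rep f)) = j' mod int (walk_size (rep f))"
proof -
  have "circuit (walk (rep f)) = circuit (walk (rep f'))"
    using circuit_walk_cong[OF rep(1)[OF assms(1)] rep(1)[OF assms(2)] assms(3)] .
  then have ff: "f = f'" using bij_rep assms(1,2) by (auto simp: bij_betw_def dest: inj_onD)
  then show ?thesis using trail_eqD(2)[OF rep(1)[OF assms(1)] rep(1)[OF assms(2)] assms(3)] by simp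
qed

end

section \<open>Heffter arrays\<close>

text \<open>Faces numbered below \<open>N1\<close> are black, the others white. The rotation at a
  vertex acts on differences alone, \<open>(x, t)\<close> going to \<open>(x, \<sigma> t)\<close>,
  so the single cycle \<open>\<sigma>\<close> on \<open>T\<close> is copied at every vertex.\<close>

lemma biembedding_of_orderings:
  assumes "ordering_system v T l1 \<omega>1" and "ordering_system v T l2 \<omega>2"
    and \<sigma>: "\<And>t. t \<in> T \<Longrightarrow> \<sigma> (ordering_perm l1 \<omega>1 t) = ordering_perm l2 \<omega>2 t"
    and cyc: "cyclic_on \<sigma> T"
  shows "\<exists>(S :: complex topology) \<psi>. surface S \<and> orientable S \<and>
     biembedding {0..<v} (complete_edges {0..<v})
       (circuits_of v (path_decomposition v l1 \<omega>1)) (circuits_of v (path_decomposition v l2 \<omega>2)) S \<psi> \<and>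
     cellular {0..<v} (complete_edges {0..<v}) S \<psi>"
proof -
  interpret R: ordering_system v T l1 \<omega>1 by fact
  interpret C: ordering_system v T l2 \<omega>2 by fact
  define N1 N2 where "N1 = card R.circuits" and "N2 = card C.circuits"
  define len where "len = (\<lambda>f. if f < N1 then R.walk_size (R.rep f) else C.walk_size (C.rep (f - N1)))"
  define arc where "arc = (\<lambda>f. if f < N1 then R.trail (R.rep f) else C.trail (C.rep (f - N1)))"
  define black where "black = (\<lambda>f. f < N1)"
  define succ where "succ = (\<lambda>c. if c then R.next_step else C.next_step)"
  define rot where "rot = (\<lambda>a :: int \<times> int. (fst a, \<sigma> (snd a)))"
  have rep1: "R.rep f \<in> R.starts" if "f < N1" for f using R.rep(1) that by (simp add: N1_def)
  have rep2: "C.rep (f - N1) \<in> C.starts" if "f < N1 + N2" "\<not> f < N1" for f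
    using C.rep(1)[of "f - N1"] that by (simp add: N2_def)
  have T: "finite T" "T \<noteq> {}" using finite_subset[OF R.T_range] cyc by (auto simp: cyclic_on_alldef)
  interpret face_system R.steps fst R.tip "N1 + N2" len arc black succ rot
  proof
    show "finite R.steps" unfolding R.steps_def using T by simp
    fix f assume f: "f < N1 + N2"
    show "0 < len f" using R.walk_size_pos rep1 C.walk_size_pos rep2[OF f] by (simp add: len_def)
    show "arc f j \<in> R.steps" for j
      using R.trail_in_steps[OF rep1] C.trail_in_steps[OF rep2[OF f]] by (simp add: arc_def)
    show "arc f (j + int (len f)) = arc f j" for j
      using R.trail_period[OF rep1] C.trail_period[OF rep2[OF f]] by (simp add: arc_def len_def)
    show "arc f (j + 1) = succ (black f) (arc f j)" for j
      using R.trail_Suc[OF rep1] C.trail_Suc[OF rep2[OF f]]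
      by (simp add: arc_def succ_def black_def)
    fix f' i j assume f': "f' < N1 + N2" and same: "black f = black f'" and eq: "arc f i = arc f' j"
    show "f = f' \<and> i mod int (len f) = j mod int (len f)"
    proof (cases "f < N1")
      case True
      then have "f' < N1" using same by (simp add: black_def)
      then have "R.trail (R.rep f) i = R.trail (R.rep f') j" using eq True by (simp add: arc_def)
      then have "f = f' \<and> i mod int (R.walk_size (R.rep f)) = j mod int (R.walk_size (R.rep f))"
        using True \<open>f' < N1\<close> unfolding N1_def by (intro R.rep_eqD)
      moreover from this have "f = f'" by blast
      ultimately show ?thesis using True unfolding len_def by simp
    next
      case False
      then have "\<not> f' < N1" using same by (simp add: black_def)
      then have "C.trail (C.rep (f - N1)) i = C.trail (C.rep (f' - N1)) j"
        using eq False by (simp add: arc_def)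
      then have "f - N1 = f' - N1 \<and>
          i mod int (C.walk_size (C.rep (f - N1))) = j mod int (C.walk_size (C.rep (f - N1)))"
        using False \<open>\<not> f' < N1\<close> f f' unfolding N2_def by (intro C.rep_eqD) linarith+
      moreover from this have "f = f'" using False \<open>\<not> f' < N1\<close> by linarith
      ultimately show ?thesis using False unfolding len_def by simp
    qed
  next
    fix a c assume a: "a \<in> R.steps"
    show "\<exists>f j. f < N1 + N2 \<and> black f = c \<and> arc f j = a"
    proof (cases c)
      case True
      obtain f j where "f < card R.circuits" "R.trail (R.rep f) j = a" using R.rep_exists[OF a] .
      then show ?thesis using True by (intro exI[of _ f] exI[of _ j]) (simp add: N1_def black_def arc_def)
    next
      case False
      obtain f j where "f < card C.circuits" "C.trail (C.rep f) j = a" using C.rep_exists[OF a] .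
      then show ?thesis
        using False by (intro exI[of _ "N1 + f"] exI[of _ j]) (simp add: N2_def black_def arc_def)
    qed
    show "fst (succ c a) = R.tip a" by (simp add: succ_def R.next_step_def C.next_step_def)
    show "fst a \<noteq> R.tip a" by (rule R.tip_neq[OF a])
    show "rot (succ True a) = succ False a"
      using a \<sigma> by (simp add: rot_def succ_def R.next_step_def C.next_step_def R.steps_def mem_Times_iff)
    fix b assume "b \<in> R.steps" "{fst a, R.tip a} = {fst b, R.tip b}"
    then show "a = b" using R.ends_inj[OF a] by (simp add: R.ends_def)
  next
    fix x assume x: "x \<in> fst ` R.steps"
    have "x \<in> {0..<v}" using x T(2) by (simp add: R.steps_def)
    then have "{a \<in> R.steps. fst a = x} = Pair x ` T" by (auto simp: R.steps_def)
    moreover have "cyclic_on rot (Pair x ` T)"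
      using cyc by (rule cyclic_on_image) (simp add: rot_def)
    ultimately show "cyclic_on rot {a \<in> R.steps. fst a = x}" by simp
  qed
  have V: "V = {0..<v}" unfolding V_def unfolding R.steps_def using T(2) by simp
  have E: "E = complete_edges {0..<v}"
    unfolding E_def R.ends_image[symmetric] R.ends_def[abs_def] ..
  have walk1: "face_walk f = R.walk (R.rep f)" if "f < N1" for f
  proof -
    have "len f = R.walk_size (R.rep f)" "arc f = R.trail (R.rep f)"
      using that by (simp_all add: arc_def len_def)
    then show ?thesis unfolding face_walk_def R.walk_def by (simp only: R.fst_trail)
  qed
  have walk2: "face_walk f = C.walk (C.rep (f - N1))" if "\<not> f < N1" for f
  proof -
    have "len f = C.walk_size (C.rep (f - N1))" "arc f = C.trail (C.rep (f - N1))"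
      using that by (simp_all add: arc_def len_def)
    then show ?thesis unfolding face_walk_def C.walk_def by (simp only: C.fst_trail)
  qed
  have "bij_betw (\<lambda>f. circuit (face_walk f)) {f. f < N1 + N2 \<and> black f} R.circuits"
  proof -
    have "{f. f < N1 + N2 \<and> black f} = {..<N1}" by (auto simp: black_def)
    moreover have "bij_betw (\<lambda>f. circuit (face_walk f)) {..<N1} R.circuits"
      using R.bij_rep walk1 unfolding N1_def[symmetric]
      by (subst bij_betw_cong[where g = "\<lambda>f. circuit (R.walk (R.rep f))"]) auto
    ultimately show ?thesis by simp
  qed
  moreover have "bij_betw (\<lambda>f. circuit (face_walk f)) {f. f < N1 + N2 \<and> \<not> black f} C.circuits"
  proof -
    have "bij_betw (\<lambda>f. f - N1) {N1..<N1 + N2} {..<N2}"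
      by (rule bij_betwI[where g = "\<lambda>f. f + N1"]) auto
    then have "bij_betw ((\<lambda>f. circuit (C.walk (C.rep f))) \<circ> (\<lambda>f. f - N1)) {N1..<N1 + N2} C.circuits"
      using C.bij_rep unfolding N2_def[symmetric] by (rule bij_betw_trans)
    moreover have "{f. f < N1 + N2 \<and> \<not> black f} = {N1..<N1 + N2}" by (auto simp: black_def)
    ultimately show ?thesis
      using walk2 by (subst bij_betw_cong[where g = "(\<lambda>f. circuit (C.walk (C.rep f))) \<circ> (\<lambda>f. f - N1)"]) auto
  qed
  ultimately have "biembedding V E R.circuits C.circuits S graph_map"
    using R.circuit_decomposition_circuits C.circuit_decomposition_circuits
    by (intro biembedding_S) (simp_all add: E)
  moreover have "surface S" by (intro surface_S connected_realization) (simp add: E V)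
  ultimately show ?thesis using orientable_S cellular_graph_map
    unfolding V E R.circuits_def C.circuits_def by blast
qed

section \<open>From Heffter arrays to ordering systems\<close>

lemma finite_filled_cells: "finite (filled_cells m n A)"
proof (rule finite_subset)
  show "filled_cells m n A \<subseteq> {..<m} \<times> {..<n}" by (auto simp: filled_cells_def)
qed simp

lemma NH_card:
  assumes "NH m n h k A" and v: "v = 2 * int n * int k + 1" and z: "0 < z" "z < v"
  shows "card {c \<in> filled_cells m n A. entry A c = z} +
    card {c \<in> filled_cells m n A. (- entry A c) mod v = z} = 1"
proof -
  let ?C = "filled_cells m n A"
  have "count (\<Sum>c\<in>?C. {# entry A c, (- entry A c) mod v #}) z = 1"
    using assms by (simp add: NH_def Let_def)
  moreover have "count {# a, b #} z = of_bool (a = z) + of_bool (b = z)" for a b :: int by simp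
  ultimately have "(\<Sum>c\<in>?C. of_bool (entry A c = z) + of_bool ((- entry A c) mod v = z)) = (1 :: nat)"
    by (simp only: count_sum)
  then show ?thesis using finite_filled_cells by (simp add: sum.distrib sum_of_bool_eq Int_def)
qed

text \<open>The counting condition concerns non-zero residues, so a zero entry is excluded by other
  means: in a simple ordering the sublist \<open>[0]\<close> cannot be proper, so the row ordering
  would be \<open>[0]\<close>, and then the row sum would be 0.\<close>

lemma NH_nonzero:
  assumes NH: "NH m n h k A" and v: "v = 2 * int n * int k + 1"
    and simple: "simple_row_orderings v m n A \<omega>"
  shows "0 \<notin> entries m n A"
proof
  assume "0 \<in> entries m n A"
  then obtain c where c: "c \<in> filled_cells m n A" "entry A c = 0" by (auto simp: entries_def)
  define i where "i = fst c"
  have i: "i < m" "c \<in> row_cells m n A i"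
    using c(1) by (auto simp: i_def filled_cells_def row_cells_def)
  have ord: "simple_ordering v (entry A ` row_cells m n A i) (\<omega> i)"
    using simple i(1) by (simp add: simple_row_orderings_def)
  have "0 \<in> set (\<omega> i)" using ord i(2) c(2) by (force simp: simple_ordering_def)
  then obtain ps ss where "\<omega> i = ps @ [0] @ ss" by (auto dest: split_list)
  then have "sublist [0] (\<omega> i)" by (simp only: sublist_appendI)
  then have "\<omega> i = [0]" using ord by (fastforce simp: simple_ordering_def)
  then have "entry A ` row_cells m n A i = {0}" using ord by (simp add: simple_ordering_def)
  then have "\<forall>c\<in>row_cells m n A i. entry A c = 0" by auto
  then have "(\<Sum>c\<in>row_cells m n A i. entry A c) = 0" by (rule sum.neutral)
  moreover have "(\<Sum>c\<in>row_cells m n A i. entry A c) mod v \<noteq> 0"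
    using NH i(1) v by (simp add: NH_def Let_def)
  ultimately show False by simp
qed

text \<open>\<open>P\<close> stands for the rows or for the columns. Every non-zero residue is
  counted once: a repeated entry, or an entry that is the negative of an entry, would be counted
  twice, and a residue that is neither an entry nor the negative of one would not be
  counted.\<close>

lemma ordering_system_NH:
  assumes NH: "NH m n h k A" and v: "v = 2 * int n * int k + 1" and nz: "0 \<notin> entries m n A"
    and ord: "\<And>i. i < l \<Longrightarrow> distinct (\<omega> i) \<and> set (\<omega> i) = entry A ` P i"
    and P: "\<And>i. i < l \<Longrightarrow> P i \<noteq> {}" "\<And>i j. i < l \<Longrightarrow> j < l \<Longrightarrow> i \<noteq> j \<Longrightarrow> P i \<inter> P j = {}"
      "(\<Union>i<l. P i) = filled_cells m n A"
  shows "ordering_system v (entries m n A) l \<omega>"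
proof
  let ?C = "filled_cells m n A"
  note card = NH_card[OF NH v]
  have sub: "entries m n A \<subseteq> {0..<v}" using NH v by (simp add: NH_def Let_def)
  show range: "entries m n A \<subseteq> {0<..<v}"
  proof (intro subsetI)
    fix x assume "x \<in> entries m n A"
    then have "x \<in> {0..<v}" "x \<noteq> 0" using sub nz by blast+
    then show "x \<in> {0<..<v}" by simp
  qed
  have fin: "finite {c \<in> ?C. Q c}" for Q using finite_filled_cells by simp
  have inj: "inj_on (entry A) ?C"
  proof (rule inj_onI, rule ccontr)
    fix c c' assume c: "c \<in> ?C" "c' \<in> ?C" "entry A c = entry A c'" "c \<noteq> c'"
    have "0 < entry A c" "entry A c < v" using range c(1) by (auto simp: entries_def)
    then have "card {d \<in> ?C. entry A d = entry A c} \<le> 1" using card by force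
    moreover have "card {c, c'} \<le> card {d \<in> ?C. entry A d = entry A c}"
      using c by (intro card_mono fin) auto
    ultimately show False using c(4) by simp
  qed
  have sets: "set (\<omega> i) = entry A ` P i" if "i < l" for i using ord[OF that] by blast
  have "entries m n A = entry A ` (\<Union>i<l. P i)" unfolding P(3) entries_def ..
  then show "entries m n A = (\<Union>i<l. set (\<omega> i))" using sets by auto
  show "distinct (\<omega> i)" if "i < l" for i using ord[OF that] by blast
  show "set (\<omega> i) \<inter> set (\<omega> j) = {}" if ij: "i < l" "j < l" "i \<noteq> j" for i j
  proof -
    have "P i \<subseteq> ?C" "P j \<subseteq> ?C" using ij P(3) by auto
    then have "entry A ` P i \<inter> entry A ` P j = entry A ` (P i \<inter> P j)"
      using inj_on_image_Int[OF inj] by simp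
    then show ?thesis using P(2)[OF ij] sets ij by simp
  qed
  show "\<omega> i \<noteq> []" if "i < l" for i using sets[OF that] P(1)[OF that] by auto
  show "(t + t') mod v \<noteq> 0" if t: "t \<in> entries m n A" "t' \<in> entries m n A" for t t'
  proof
    assume 0: "(t + t') mod v = 0"
    obtain c c' where c: "c \<in> ?C" "t = entry A c" "c' \<in> ?C" "t' = entry A c'"
      using t by (auto simp: entries_def)
    have tr: "0 < t" "t < v" using range t(1) by auto
    have "v dvd t + t'" using 0 by auto
    then have "v dvd - (t + t')" by (simp only: dvd_minus_iff)
    moreover have "- (t + t') = - t' - t" by simp
    ultimately have "v dvd - t' - t" by (simp only:)
    then have "(- t') mod v = t mod v" by (simp add: mod_eq_dvd_iff)
    then have "(- t') mod v = t" using tr by simp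
    then have "c' \<in> {d \<in> ?C. (- entry A d) mod v = t}" "c \<in> {d \<in> ?C. entry A d = t}" using c by auto
    then have "{d \<in> ?C. (- entry A d) mod v = t} \<noteq> {}" "{d \<in> ?C. entry A d = t} \<noteq> {}" by blast+
    then have "0 < card {d \<in> ?C. (- entry A d) mod v = t}" "0 < card {d \<in> ?C. entry A d = t}"
      unfolding card_gt_0_iff using fin by simp_all
    then show False using card[OF tr] by linarith
  qed
  show "z \<in> entries m n A \<or> v - z \<in> entries m n A" if z: "0 < z" "z < v" for z
  proof -
    have "card {c \<in> ?C. entry A c = z} \<noteq> 0 \<or> card {c \<in> ?C. (- entry A c) mod v = z} \<noteq> 0"
      using card[OF z] by linarith
    then consider c where "c \<in> ?C" "entry A c = z" | c where "c \<in> ?C" "(- entry A c) mod v = z"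
      by (metis (mono_tags, lifting) card.empty empty_Collect_eq)
    then show ?thesis
    proof cases
      case 1 then show ?thesis by (auto simp: entries_def)
    next
      case 2
      have e: "entry A c \<in> entries m n A" using 2(1) by (simp add: entries_def)
      then have "0 < entry A c" "entry A c < v" using range by auto
      then have "(- entry A c) mod v = v - entry A c" by (simp add: zmod_zminus1_eq_if)
      then have "v - z = entry A c" using 2(2) by simp
      then show ?thesis using e by simp
    qed
  qed
  show "0 < v" using v by simp
qed

lemma ordering_perm_reverse:
  assumes "ordering_system v T l \<omega>" "ordering_system v T l (reverse_ordering \<omega>)" "t \<in> T"
  shows "ordering_perm l \<omega> (ordering_perm l (reverse_ordering \<omega>) t) = t"
proof -
  interpret A: ordering_system v T l \<omega> by fact
  interpret B: ordering_system v T l "reverse_ordering \<omega>" by fact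
  obtain i where i: "i < l" "t \<in> set (reverse_ordering \<omega> i)" using assms(3) B.T_eq by blast
  define ts where "ts = \<omega> i"
  have rev: "reverse_ordering \<omega> i = rev ts" by (simp add: reverse_ordering_def ts_def)
  obtain j where j: "j < length ts" "t = rev ts ! j" using i(2) unfolding rev in_set_conv_nth by auto
  \<comment> \<open>\<open>?k\<close> is the index in \<open>ts\<close> of the entry that follows
    \<open>t\<close> cyclically in \<open>rev ts\<close>; its cyclic successor in \<open>ts\<close>
    is \<open>t\<close> again.\<close>
  let ?k = "length ts - Suc (Suc j mod length ts)"
  have l: "0 < length ts" using j by auto
  then have m: "Suc j mod length ts < length ts" by simp
  have "ordering_perm l (reverse_ordering \<omega>) t = rev ts ! (Suc j mod length ts)"
    using ordering_perm_nth[where \<omega> = "reverse_ordering \<omega>" and j = j, OF B.distinct B.disjoint i(1)] j by (simp add: rev)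
  also have "\<dots> = ts ! ?k" using m by (simp add: rev_nth)
  finally have "ordering_perm l \<omega> (ordering_perm l (reverse_ordering \<omega>) t) =
      ts ! (Suc ?k mod length ts)"
    using ordering_perm_nth[where \<omega> = \<omega> and j = ?k, OF A.distinct A.disjoint i(1)] l by (simp add: ts_def)
  also have "Suc ?k mod length ts = length ts - Suc j"
  proof (cases "Suc j = length ts")
    case False
    then have "Suc j < length ts" using j by simp
    then show ?thesis by simp
  qed (use l in simp)
  also have "ts ! (length ts - Suc j) = t" using j by (simp add: rev_nth)
  finally show ?thesis .
qed

theorem theorem6p4:
  fixes m n h k :: nat and v :: int and A :: pf_array
    and \<omega>r \<omega>c :: "nat \<Rightarrow> int list"
  assumes "1 \<le> k" "k \<le> m" "1 \<le> h" "h \<le> n" "m * h = n * k"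
    and "v = 2 * int n * int k + 1"
    and "NH m n h k A"
    and "simple_row_orderings v m n A \<omega>r"
    and "simple_col_orderings v m n A \<omega>c"
    and "compatible m n A \<omega>r \<omega>c"
  shows "\<exists>(S :: complex topology) \<psi>.
           surface S \<and> orientable S \<and>
           biembedding {0..<v} (complete_edges {0..<v})
             (circuits_of v (path_decomposition v m (reverse_ordering \<omega>r)))
             (circuits_of v (path_decomposition v n \<omega>c)) S \<psi> \<and>
           cellular {0..<v} (complete_edges {0..<v}) S \<psi>"
proof -
  note NH = assms(7) and v = assms(6)
  have nz: "0 \<notin> entries m n A" by (rule NH_nonzero[OF NH v assms(8)])
  have rows: "distinct (\<omega>r i) \<and> set (\<omega>r i) = entry A ` row_cells m n A i" if "i < m" for i
    using assms(8) that by (simp add: simple_row_orderings_def simple_ordering_def)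
  have cols: "distinct (\<omega>c j) \<and> set (\<omega>c j) = entry A ` col_cells m n A j" if "j < n" for j
    using assms(9) that by (simp add: simple_col_orderings_def simple_ordering_def)
  have "card (row_cells m n A i) = h" if "i < m" for i using NH that by (simp add: NH_def Let_def)
  then have R1: "row_cells m n A i \<noteq> {}" if "i < m" for i using that assms(3) by force
  have "card (col_cells m n A j) = k" if "j < n" for j using NH that by (simp add: NH_def Let_def)
  then have C1: "col_cells m n A j \<noteq> {}" if "j < n" for j using that assms(1) by force
  have R2: "row_cells m n A i \<inter> row_cells m n A j = {}" if "i \<noteq> j" for i j
    using that by (auto simp: row_cells_def)
  have C2: "col_cells m n A i \<inter> col_cells m n A j = {}" if "i \<noteq> j" for i j
    using that by (auto simp: col_cells_def)
  have R3: "(\<Union>i<m. row_cells m n A i) = filled_cells m n A"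
    by (auto simp: row_cells_def filled_cells_def)
  have C3: "(\<Union>j<n. col_cells m n A j) = filled_cells m n A"
    by (auto simp: col_cells_def filled_cells_def)
  have R: "ordering_system v (entries m n A) m \<omega>r"
    by (rule ordering_system_NH[OF NH v nz rows R1 R2 R3])
  have R': "ordering_system v (entries m n A) m (reverse_ordering \<omega>r)"
    by (rule ordering_system_NH[OF NH v nz _ R1 R2 R3]) (use rows in \<open>simp add: reverse_ordering_def\<close>)
  have C: "ordering_system v (entries m n A) n \<omega>c"
    by (rule ordering_system_NH[OF NH v nz cols C1 C2 C3])
  show ?thesis
  proof (rule biembedding_of_orderings[OF R' C])
    show "cyclic_on (ordering_perm n \<omega>c \<circ> ordering_perm m \<omega>r) (entries m n A)"
      using assms(10) by (simp add: compatible_def)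
    \<comment> \<open>From the predecessor of \<open>t\<close> in its row, the compatible
      composition steps to \<open>t\<close> and on to the successor of \<open>t\<close> in its
      column; this is why the rows enter reversed.\<close>
    show "(ordering_perm n \<omega>c \<circ> ordering_perm m \<omega>r) (ordering_perm m (reverse_ordering \<omega>r) t) =
        ordering_perm n \<omega>c t" if "t \<in> entries m n A" for t
      using ordering_perm_reverse[OF R R' that] by simp
  qed
qed

end
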